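(* Let $q$ be a prime power. Consider the maximal curve $\mathcal{X}/\mathbb{F}_{q^2}$ defined by the equation $y^{\beta}=A(x)$, where $A(x)$ is an additive separable polynomial (over $\mathbb{F}_{q^2}$) of degree $\alpha$. Let $\eta,\lambda\in\mathbb{F}_{q^2}^\times$, and define $u:=\mathrm{ord}(\eta)$, $v:=\mathrm{ord}(\lambda)$ (multiplicative orders). Assume that $u$ and $v$ are divisors of $\beta$, with $1<u\leq v$ and $\gcd(u,v)=m>1$. Then, for integers $t_1,t_2\ge 0$ with $t_1\leq (v-2)/u$ and $t_2\leq\alpha-2$, there exists an $$[\,n,\ (t_1+1)(t_2+1),\ d\geq n-\alpha u t_1-\beta t_2;\ t_2+1,\ t_1+1\,]$$ locally recoverable code over $\mathbb{F}_{q^2}$, where $n:=q^2+(\beta-1)(\alpha-1)q-\alpha$.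
   Context: By a curve is meant a smooth, projective, absolutely irreducible curve; a curve given by an affine equation means the smooth projective model of the absolutely irreducible curve given by that equation. A curve $\mathcal{X}$ of genus $g$ over $\mathbb{F}_{q^2}$ is maximal over $\mathbb{F}_{q^2}$ if $\#\mathcal{X}(\mathbb{F}_{q^2})=q^2+1+2gq$. A polynomial $A(x)$ over a field of characteristic $p$ is additive if $A(a+b)=A(a)+A(b)$ identically, i.e. $A(x)=\sum_i a_i x^{p^i}$. Locally recoverable codes (LRCs): let $C\subseteq\mathbb{F}_\ell^n$ be a linear code over the finite field $\mathbb{F}_\ell$ ($\ell$ a prime power). For $\gamma\in\mathbb{F}_\ell$ and $i\in\{1,\dots,n\}$ let $C(i,\gamma)=\{c\in C: c_i=\gamma\}$, and for nonempty $I\subseteq\{1,\dots,n\}\setminus\{i\}$ let $C_I(i,\gamma)$ be the projection of $C(i,\gamma)$ to $\mathbb{F}_\ell^I$. The set $I$ is a recovery set for coordinate $i$ if $C_I(i,\gamma)\cap C_I(i,\gamma')=\emptyset$ for all $\gamma\neq\gamma'$ in $\mathbb{F}_\ell$. An $[n,k,d;r_1,\dots,r_t]$ LRC over $\mathbb{F}_\ell$ is a linear code $C\subseteq\mathbb{F}_\ell^n$ of length $n$, dimension $k$ and minimum (Hamming) distance $d$ such that every coordinate $i$ has $t$ pairwise disjoint recovery sets, of cardinalities $r_1,\dots,r_t$ respectively. Writing "$d\ge D$" in the parameters means the minimum distance is at least $D$.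
   Formalization: The formal theorem additionally assumes gcd(α,β)=1; without it the claim fails, e.g. q=3, y^12=x^3+x (birational to the Hermitian curve), u=2, v=4, t_1=1, t_2=0 would give a [72,2,d≥66] code over F_9, contradicting the Plotkin bound. *)

theory Defs
  imports
    "HOL-Algebra.Algebraic_Closure_Type"
    "HOL-Number_Theory.Prime_Powers"
    "HOL-Computational_Algebra.Polynomial"
    "HOL-Library.Cardinality"
    "HOL-Library.Function_Algebras"
    "HOL-Library.FuncSet"
    "HOL-Library.Disjoint_Sets"
begin

section \<open>Curves as function fields\<close>

text \<open>
  A plane curve over a field \<^typ>\<open>'a\<close> is given by a polynomial of type \<^typ>\<open>'a poly poly\<close>:
  the outer variable is $y$, the inner one is $x$.  Its smooth projective model is handled as
  the abstract nonsingular curve of its function field: a field \<^typ>\<open>'f\<close> containing the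
  constants via an embedding \<open>\<iota>\<close>, whose closed points are the discrete valuations of \<^typ>\<open>'f\<close>
  that are trivial on the constants.
\<close>

definition eval2 :: "('a::field \<Rightarrow> 'f::field) \<Rightarrow> 'f \<Rightarrow> 'f \<Rightarrow> 'a poly poly \<Rightarrow> 'f" where
  "eval2 \<iota> x y G = poly (map_poly (\<lambda>p. poly (map_poly \<iota> p) x) G) y"

definition absolutely_irreducible :: "'a::field poly poly \<Rightarrow> bool" where
  "absolutely_irreducible G \<longleftrightarrow> irreducible (map_poly (map_poly to_ac) G)"

definition field_embedding :: "('a::field \<Rightarrow> 'f::field) \<Rightarrow> bool" where
  "field_embedding \<iota> \<longleftrightarrow> \<iota> 1 = 1 \<and> (\<forall>a b. \<iota> (a + b) = \<iota> a + \<iota> b) \<and> (\<forall>a b. \<iota> (a * b) = \<iota> a * \<iota> b)"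

text \<open>
  \<^typ>\<open>'f\<close> is the field of fractions of $K[x,y]/(G)$, with \<open>x\<close> and \<open>y\<close> the classes of the
  two variables.
\<close>

definition is_function_field ::
  "('a::field \<Rightarrow> 'f::field) \<Rightarrow> 'f \<Rightarrow> 'f \<Rightarrow> 'a poly poly \<Rightarrow> bool" where
  "is_function_field \<iota> x y G \<longleftrightarrow>
     field_embedding \<iota> \<and>
     (\<forall>H. eval2 \<iota> x y H = 0 \<longleftrightarrow> G dvd H) \<and>
     (\<forall>z. \<exists>H1 H2. eval2 \<iota> x y H2 \<noteq> 0 \<and> z = eval2 \<iota> x y H1 / eval2 \<iota> x y H2)"

text \<open>
  The value of a valuation at \<open>0\<close> (mathematically $\infty$) is set to \<open>0\<close>, so that distinct
  functions represent distinct places.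
\<close>

definition place :: "('a::field \<Rightarrow> 'f::field) \<Rightarrow> ('f \<Rightarrow> int) \<Rightarrow> bool" where
  "place \<iota> v \<longleftrightarrow>
     v 0 = 0 \<and>
     (\<forall>c. c \<noteq> 0 \<longrightarrow> v (\<iota> c) = 0) \<and>
     (\<forall>f g. f \<noteq> 0 \<longrightarrow> g \<noteq> 0 \<longrightarrow> v (f * g) = v f + v g) \<and>
     (\<forall>f g. f \<noteq> 0 \<longrightarrow> g \<noteq> 0 \<longrightarrow> f + g \<noteq> 0 \<longrightarrow> min (v f) (v g) \<le> v (f + g)) \<and>
     (\<exists>t. v t = 1)"

definition valuation_ring :: "('f::field \<Rightarrow> int) \<Rightarrow> 'f set" where
  "valuation_ring v = {f. f = 0 \<or> 0 \<le> v f}"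

definition maximal_ideal :: "('f::field \<Rightarrow> int) \<Rightarrow> 'f set" where
  "maximal_ideal v = {f. f = 0 \<or> 0 < v f}"

text \<open>
  The dimension over the constants of the residue field of \<open>v\<close>, as the largest size of a set
  that is linearly independent modulo the maximal ideal.
\<close>

definition place_degree :: "('a::field \<Rightarrow> 'f::field) \<Rightarrow> ('f \<Rightarrow> int) \<Rightarrow> nat" where
  "place_degree \<iota> v =
     (GREATEST d. \<exists>B \<subseteq> valuation_ring v. finite B \<and> card B = d \<and>
        (\<forall>c. (\<Sum>b\<in>B. \<iota> (c b) * b) \<in> maximal_ideal v \<longrightarrow> (\<forall>b\<in>B. c b = 0)))"

text \<open>The rational points of the smooth model: the places with residue field \<open>\<iota> ` UNIV\<close>.\<close>

definition rational_places :: "('a::field \<Rightarrow> 'f::field) \<Rightarrow> ('f \<Rightarrow> int) set" where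
  "rational_places \<iota> =
     {v. place \<iota> v \<and> (\<forall>f\<in>valuation_ring v. \<exists>c. f - \<iota> c \<in> maximal_ideal v)}"

definition divisor :: "('a::field \<Rightarrow> 'f::field) \<Rightarrow> (('f \<Rightarrow> int) \<Rightarrow> int) \<Rightarrow> bool" where
  "divisor \<iota> D \<longleftrightarrow> finite {v. D v \<noteq> 0} \<and> {v. D v \<noteq> 0} \<subseteq> {v. place \<iota> v}"

definition divisor_degree :: "('a::field \<Rightarrow> 'f::field) \<Rightarrow> (('f \<Rightarrow> int) \<Rightarrow> int) \<Rightarrow> int" where
  "divisor_degree \<iota> D = (\<Sum>v | D v \<noteq> 0. D v * int (place_degree \<iota> v))"

definition riemann_roch_space ::
  "('a::field \<Rightarrow> 'f::field) \<Rightarrow> (('f \<Rightarrow> int) \<Rightarrow> int) \<Rightarrow> 'f set" where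
  "riemann_roch_space \<iota> D = {f. f = 0 \<or> (\<forall>v. place \<iota> v \<longrightarrow> - D v \<le> v f)}"

definition ell :: "('a::field \<Rightarrow> 'f::field) \<Rightarrow> (('f \<Rightarrow> int) \<Rightarrow> int) \<Rightarrow> nat" where
  "ell \<iota> D = vector_space.dim (\<lambda>c f. \<iota> c * f) (riemann_roch_space \<iota> D)"

text \<open>
  The genus is the maximum of $\deg D - \ell(D) + 1$ over all divisors $D$.  This is the genus
  of the curve when the constants are algebraically closed in \<^typ>\<open>'f\<close>, as they are for
  an absolutely irreducible equation.
\<close>

definition has_genus :: "('a::field \<Rightarrow> 'f::field) \<Rightarrow> nat \<Rightarrow> bool" where
  "has_genus \<iota> g \<longleftrightarrow>
     (\<exists>D. divisor \<iota> D \<and> divisor_degree \<iota> D - int (ell \<iota> D) + 1 = int g) \<and>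
     (\<forall>D. divisor \<iota> D \<longrightarrow> divisor_degree \<iota> D - int (ell \<iota> D) + 1 \<le> int g)"

text \<open>To be used with a field of constants of cardinality $q^2$.\<close>

definition maximal_curve :: "nat \<Rightarrow> ('a::field \<Rightarrow> 'f::field) \<Rightarrow> bool" where
  "maximal_curve q \<iota> \<longleftrightarrow>
     (\<exists>g. has_genus \<iota> g \<and> card (rational_places \<iota>) = q\<^sup>2 + 1 + 2 * g * q)"

lemma vector_space_over_constants:
  assumes "field_embedding \<iota>"
  shows "vector_space (\<lambda>c f. \<iota> c * f)"
  using assms unfolding field_embedding_def
  by unfold_locales (simp_all add: algebra_simps)


section \<open>Additive and separable polynomials, multiplicative order\<close>

definition additive_poly :: "'a::field poly \<Rightarrow> bool" where
  "additive_poly A \<longleftrightarrow> (\<exists>m a. A = (\<Sum>i\<le>m. monom (a i) (CHAR('a) ^ i)))"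

definition separable_poly :: "'a::field poly \<Rightarrow> bool" where
  "separable_poly A \<longleftrightarrow> coprime A (pderiv A)"

text \<open>
  Meaningful for roots of unity only, hence for all nonzero elements of a finite field.
\<close>

definition mult_order :: "'a::field \<Rightarrow> nat" where
  "mult_order a = (LEAST k. 0 < k \<and> a ^ k = 1)"


section \<open>Locally recoverable codes\<close>

text \<open>
  Words of length \<open>n\<close> are functions on \<^typ>\<open>nat\<close> that vanish outside the coordinates
  \<open>{..<n}\<close>; this makes them a vector space of dimension \<open>n\<close>.
\<close>

definition words :: "nat \<Rightarrow> (nat \<Rightarrow> 'a::field) set" where
  "words n = {c. \<forall>i\<ge>n. c i = 0}"

abbreviation word_scale :: "'a::field \<Rightarrow> (nat \<Rightarrow> 'a) \<Rightarrow> nat \<Rightarrow> 'a" where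
  "word_scale \<equiv> \<lambda>a c i. a * c i"

lemma vector_space_word_scale: "vector_space (word_scale :: 'a::field \<Rightarrow> _)"
  by unfold_locales (simp_all add: fun_eq_iff algebra_simps)

definition linear_code :: "nat \<Rightarrow> (nat \<Rightarrow> 'a::field) set \<Rightarrow> bool" where
  "linear_code n C \<longleftrightarrow> C \<subseteq> words n \<and> module.subspace word_scale C"

definition code_dim :: "(nat \<Rightarrow> 'a::field) set \<Rightarrow> nat" where
  "code_dim C = vector_space.dim word_scale C"

definition hamming_dist :: "nat \<Rightarrow> (nat \<Rightarrow> 'a) \<Rightarrow> (nat \<Rightarrow> 'a) \<Rightarrow> nat" where
  "hamming_dist n c c' = card {i. i < n \<and> c i \<noteq> c' i}"

text \<open>Meaningful for codes with at least two words.\<close>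

definition min_dist :: "nat \<Rightarrow> (nat \<Rightarrow> 'a) set \<Rightarrow> nat" where
  "min_dist n C = Min {hamming_dist n c c' |c c'. c \<in> C \<and> c' \<in> C \<and> c \<noteq> c'}"

definition projections :: "(nat \<Rightarrow> 'a) set \<Rightarrow> nat set \<Rightarrow> nat \<Rightarrow> 'a \<Rightarrow> (nat \<Rightarrow> 'a) set" where
  "projections C I i \<gamma> = (\<lambda>c. restrict c I) ` {c \<in> C. c i = \<gamma>}"

definition recovery_set :: "nat \<Rightarrow> (nat \<Rightarrow> 'a) set \<Rightarrow> nat \<Rightarrow> nat set \<Rightarrow> bool" where
  "recovery_set n C i I \<longleftrightarrow>
     I \<noteq> {} \<and> I \<subseteq> {..<n} - {i} \<and>
     (\<forall>\<gamma> \<gamma>'. \<gamma> \<noteq> \<gamma>' \<longrightarrow> projections C I i \<gamma> \<inter> projections C I i \<gamma>' = {})"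

text \<open>\<open>C\<close> is an $[n,k,d;r_1,\dots,r_t]$ locally recoverable code, with \<open>rs\<close> the list $[r_1,\dots,r_t]$.\<close>

definition is_LRC :: "nat \<Rightarrow> nat \<Rightarrow> nat \<Rightarrow> nat list \<Rightarrow> (nat \<Rightarrow> 'a::field) set \<Rightarrow> bool" where
  "is_LRC n k d rs C \<longleftrightarrow>
     linear_code n C \<and> code_dim C = k \<and> min_dist n C = d \<and>
     (\<forall>i<n. \<exists>I. disjoint_family_on I {..<length rs} \<and>
        (\<forall>j<length rs. recovery_set n C i (I j) \<and> card (I j) = rs ! j))"

end

theory Submission
  imports
    Defs
    "HOL-Computational_Algebra.Formal_Laurent_Series"
    "HOL-Computational_Algebra.Polynomial_FPS"
    "HOL-Number_Theory.Cong"
begin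

text \<open>
  The code evaluates the functions \<open>x^j y^(u i)\<close>, \<open>i \<le> t1\<close> and \<open>j \<le> t2\<close>, at the rational points of the curve
  \<open>y^\<beta> = A(x)\<close> with \<open>y \<noteq> 0\<close>.  At infinity \<open>x\<close> has a pole of order \<open>\<beta>\<close> and \<open>y\<close> one of order \<open>\<alpha>\<close>, so a
  combination of these functions has at most \<open>\<alpha> u t1 + \<beta> t2\<close> zeros.  Translating \<open>x\<close> by roots of \<open>A\<close> leaves \<open>y\<close>
  unchanged and makes a word a polynomial of degree at most \<open>t2\<close> in \<open>x\<close>; replacing \<open>y\<close> by \<open>\<eta> y\<close>
  leaves every word unchanged, since \<open>\<eta>^u = 1\<close>.  This yields the two recovery sets (\<open>exists_LRC\<close>).

  The construction needs that there are exactly \<open>n\<close> points with \<open>y \<noteq> 0\<close> and that all roots of \<open>A\<close> and all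
  \<open>\<beta>\<close>-th roots of unity lie in the base field.  Both follow from maximality (\<open>maximal_counts\<close>), by
  squeezing the number of points between two bounds.

  The upper bound (\<open>card_affine_points_le\<close>) is a character sum estimate.  It is proved by a second moment
  argument with Cauchy--Schwarz and involves the numbers of roots that are rational, which is why
  equality forces all of them to be rational.

  The lower bound (\<open>genus_ge\<close> and \<open>card_rational_places_le\<close>) needs the genus, which is defined through all
  divisors and places of the function field.  One divisor suffices: a multiple of the place at infinity.
  Its Riemann--Roch space is spanned by monomials, because a function that is regular at all affine
  places is a polynomial in \<open>x\<close> and \<open>y\<close> (\<open>regular_imp_polynomial\<close>).  The places are constructed by embedding
  the function field into fields of Laurent series: at a point of the affine curve over the algebraic
  closure \<open>x\<close> is a power series in \<open>y - b\<close>, since \<open>A'\<close> is a nonzero constant (\<open>affine_branch\<close>), and at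
  infinity a \<open>\<beta>\<close>-th root of a power series is taken (\<open>infinite_branch\<close>).  Conversely a rational place is
  determined by its center, or by having a pole of \<open>x\<close>; this bounds the number of rational places.

  The number of zeros of a function is bounded by its pole order by counting
  functions of bounded pole order over the finite base field (\<open>card_zeros_le_valuation\<close>).
\<close>

unbundle Formal_Power_Series.fps_syntax


section \<open>Points on $y^\beta = A(x)$ over a finite field\<close>

lemma finite_field_char_prime: "prime CHAR('a::{field,finite})"
  by (intro prime_CHAR_semidom finite_imp_CHAR_pos) auto

text \<open>
  A maximal proper additive subgroup \<open>H\<close> and any \<open>z \<notin> H\<close> generate the whole field, and \<open>k z \<in> H\<close>
  only when the characteristic \<open>p\<close> divides \<open>k\<close>.  So every element is congruent modulo \<open>H\<close> to \<open>k z\<close> for a \<open>k\<close>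
  that is unique modulo \<open>p\<close>, and \<open>e^(2 \<pi> i k / p)\<close> is a character.
\<close>

lemma exists_additive_character:
  obtains \<psi> :: "'a::{field,finite} \<Rightarrow> complex"
  where "\<And>a b. \<psi> (a + b) = \<psi> a * \<psi> b" and "\<And>a. norm (\<psi> a) = 1" and "\<exists>z. \<psi> z \<noteq> 1"
proof -
  define p where "p = CHAR('a)"
  have p: "prime p" unfolding p_def by (rule finite_field_char_prime)
  hence p2: "p \<ge> 2" by (rule prime_ge_2_nat)
  have p0: "of_nat p = (0::'a)" by (simp add: p_def)
  define sub where "sub = (\<lambda>H::'a set. 0 \<in> H \<and> (\<forall>a\<in>H. \<forall>b\<in>H. a + b \<in> H) \<and> (\<forall>a\<in>H. - a \<in> H))"
  let ?F = "{H. sub H \<and> H \<noteq> UNIV}"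
  have "{0} \<in> ?F"
  proof -
    have "{0} \<noteq> (UNIV :: 'a set)" by (metis UNIV_I one_neq_zero singletonD)
    thus ?thesis by (auto simp: sub_def)
  qed
  hence "?F \<noteq> {}" by blast
  then obtain H where H: "sub H" "H \<noteq> UNIV" and max: "\<And>G. sub G \<Longrightarrow> G \<noteq> UNIV \<Longrightarrow> H \<subseteq> G \<Longrightarrow> H = G"
    using finite_has_maximal[of ?F] by auto
  have H0: "0 \<in> H" and Hadd: "\<And>a b. a \<in> H \<Longrightarrow> b \<in> H \<Longrightarrow> a + b \<in> H" and Hneg: "\<And>a. a \<in> H \<Longrightarrow> - a \<in> H"
    using H(1) by (auto simp: sub_def)
  have Hnat: "of_nat k * h \<in> H" if "h \<in> H" for k h
    by (induction k) (use that in \<open>auto simp: H0 algebra_simps intro: Hadd\<close>)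
  have Hint: "of_int k * h \<in> H" if "h \<in> H" for k h
    by (cases k) (use Hnat[OF that] Hneg[OF Hnat[OF that]] in \<open>auto simp del: of_nat_Suc\<close>)
  obtain z where z: "z \<notin> H" using H(2) by blast
  define G where "G = {h + of_int k * z | h k. h \<in> H}"
  have "sub G"
    unfolding sub_def
  proof (intro conjI ballI)
    show "0 \<in> G" unfolding G_def using H0 by (auto intro!: exI[of _ 0])
  next
    fix a b assume "a \<in> G" "b \<in> G"
    then obtain h k h' k' where *: "a = h + of_int k * z" "b = h' + of_int k' * z" "h \<in> H" "h' \<in> H"
      unfolding G_def by blast
    have "a + b = (h + h') + of_int (k + k') * z" by (simp add: * algebra_simps)
    thus "a + b \<in> G" unfolding G_def using Hadd[OF *(3,4)] by blast
  next
    fix a assume "a \<in> G"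
    then obtain h k where *: "a = h + of_int k * z" "h \<in> H" unfolding G_def by blast
    have "- a = - h + of_int (- k) * z" by (simp add: * algebra_simps)
    thus "- a \<in> G" unfolding G_def using Hneg[OF *(2)] by blast
  qed
  moreover have "H \<subseteq> G"
  proof
    fix h assume "h \<in> H"
    moreover have "h = h + of_int 0 * z" by simp
    ultimately show "h \<in> G" unfolding G_def by blast
  qed
  moreover have "z = 0 + of_int 1 * z" by simp
  hence "z \<in> G" unfolding G_def using H0 by blast
  ultimately have G: "G = UNIV" using max z by blast
  have dvd: "int p dvd j" if j: "of_int j * z \<in> H" for j
  proof (rule ccontr)
    assume "\<not> int p dvd j"
    hence "coprime (int p) j" using p by (simp add: prime_imp_coprime)
    then obtain r s where rs: "r * int p + s * j = 1"
      using bezout_int[of "int p" j] by auto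
    have "z = of_int (r * int p + s * j) * z" by (simp add: rs)
    also have "\<dots> = of_int s * (of_int j * z)" by (simp add: p0 algebra_simps)
    also have "\<dots> \<in> H" by (rule Hint[OF j])
    finally show False using z by contradiction
  qed
  define e where "e = (\<lambda>k::int. cis (2 * pi * of_int k / of_nat p))"
  have e_add: "e (k + l) = e k * e l" for k l
    by (simp add: e_def cis_mult ring_distribs add_divide_distrib)
  have e_eq: "e k = 1" if dvd_k: "int p dvd k" for k
  proof -
    obtain l where "k = int p * l" using dvd_k by blast
    hence "2 * pi * of_int k / of_nat p = 2 * pi * of_int l" using p2 by simp
    thus ?thesis unfolding e_def by (metis Ints_of_int cis_multiple_2pi)
  qed
  define \<kappa> where "\<kappa> = (\<lambda>a. SOME k::int. a - of_int k * z \<in> H)"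
  have \<kappa>: "a - of_int (\<kappa> a) * z \<in> H" for a
  proof -
    have "a \<in> G" using G by simp
    then obtain h k where "a = h + of_int k * z" "h \<in> H" unfolding G_def by blast
    hence "a - of_int k * z \<in> H" by simp
    thus ?thesis unfolding \<kappa>_def by (rule someI)
  qed
  define \<psi> where "\<psi> = (\<lambda>a. e (\<kappa> a))"
  have \<psi>_eq: "\<psi> a = e k" if "a - of_int k * z \<in> H" for a k
  proof -
    have "of_int (\<kappa> a - k) * z = (a - of_int k * z) + - (a - of_int (\<kappa> a) * z)"
      by (simp add: algebra_simps)
    also have "\<dots> \<in> H" by (intro Hadd Hneg that \<kappa>)
    finally have "e (\<kappa> a - k) = 1" using dvd e_eq by blast
    hence "e (\<kappa> a - k + k) = e k" unfolding e_add by simp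
    thus ?thesis by (simp add: \<psi>_def)
  qed
  show thesis
  proof (rule that[of \<psi>])
    fix a b
    have "a + b - of_int (\<kappa> a + \<kappa> b) * z = (a - of_int (\<kappa> a) * z) + (b - of_int (\<kappa> b) * z)"
      by (simp add: algebra_simps)
    also have "\<dots> \<in> H" by (intro Hadd \<kappa>)
    finally have "\<psi> (a + b) = e (\<kappa> a + \<kappa> b)" by (rule \<psi>_eq)
    thus "\<psi> (a + b) = \<psi> a * \<psi> b" by (simp add: e_add \<psi>_def)
  next
    show "norm (\<psi> a) = 1" for a by (simp add: \<psi>_def e_def)
  next
    have "\<psi> z = e 1" by (rule \<psi>_eq) (simp add: H0)
    moreover have "e 1 \<noteq> 1"
    proof
      assume "e 1 = 1"
      hence "cos (2 * pi / of_nat p) = 1" by (simp add: e_def complex_eq_iff)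
      moreover have "cos (2 * pi / of_nat p) < cos 0"
        using p2 by (intro cos_monotone_0_pi) (auto simp: field_simps)
      ultimately show False by simp
    qed
    ultimately show "\<exists>z. \<psi> z \<noteq> 1" by metis
  qed
qed

text \<open>
  The Cauchy--Schwarz inequality against the constant 1: the variance is nonnegative.
\<close>

lemma square_of_sum_le:
  fixes f :: "'b \<Rightarrow> real"
  shows "(\<Sum>i\<in>I. f i)\<^sup>2 \<le> of_nat (card I) * (\<Sum>i\<in>I. (f i)\<^sup>2)"
proof (cases "finite I \<and> I \<noteq> {}")
  case True
  define n where "n = real (card I)"
  define t where "t = (\<Sum>i\<in>I. f i) / n"
  have n: "n > 0" using True by (auto simp: n_def card_gt_0_iff)
  have "0 \<le> (\<Sum>i\<in>I. (f i - t)\<^sup>2)" by (simp add: sum_nonneg)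
  also have "\<dots> = (\<Sum>i\<in>I. (f i)\<^sup>2) - 2 * t * (\<Sum>i\<in>I. f i) + n * t\<^sup>2"
    by (simp add: power2_diff sum.distrib sum_subtractf n_def flip: sum_distrib_left sum_distrib_right)
  also have "\<dots> = (\<Sum>i\<in>I. (f i)\<^sup>2) - (\<Sum>i\<in>I. f i)\<^sup>2 / n"
    using n by (simp add: t_def power2_eq_square field_simps)
  finally show ?thesis using n by (simp add: field_simps n_def)
qed auto

locale additive_character =
  fixes \<psi> :: "'a::{field,finite} \<Rightarrow> complex"
  assumes add: "\<psi> (a + b) = \<psi> a * \<psi> b"
    and norm_1 [simp]: "norm (\<psi> a) = 1"
    and nontrivial: "\<exists>z. \<psi> z \<noteq> 1"
begin

lemma zero [simp]: "\<psi> 0 = 1"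
  using add[of 0 0] norm_1[of 0] by (metis add_0 mult_cancel_left1 norm_zero zero_neq_one)

lemma neg: "\<psi> (- a) = cnj (\<psi> a)"
proof -
  have "\<psi> (- a) * \<psi> a = 1" using add[of "- a" a] by simp
  moreover have "cnj (\<psi> a) * \<psi> a = 1"
    using complex_norm_square[of "\<psi> a"] by (simp add: mult.commute)
  moreover have "\<psi> a \<noteq> 0" using norm_1[of a] by force
  ultimately show ?thesis by (metis mult_right_cancel)
qed

lemma sum_over_subgroup:
  assumes "w \<in> W" and "\<And>a. a \<in> W \<Longrightarrow> a + w \<in> W" and "\<psi> (c * w) \<noteq> 1"
  shows "(\<Sum>a\<in>W. \<psi> (c * a)) = 0"
proof -
  have "inj_on (\<lambda>a. a + w) W" by (simp add: inj_on_def)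
  moreover from this have "(\<lambda>a. a + w) ` W = W"
    using assms(2) by (intro card_seteq) (auto simp: card_image)
  ultimately have "bij_betw (\<lambda>a. a + w) W W" by (simp add: bij_betw_def)
  hence "(\<Sum>a\<in>W. \<psi> (c * a)) = (\<Sum>a\<in>W. \<psi> (c * (a + w)))"
    by (rule sum.reindex_bij_betw[symmetric])
  also have "\<dots> = (\<Sum>a\<in>W. \<psi> (c * a)) * \<psi> (c * w)"
    by (simp add: ring_distribs add sum_distrib_right)
  finally show ?thesis using assms(3) by simp
qed

lemma orthogonality: "(\<Sum>a\<in>UNIV. \<psi> (a * c)) = (if c = 0 then of_nat CARD('a) else 0)"
proof (cases "c = 0")
  case False
  obtain z where z: "\<psi> z \<noteq> 1" using nontrivial by blast
  have "(\<Sum>a\<in>UNIV. \<psi> (c * a)) = 0"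
    by (rule sum_over_subgroup[of "z / c"]) (use False z in auto)
  thus ?thesis using False by (simp add: mult.commute)
qed auto

end

lemma card_same_power:
  fixes y :: "'a::field"
  assumes "y \<noteq> 0"
  shows "card {z. z ^ \<beta> = y ^ \<beta>} = card {z::'a. z ^ \<beta> = 1}"
proof -
  have "bij_betw (\<lambda>z. y * z) {z. z ^ \<beta> = 1} {z. z ^ \<beta> = y ^ \<beta>}"
    by (rule bij_betw_byWitness[where f' = "\<lambda>z. z / y"])
       (use assms in \<open>auto simp: power_mult_distrib power_divide\<close>)
  thus ?thesis by (simp add: bij_betw_same_card)
qed

context additive_character begin

definition power_sum :: "nat \<Rightarrow> 'a \<Rightarrow> complex" where
  "power_sum \<beta> c = (\<Sum>y\<in>UNIV. \<psi> (c * y ^ \<beta>))"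

lemma power_sum_0: "power_sum \<beta> 0 = of_nat CARD('a)"
  by (simp add: power_sum_def)

lemma sum_power_sum:
  assumes "\<beta> > 0"
  shows "(\<Sum>c\<in>UNIV. power_sum \<beta> c) = of_nat CARD('a)"
proof -
  have "(\<Sum>c\<in>UNIV. power_sum \<beta> c) = (\<Sum>y\<in>UNIV. \<Sum>c\<in>UNIV. \<psi> (c * y ^ \<beta>))"
    unfolding power_sum_def by (rule sum.swap)
  also have "\<dots> = (\<Sum>y\<in>UNIV. if (y::'a) = 0 then of_nat CARD('a) else 0)"
    using assms by (simp add: orthogonality)
  finally show ?thesis by simp
qed

text \<open>
  Expanding the square and using orthogonality leaves the number of pairs \<open>(y, z)\<close> with \<open>y^\<beta> = z^\<beta>\<close>.
\<close>

lemma second_moment: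
  assumes "\<beta> > 0"
  shows "(\<Sum>c\<in>UNIV. (norm (power_sum \<beta> c))\<^sup>2) =
           CARD('a) * (1 + (real CARD('a) - 1) * card {z::'a. z ^ \<beta> = 1})"
proof -
  let ?Q = "CARD('a)" and ?d = "card {z::'a. z ^ \<beta> = 1}"
  have "of_real (\<Sum>c\<in>UNIV. (norm (power_sum \<beta> c))\<^sup>2) = (\<Sum>c\<in>UNIV. power_sum \<beta> c * cnj (power_sum \<beta> c))"
    by (simp only: of_real_sum complex_norm_square)
  also have "\<dots> = (\<Sum>c\<in>UNIV. \<Sum>y\<in>UNIV. \<Sum>z\<in>UNIV. \<psi> (c * (y ^ \<beta> - z ^ \<beta>)))"
  proof (rule sum.cong[OF refl])
    fix c
    have "\<psi> (c * y ^ \<beta>) * cnj (\<psi> (c * z ^ \<beta>)) = \<psi> (c * (y ^ \<beta> - z ^ \<beta>))" for y z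
      using add[of "c * y ^ \<beta>" "- (c * z ^ \<beta>)"] by (simp add: neg algebra_simps)
    thus "power_sum \<beta> c * cnj (power_sum \<beta> c) = (\<Sum>y\<in>UNIV. \<Sum>z\<in>UNIV. \<psi> (c * (y ^ \<beta> - z ^ \<beta>)))"
      unfolding power_sum_def cnj_sum sum_product by simp
  qed
  also have "\<dots> = (\<Sum>y\<in>UNIV. \<Sum>z\<in>UNIV. \<Sum>c\<in>UNIV. \<psi> (c * (y ^ \<beta> - z ^ \<beta>)))"
    by (subst sum.swap, rule sum.cong[OF refl], rule sum.swap)
  also have "\<dots> = (\<Sum>y\<in>UNIV. of_nat ?Q * of_nat (card {z. z ^ \<beta> = (y::'a) ^ \<beta>}))"
  proof (rule sum.cong[OF refl])
    fix y
    have "(\<Sum>z\<in>UNIV. \<Sum>c\<in>UNIV. \<psi> (c * (y ^ \<beta> - z ^ \<beta>))) = (\<Sum>z\<in>UNIV. if z ^ \<beta> = y ^ \<beta> then of_nat ?Q else 0)"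
      unfolding orthogonality by (rule sum.cong) auto
    also have "\<dots> = of_nat ?Q * of_nat (card {z. z ^ \<beta> = y ^ \<beta>})"
      by (simp add: sum.If_cases)
    finally show "(\<Sum>z\<in>UNIV. \<Sum>c\<in>UNIV. \<psi> (c * (y ^ \<beta> - z ^ \<beta>))) = of_nat ?Q * of_nat (card {z. z ^ \<beta> = y ^ \<beta>})" .
  qed
  also have "\<dots> = of_nat ?Q * (\<Sum>y\<in>UNIV. of_nat (card {z. z ^ \<beta> = (y::'a) ^ \<beta>}))"
    by (simp add: sum_distrib_left)
  also have "(\<Sum>y\<in>UNIV. (of_nat (card {z. z ^ \<beta> = (y::'a) ^ \<beta>})::complex)) =
      of_nat (card {z. z ^ \<beta> = (0::'a) ^ \<beta>}) + (\<Sum>y\<in>UNIV - {0}. of_nat (card {z. z ^ \<beta> = (y::'a) ^ \<beta>}))"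
    by (rule sum.remove) auto
  also have "{z. z ^ \<beta> = (0::'a) ^ \<beta>} = {0}" using assms by (auto simp: power_0_left)
  also have "(\<Sum>y\<in>UNIV - {0}. (of_nat (card {z. z ^ \<beta> = (y::'a) ^ \<beta>})::complex)) = (\<Sum>y\<in>UNIV - {0::'a}. of_nat ?d)"
    by (intro sum.cong) (auto simp: card_same_power)
  also have "of_nat ?Q * (of_nat (card {0::'a}) + (\<Sum>y\<in>UNIV - {0::'a}. of_nat ?d)) =
      complex_of_real (?Q * (1 + (real ?Q - 1) * ?d))"
    by (simp add: card_Diff_singleton of_nat_diff)
  finally show ?thesis by (simp only: of_real_eq_iff)
qed

text \<open>
  This bound is usually obtained from Gauss sums; here it comes from two moments.  Let \<open>d\<close> be the
  number of \<open>\<beta>\<close>-th roots of unity in the field and \<open>M = (q^2 - 1)/d\<close>.  The sum \<open>S(c)\<close> is constant on the \<open>M\<close> elements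
  of the coset \<open>T\<close> of \<open>c0\<close> modulo \<open>\<beta>\<close>-th powers, and the sum of all \<open>S(c)\<close> with \<open>c \<noteq> 0\<close> is 0.
  A large value \<open>s = |S(c0)|\<close> therefore forces the remaining \<open>M (d - 1)\<close> values to add up to
  \<open>M s\<close> in absolute value, which by Cauchy--Schwarz costs \<open>M s^2 / (d - 1)\<close> in the second moment.  Keeping
  this contribution is what sharpens the constant from \<open>d (d - 1)\<close> to \<open>(d - 1)^2\<close>.
\<close>

lemma norm_power_sum_le:
  assumes "\<beta> > 0" and "c0 \<noteq> 0" and "CARD('a) = q\<^sup>2"
  shows "norm (power_sum \<beta> c0) \<le> (real (card {z::'a. z ^ \<beta> = 1}) - 1) * q"
proof -
  let ?Q = "real CARD('a)" and ?S = "power_sum \<beta>"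
  define d where "d = real (card {z::'a. z ^ \<beta> = 1})"
  define T where "T = (\<lambda>t. c0 * t ^ \<beta>) ` (UNIV - {0})"
  define M where "M = real (card T)"
  define R where "R = UNIV - {0} - T"
  define s where "s = norm (?S c0)"
  have T0: "0 \<notin> T" using assms(2) by (auto simp: T_def)
  have Q1: "card (UNIV - {0::'a}) = CARD('a) - 1" by (simp add: card_Diff_singleton)
  have Qgt: "CARD('a) > 1"
    using card_mono[of UNIV "{0, 1::'a}"] by simp
  have const: "?S c = ?S c0" if cT: "c \<in> T" for c
  proof -
    obtain t where t: "t \<noteq> 0" "c = c0 * t ^ \<beta>" using cT unfolding T_def by blast
    have "bij_betw (\<lambda>y. t * y) UNIV UNIV"
      by (rule bij_betw_byWitness[where f' = "\<lambda>z. z / t"]) (use t in auto)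
    hence "?S c0 = (\<Sum>y\<in>UNIV. \<psi> (c0 * (t * y) ^ \<beta>))"
      unfolding power_sum_def by (rule sum.reindex_bij_betw[symmetric])
    thus ?thesis by (simp add: power_sum_def t power_mult_distrib mult_ac)
  qed
  have dM: "d * M = ?Q - 1"
  proof -
    have "card (UNIV - {0::'a}) = (\<Sum>w\<in>T. card {t \<in> UNIV - {0}. c0 * t ^ \<beta> = w})"
      unfolding T_def using sum.image_gen[of "UNIV - {0::'a}" "\<lambda>_. 1::nat" "\<lambda>t. c0 * t ^ \<beta>"]
      by simp
    also have "\<dots> = (\<Sum>w\<in>T. card {z::'a. z ^ \<beta> = 1})"
    proof (rule sum.cong[OF refl])
      fix w assume "w \<in> T"
      then obtain t where t: "t \<noteq> 0" "w = c0 * t ^ \<beta>" by (auto simp: T_def)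
      have "{s \<in> UNIV - {0}. c0 * s ^ \<beta> = w} = {z. z ^ \<beta> = t ^ \<beta>}"
        using t assms by (auto simp: power_0_left)
      thus "card {s \<in> UNIV - {0}. c0 * s ^ \<beta> = w} = card {z::'a. z ^ \<beta> = 1}"
        using card_same_power[OF t(1)] by simp
    qed
    finally have "CARD('a) - 1 = card T * card {z::'a. z ^ \<beta> = 1}" by (simp add: Q1)
    hence "real (CARD('a) - 1) = M * d" unfolding M_def d_def by (metis of_nat_mult)
    thus ?thesis using Qgt by (simp add: of_nat_diff mult.commute)
  qed
  have split: "(\<Sum>c\<in>UNIV. f c) = f 0 + (\<Sum>c\<in>T. f c) + (\<Sum>c\<in>R. f c)" for f :: "'a \<Rightarrow> 'b::comm_monoid_add"
  proof -
    have "(\<Sum>c\<in>UNIV. f c) = f 0 + (\<Sum>c\<in>UNIV - {0}. f c)" by (rule sum.remove) auto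
    also have "(\<Sum>c\<in>UNIV - {0}. f c) = (\<Sum>c\<in>R. f c) + (\<Sum>c\<in>T. f c)"
      unfolding R_def using T0 by (intro sum.subset_diff) auto
    finally show ?thesis by (simp add: ac_simps)
  qed
  have cardR: "real (card R) = M * (d - 1)"
  proof -
    have "card R = CARD('a) - 1 - card T"
      unfolding R_def using T0 by (subst card_Diff_subset) (auto simp: Q1)
    moreover have "card T \<le> CARD('a) - 1"
      using T0 card_mono[of "UNIV - {0::'a}" T] by (auto simp: Q1)
    ultimately show ?thesis using dM Qgt by (simp add: M_def of_nat_diff algebra_simps)
  qed
  have "M \<noteq> 0" using dM Qgt by auto
  hence M: "M > 0" by (simp add: M_def card_gt_0_iff)
  have "1 \<in> {z::'a. z ^ \<beta> = 1}" by simp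
  hence d: "d \<ge> 1" unfolding d_def using card_gt_0_iff[of "{z::'a. z ^ \<beta> = 1}"] by fastforce
  have "(\<Sum>c\<in>T. ?S c) = of_nat (card T) * ?S c0" using const by simp
  hence sumR: "(\<Sum>c\<in>R. ?S c) = - of_nat (card T) * ?S c0"
    using split[of ?S] sum_power_sum[OF assms(1)] power_sum_0[of \<beta>]
    by (simp add: add_eq_0_iff2)
  have sqR: "(\<Sum>c\<in>R. (norm (?S c))\<^sup>2) = ?Q * (?Q - 1) * (d - 1) - M * s\<^sup>2"
  proof -
    have "(\<Sum>c\<in>T. (norm (?S c))\<^sup>2) = M * s\<^sup>2" using const by (simp add: M_def s_def)
    thus ?thesis using split[of "\<lambda>c. (norm (?S c))\<^sup>2"] second_moment[OF assms(1)] power_sum_0[of \<beta>]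
      by (simp add: d_def algebra_simps power2_eq_square)
  qed
  have "M * s = norm (\<Sum>c\<in>R. ?S c)" unfolding sumR by (simp add: norm_mult M_def s_def)
  also have "\<dots> \<le> (\<Sum>c\<in>R. norm (?S c))" by (rule norm_sum)
  finally have "(M * s)\<^sup>2 \<le> (\<Sum>c\<in>R. norm (?S c))\<^sup>2"
    using M by (intro power_mono) (auto simp: s_def)
  also have "\<dots> \<le> M * (d - 1) * (?Q * (?Q - 1) * (d - 1) - M * s\<^sup>2)"
    using square_of_sum_le[of "\<lambda>c. norm (?S c)" R] by (simp add: cardR sqR)
  also have "\<dots> = M\<^sup>2 * ((d - 1) * (?Q * d * (d - 1) - s\<^sup>2))"
    by (simp add: dM[symmetric] algebra_simps power2_eq_square)
  finally have "M\<^sup>2 * s\<^sup>2 \<le> M\<^sup>2 * ((d - 1) * (?Q * d * (d - 1) - s\<^sup>2))" by (simp add: power_mult_distrib)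
  hence "s\<^sup>2 \<le> (d - 1) * (?Q * d * (d - 1) - s\<^sup>2)" using M by simp
  hence "d * s\<^sup>2 \<le> d * (?Q * (d - 1)\<^sup>2)" by (simp add: algebra_simps power2_eq_square)
  hence "s\<^sup>2 \<le> ?Q * (d - 1)\<^sup>2" using d by simp
  also have "\<dots> = ((d - 1) * q)\<^sup>2" using assms(3) by (simp add: power_mult_distrib mult.commute)
  finally show ?thesis using d power2_le_imp_le[of s "(d - 1) * q"] by (simp add: s_def d_def)
qed

end

text \<open>
  The Hasse--Weil bound for this family of curves, in a refined form that knows the number of roots of
  \<open>L\<close> and of \<open>z^\<beta> = 1\<close> in the base field.  With \<open>W\<close> the image of \<open>L\<close>, the number of points is
  the size of the kernel times the number of \<open>b\<close> with \<open>b^\<beta> \<in> W\<close>.  Fourier expansion of the indicator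
  function of \<open>W\<close> turns this into the sum of \<open>S(c)\<close> over the annihilator \<open>V\<close> of \<open>W\<close>, which has as many
  elements as the kernel.
\<close>

lemma card_affine_points_le:
  fixes L :: "'a::{field,finite} \<Rightarrow> 'a"
  assumes L: "\<And>a b. L (a + b) = L a + L b" and \<beta>: "\<beta> > 0" and q: "CARD('a) = q\<^sup>2"
  shows "card {(a, b). b ^ \<beta> = L a} \<le>
           real (q\<^sup>2) + (real (card {a. L a = 0}) - 1) * (real (card {z::'a. z ^ \<beta> = 1}) - 1) * q"
proof -
  obtain \<psi> :: "'a \<Rightarrow> complex" where \<psi>: "\<And>a b. \<psi> (a + b) = \<psi> a * \<psi> b" "\<And>a. norm (\<psi> a) = 1" "\<exists>z. \<psi> z \<noteq> 1"
    using exists_additive_character by blast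
  interpret additive_character \<psi> by standard (use \<psi> in auto)
  define k where "k = card {a. L a = 0}"
  define W where "W = range L"
  define V where "V = {c. \<forall>w\<in>W. \<psi> (c * w) = 1}"
  have L0: "L 0 = 0" using L[of 0 0] by (simp only: add_0_right add_cancel_right_right)
  have Lm: "L (- a) = - L a" for a using L[of a "- a"] L0 by (simp add: add_eq_0_iff)
  have W0: "0 \<in> W" unfolding W_def using L0 by (intro image_eqI[of _ _ 0]) auto
  have Wadd: "a + b \<in> W" if "a \<in> W" "b \<in> W" for a b
    using that L by (auto simp: W_def simp flip: L)
  have fib: "card {a. L a = b} = (if b \<in> W then k else 0)" for b
  proof (cases "b \<in> W")
    case True
    then obtain a0 where a0: "b = L a0" by (auto simp: W_def)
    have "bij_betw (\<lambda>a. a + a0) {a. L a = 0} {a. L a = b}"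
      by (rule bij_betw_byWitness[where f' = "\<lambda>a. a - a0"])
         (use L[of _ "- a0"] in \<open>auto simp: L Lm a0\<close>)
    thus ?thesis using True by (simp add: k_def bij_betw_same_card)
  qed (auto simp: W_def)
  have kW: "k * card W = CARD('a)"
  proof -
    have "CARD('a) = (\<Sum>b\<in>W. card {a. L a = b})"
      unfolding W_def using sum.image_gen[of "UNIV::'a set" "\<lambda>_. 1::nat" L] by simp
    thus ?thesis by (simp add: fib)
  qed
  (* Fourier inversion of the indicator function of W *)
  have ind: "of_nat CARD('a) * (if y \<in> W then 1 else 0) = of_nat (card W) * (\<Sum>c\<in>V. \<psi> (c * y))" for y
  proof -
    have "of_nat CARD('a) * (if y \<in> W then 1 else 0) = (\<Sum>w\<in>W. if y - w = 0 then (of_nat CARD('a)::complex) else 0)"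
      by (simp add: sum.delta)
    also have "\<dots> = (\<Sum>w\<in>W. \<Sum>c\<in>UNIV. \<psi> (c * (y - w)))"
      unfolding orthogonality by simp
    also have "\<dots> = (\<Sum>c\<in>UNIV. \<Sum>w\<in>W. \<psi> (c * (y - w)))" by (rule sum.swap)
    also have "\<dots> = (\<Sum>c\<in>UNIV. \<psi> (c * y) * cnj (\<Sum>w\<in>W. \<psi> (c * w)))"
    proof (rule sum.cong[OF refl])
      fix c
      have "\<psi> (c * (y - w)) = \<psi> (c * y) * cnj (\<psi> (c * w))" for w
        using add[of "c * y" "- (c * w)"] by (simp add: neg algebra_simps)
      thus "(\<Sum>w\<in>W. \<psi> (c * (y - w))) = \<psi> (c * y) * cnj (\<Sum>w\<in>W. \<psi> (c * w))"
        by (simp add: sum_distrib_left)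
    qed
    also have "\<dots> = (\<Sum>c\<in>UNIV. if c \<in> V then of_nat (card W) * \<psi> (c * y) else 0)"
    proof (rule sum.cong[OF refl])
      fix c
      show "\<psi> (c * y) * cnj (\<Sum>w\<in>W. \<psi> (c * w)) = (if c \<in> V then of_nat (card W) * \<psi> (c * y) else 0)"
      proof (cases "c \<in> V")
        case True
        thus ?thesis by (simp add: V_def)
      next
        case False
        then obtain w where "w \<in> W" "\<psi> (c * w) \<noteq> 1" by (auto simp: V_def)
        hence "(\<Sum>w\<in>W. \<psi> (c * w)) = 0" using Wadd by (intro sum_over_subgroup[of w])
        thus ?thesis using False by simp
      qed
    qed
    finally show ?thesis by (simp add: sum.If_cases sum_distrib_left)
  qed
  have V0: "0 \<in> V" by (simp add: V_def)
  have W_pos: "card W > 0" using W0 by (auto simp: card_gt_0_iff)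
  have k_pos: "k > 0" using L0 by (auto simp: k_def card_gt_0_iff)
  have cardV: "card V = k"
  proof -
    have "of_nat (k * card W) = (of_nat (card W * card V) :: complex)"
      using ind[of 0] W0 unfolding kW by simp
    hence "k * card W = card W * card V" by (simp only: of_nat_eq_iff)
    thus ?thesis using W_pos by auto
  qed
  have "card {(a, b). b ^ \<beta> = L a} = (\<Sum>b\<in>UNIV. card {a. L a = b ^ \<beta>})"
  proof -
    have "bij_betw (\<lambda>(b, a). (a, b)) (SIGMA b:UNIV. {a. L a = b ^ \<beta>}) {(a, b). b ^ \<beta> = L a}"
      by (rule bij_betw_byWitness[where f' = "\<lambda>(a, b). (b, a)"]) auto
    thus ?thesis using card_SigmaI[of "UNIV::'a set" "\<lambda>b. {a. L a = b ^ \<beta>}"] by (simp add: bij_betw_same_card)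
  qed
  also have "\<dots> = (\<Sum>b\<in>UNIV. if b ^ \<beta> \<in> W then k else 0)" by (simp add: fib)
  finally have N: "card {(a, b). b ^ \<beta> = L a} = (\<Sum>b\<in>UNIV. if b ^ \<beta> \<in> W then k else 0)" .
  have "of_nat (card W) * (of_nat (card {(a, b). b ^ \<beta> = L a})::complex) =
      (\<Sum>b\<in>UNIV. of_nat CARD('a) * (if b ^ \<beta> \<in> W then 1 else 0))"
    unfolding N kW[symmetric] of_nat_sum sum_distrib_left by (rule sum.cong) auto
  also have "\<dots> = of_nat (card W) * (\<Sum>b\<in>UNIV. \<Sum>c\<in>V. \<psi> (c * b ^ \<beta>))"
    unfolding ind by (simp add: sum_distrib_left)
  also have "(\<Sum>b\<in>UNIV. \<Sum>c\<in>V. \<psi> (c * b ^ \<beta>)) = (\<Sum>c\<in>V. power_sum \<beta> c)"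
    unfolding power_sum_def by (rule sum.swap)
  finally have "of_nat (card {(a, b). b ^ \<beta> = L a}) = (\<Sum>c\<in>V. power_sum \<beta> c)" using W_pos by auto
  also have "\<dots> = of_nat CARD('a) + (\<Sum>c\<in>V - {0}. power_sum \<beta> c)"
    using V0 by (subst sum.remove[of V 0]) (auto simp: power_sum_0)
  finally have "of_nat (card {(a, b). b ^ \<beta> = L a}) = (of_nat CARD('a) :: complex) + (\<Sum>c\<in>V - {0}. power_sum \<beta> c)" .
  hence "norm (of_nat (card {(a, b). b ^ \<beta> = L a}) :: complex) = norm ((of_nat CARD('a) :: complex) + (\<Sum>c\<in>V - {0}. power_sum \<beta> c))"
    by (rule arg_cong)
  hence "real (card {(a, b). b ^ \<beta> = L a}) \<le> real CARD('a) + (\<Sum>c\<in>V - {0}. norm (power_sum \<beta> c))"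
    using norm_triangle_ineq[of "of_nat CARD('a) :: complex" "\<Sum>c\<in>V - {0}. power_sum \<beta> c"]
      norm_sum[of "power_sum \<beta>" "V - {0}"] by simp
  also have "(\<Sum>c\<in>V - {0}. norm (power_sum \<beta> c)) \<le> (\<Sum>c\<in>V - {0}. (real (card {z::'a. z ^ \<beta> = 1}) - 1) * q)"
    by (intro sum_mono norm_power_sum_le) (use \<beta> q in auto)
  also have "\<dots> = (real k - 1) * (real (card {z::'a. z ^ \<beta> = 1}) - 1) * q"
    using V0 cardV k_pos by (simp add: card_Diff_singleton of_nat_diff)
  finally show ?thesis by (simp add: q k_def)
qed


section \<open>Evaluation homomorphisms\<close>

locale ring_map =
  fixes h :: "'r::comm_ring_1 \<Rightarrow> 's::comm_ring_1"
  assumes one [simp]: "h 1 = 1"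
    and add [simp]: "h (a + b) = h a + h b"
    and mult [simp]: "h (a * b) = h a * h b"
begin

lemma zero [simp]: "h 0 = 0"
  using add[of 0 0] by (simp only: add_0_right add_cancel_right_right)

lemma neg [simp]: "h (- a) = - h a"
  using add[of a "- a"] by (simp add: add_eq_0_iff)

lemma diff [simp]: "h (a - b) = h a - h b"
  using add[of a "- b"] by simp

lemma power [simp]: "h (a ^ n) = h a ^ n"
  by (induction n) auto

lemma prod: "h (\<Prod>i\<in>I. f i) = (\<Prod>i\<in>I. h (f i))"
  by (induction I rule: infinite_finite_induct) auto

lemma sum [simp]: "h (\<Sum>i\<in>I. f i) = (\<Sum>i\<in>I. h (f i))"
  by (induction I rule: infinite_finite_induct) auto

end

abbreviation ev :: "('r::comm_ring_1 \<Rightarrow> 's::comm_ring_1) \<Rightarrow> 's \<Rightarrow> 'r poly \<Rightarrow> 's" where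
  "ev h z p \<equiv> poly (map_poly h p) z"

lemma eval2_ev: "eval2 \<iota> x y H = ev (ev \<iota> x) y H"
  by (simp add: eval2_def)

context ring_map begin

lemma ev_pCons [simp]: "ev h z (pCons c p) = h c + z * ev h z p"
  by (simp add: map_poly_pCons)

lemma ring_map_ev: "ring_map (ev h z)"
proof
  have madd: "map_poly h (p + q) = map_poly h p + map_poly h q" for p q
    by (rule poly_eqI) (simp add: coeff_map_poly)
  have "map_poly h (p * q) = map_poly h p * map_poly h q" for p q
    by (rule poly_eqI) (simp add: coeff_map_poly coeff_mult)
  thus "ev h z (p * q) = ev h z p * ev h z q" for p q by simp
  show "ev h z (p + q) = ev h z p + ev h z q" for p q by (simp add: madd)
qed (simp add: map_poly_1)

lemma ev_monom: "ev h z (monom c n) = h c * z ^ n"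
  by (simp add: map_poly_monom poly_monom)

lemma ev_ev:
  assumes "\<And>c. h (g c) = k c" and "ring_map g"
  shows "h (ev g z p) = ev k (h z) p"
proof -
  interpret g: ring_map g by fact
  interpret k: ring_map k by standard (simp_all flip: assms(1))
  show ?thesis by (induction p) (simp_all add: assms(1))
qed

lemma ev_altdef:
  assumes "degree p < n"
  shows "ev h z p = (\<Sum>i<n. h (coeff p i) * z ^ i)"
proof -
  have deg: "degree (map_poly h p) < n" using assms map_poly_degree_leq[of h p] zero by simp
  have "ev h z p = (\<Sum>i\<le>degree (map_poly h p). h (coeff p i) * z ^ i)"
    by (subst poly_altdef) (simp add: coeff_map_poly)
  also have "\<dots> = (\<Sum>i<n. h (coeff p i) * z ^ i)"
  proof (rule sum.mono_neutral_left)
    show "\<forall>i\<in>{..<n} - {..degree (map_poly h p)}. h (coeff p i) * z ^ i = 0"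
      using coeff_eq_0[of "map_poly h p"] by (simp add: coeff_map_poly)
  qed (use deg in auto)
  finally show ?thesis .
qed

end

lemma field_embedding_ring_map: "field_embedding \<iota> \<longleftrightarrow> ring_map \<iota>"
  by (auto simp: field_embedding_def ring_map_def)

lemma ring_map_compose: "ring_map g \<Longrightarrow> ring_map h \<Longrightarrow> ring_map (\<lambda>a. h (g a))"
  by (simp add: ring_map_def)

lemma ring_map_field_eq_0_iff:
  fixes h :: "'r::field \<Rightarrow> 's::field"
  assumes "ring_map h"
  shows "h a = 0 \<longleftrightarrow> a = 0"
proof -
  interpret ring_map h by fact
  have "h a * h (inverse a) = 1" if "a \<noteq> 0" using that mult[of a "inverse a"] by (simp del: mult)
  thus ?thesis using zero by fastforce
qed

lemma ring_map_to_ac: "ring_map to_ac"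
  by standard auto

lemma ring_map_fps_const: "ring_map (fps_const :: 'k::field \<Rightarrow> 'k fps)"
  by standard auto

lemma ring_map_fls_const: "ring_map (fls_const :: 'k::field \<Rightarrow> 'k fls)"
  by standard (auto simp: fls_plus_const fls_const_mult_const)

lemma ring_map_fps_to_fls: "ring_map (fps_to_fls :: 'k::field fps \<Rightarrow> 'k fls)"
  by standard (auto simp: fls_times_fps_to_fls)

lemma ring_map_fps_nth_0: "ring_map (\<lambda>f :: 'k::field fps. f $ 0)"
  by standard auto

lemma ring_map_eval2: "ring_map \<iota> \<Longrightarrow> ring_map (eval2 \<iota> x y)"
  unfolding eval2_ev[abs_def] by (intro ring_map.ring_map_ev)


section \<open>Valuations\<close>

locale valuation =
  fixes v :: "'f::field \<Rightarrow> int"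
  assumes v_mult: "f \<noteq> 0 \<Longrightarrow> g \<noteq> 0 \<Longrightarrow> v (f * g) = v f + v g"
    and v_add: "f \<noteq> 0 \<Longrightarrow> g \<noteq> 0 \<Longrightarrow> f + g \<noteq> 0 \<Longrightarrow> min (v f) (v g) \<le> v (f + g)"
begin

lemma v_1: "v 1 = 0"
  using v_mult[of 1 1] by simp

lemma v_minus: "v (- f) = v f"
proof (cases "f = 0")
  case False
  have "v (- 1) + v (- 1) = 0" using v_mult[of "-1" "-1"] v_1 by simp
  hence "v (- 1) = 0" by simp
  thus ?thesis using v_mult[of "-1" f] False by simp
qed simp

lemma v_power: "f \<noteq> 0 \<Longrightarrow> v (f ^ n) = int n * v f"
  by (induction n) (simp_all add: v_1 v_mult algebra_simps)

lemma v_divide: "f \<noteq> 0 \<Longrightarrow> g \<noteq> 0 \<Longrightarrow> v (f / g) = v f - v g"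
  using v_mult[of "f / g" g] by simp

lemma v_add_less:
  assumes "f \<noteq> 0" and "g \<noteq> 0" and "v f < v g"
  shows "f + g \<noteq> 0" and "v (f + g) = v f"
proof -
  show nz: "f + g \<noteq> 0"
  proof
    assume "f + g = 0"
    hence "f = - g" by (simp add: eq_neg_iff_add_eq_0)
    thus False using assms(3) v_minus[of g] by simp
  qed
  have "min (v (f + g)) (v (- g)) \<le> v (f + g + - g)"
    using nz assms by (intro v_add) auto
  hence "min (v (f + g)) (v g) \<le> v f" by (simp add: v_minus)
  moreover have "min (v f) (v g) \<le> v (f + g)" using nz assms by (intro v_add)
  ultimately show "v (f + g) = v f" using assms(3) by linarith
qed

text \<open>
  No cancellation can occur between terms of pairwise distinct valuation.
\<close>

lemma v_sum_distinct:
  assumes "finite I" and "I \<noteq> {}" and "\<And>i. i \<in> I \<Longrightarrow> f i \<noteq> 0" and "inj_on (\<lambda>i. v (f i)) I"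
  shows "sum f I \<noteq> 0" and "v (sum f I) = Min ((\<lambda>i. v (f i)) ` I)"
proof -
  have "sum f I \<noteq> 0 \<and> v (sum f I) = Min ((\<lambda>i. v (f i)) ` I)"
    using assms
  proof (induction I rule: finite_ne_induct)
    case (insert i I)
    let ?m = "Min ((\<lambda>i. v (f i)) ` I)"
    have IH: "sum f I \<noteq> 0" "v (sum f I) = ?m" using insert by (auto simp: inj_on_insert)
    have "?m \<in> (\<lambda>i. v (f i)) ` I" using insert by (intro Min_in) auto
    moreover have "v (f i) \<notin> (\<lambda>i. v (f i)) ` I"
      using insert.prems(2) \<open>i \<notin> I\<close> by (auto simp: inj_on_def)
    ultimately have ne: "v (f i) \<noteq> ?m" by metis
    have fi: "f i \<noteq> 0" using insert by auto
    have "f i + sum f I \<noteq> 0 \<and> v (f i + sum f I) = min (v (f i)) ?m"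
    proof (cases "v (f i) < ?m")
      case True
      thus ?thesis using v_add_less[of "f i" "sum f I"] IH fi by auto
    next
      case False
      hence "v (sum f I) < v (f i)" using ne IH by auto
      thus ?thesis using v_add_less[of "sum f I" "f i"] IH fi by (auto simp: add.commute)
    qed
    thus ?case using insert by simp
  qed auto
  thus "sum f I \<noteq> 0" and "v (sum f I) = Min ((\<lambda>i. v (f i)) ` I)" by auto
qed

end

lemma place_valuation: "place \<iota> v \<Longrightarrow> valuation v"
  by (simp add: place_def valuation_def)

lemma fls_valuation: "valuation (fls_subdegree :: 'k::field fls \<Rightarrow> int)"
  by standard (auto intro: fls_plus_subdegree)

text \<open>
  The order of a Laurent series gives a multiplicative and ultrametric function for free.  Its values on
  the subfield form a nonzero subgroup \<open>d \<int>\<close> of \<open>\<int>\<close>, so a place is obtained after division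
  by \<open>d\<close>.
\<close>

lemma place_of_Laurent_embedding:
  fixes \<phi> :: "'f::field \<Rightarrow> 'k::field fls"
  assumes \<phi>: "ring_map \<phi>" and const: "\<And>c. fls_subdegree (\<phi> (\<iota> c)) = 0"
    and t0: "fls_subdegree (\<phi> t0) \<noteq> 0"
  obtains v d where "place \<iota> v" and "d > 0" and "\<And>f. fls_subdegree (\<phi> f) = d * v f"
proof -
  interpret \<phi>: ring_map \<phi> by fact
  interpret L: valuation "fls_subdegree :: 'k fls \<Rightarrow> int" by (rule fls_valuation)
  define w where "w = (\<lambda>f. fls_subdegree (\<phi> f))"
  have nz: "\<phi> f = 0 \<longleftrightarrow> f = 0" for f using \<phi> by (rule ring_map_field_eq_0_iff)
  interpret w: valuation w
  proof
    fix f g :: 'f assume fg: "f \<noteq> 0" "g \<noteq> 0"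
    show "w (f * g) = w f + w g" using fg by (simp add: w_def L.v_mult nz)
    show "min (w f) (w g) \<le> w (f + g)" if "f + g \<noteq> 0"
      using L.v_add[of "\<phi> f" "\<phi> g"] fg that nz[of "f + g"] by (simp add: w_def nz)
  qed
  have w0: "w 0 = 0" by (simp add: w_def)
  define P where "P = (\<lambda>n::nat. n > 0 \<and> (\<exists>f. w f = int n))"
  have "\<exists>n. P n"
  proof (cases "w t0 > 0")
    case True
    thus ?thesis unfolding P_def by (intro exI[of _ "nat (w t0)"]) auto
  next
    case False
    have "t0 \<noteq> 0" using t0 by auto
    hence "w (1 / t0) = - w t0" using w.v_divide[of 1 t0] w.v_1 by simp
    moreover have "w t0 < 0" using False t0 by (simp add: w_def)
    ultimately show ?thesis unfolding P_def by (intro exI[of _ "nat (- w t0)"]) (auto intro!: exI[of _ "1 / t0"])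
  qed
  define d where "d = (LEAST n. P n)"
  have "P d" unfolding d_def using \<open>\<exists>n. P n\<close> by (rule LeastI_ex)
  then obtain t where d: "d > 0" and t: "w t = int d" by (auto simp: P_def)
  have t_nz: "t \<noteq> 0" using t d w0 by auto
  have min: "d \<le> n" if "n > 0" "w f = int n" for n f
    unfolding d_def using that by (intro Least_le) (auto simp: P_def)
  have dvd_nat: "d dvd n" if "w f = int n" for n f
    using that
  proof (induction n arbitrary: f rule: less_induct)
    case (less n)
    show ?case
    proof (cases "n = 0")
      case False
      hence le: "d \<le> n" using min less.prems by blast
      have "f \<noteq> 0" using False less.prems w0 by auto
      hence "w (f / t) = int (n - d)" using w.v_divide[of f t] t_nz t less.prems le by simp
      hence "d dvd n - d" using less.IH[of "n - d"] d le by simp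
      thus ?thesis using le dvd_add[of d "n - d" d] by simp
    qed simp
  qed
  have dvd: "int d dvd w f" for f
  proof (cases "w f \<ge> 0 \<or> f = 0")
    case True
    moreover have "int d dvd w f" if "w f \<ge> 0"
    proof -
      have "d dvd nat (w f)" using dvd_nat[of f "nat (w f)"] that by simp
      hence "int d dvd int (nat (w f))" by (simp only: int_dvd_int_iff)
      thus ?thesis using that by (simp only: int_nat_eq if_True)
    qed
    ultimately show ?thesis using w0 by auto
  next
    case False
    hence "w (1 / f) = int (nat (- w f))" using w.v_divide[of 1 f] w.v_1 by simp
    hence "d dvd nat (- w f)" by (rule dvd_nat)
    hence "int d dvd int (nat (- w f))" by (simp only: int_dvd_int_iff)
    moreover have "int (nat (- w f)) = - w f" using False by simp
    ultimately show ?thesis by (simp only: dvd_minus_iff)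
  qed
  define v where "v = (\<lambda>f. w f div int d)"
  have wv: "w f = int d * v f" for f unfolding v_def using dvd[of f] by simp
  have "place \<iota> v"
    unfolding place_def
  proof (intro conjI allI impI)
    show "v 0 = 0" by (simp add: v_def w0)
    show "v (\<iota> c) = 0" for c by (simp add: v_def w_def const)
    show "v (f * g) = v f + v g" if "f \<noteq> 0" "g \<noteq> 0" for f g
    proof -
      have "int d * v (f * g) = int d * (v f + v g)"
        using w.v_mult[OF that] by (simp add: wv ring_distribs)
      thus ?thesis using d by simp
    qed
    show "min (v f) (v g) \<le> v (f + g)" if "f \<noteq> 0" "g \<noteq> 0" "f + g \<noteq> 0" for f g
    proof -
      have "w f \<le> w (f + g) \<or> w g \<le> w (f + g)" using w.v_add[OF that] by linarith
      hence "v f \<le> v (f + g) \<or> v g \<le> v (f + g)" using d by (simp add: wv)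
      thus ?thesis by linarith
    qed
    show "\<exists>t. v t = 1" using t d by (intro exI[of _ t]) (simp add: v_def)
  qed
  thus thesis using that[of v "int d"] d wv by (simp add: w_def)
qed


section \<open>Power series solutions of polynomial equations\<close>

lemma fps_of_poly_pcompose_linear:
  fixes P :: "'k::field poly" and Z :: "'k fps"
  assumes "Z $ 0 = 0"
  shows "fps_compose (fps_of_poly (pcompose P [:a, 1:])) Z = ev fps_const (fps_const a + Z) P"
proof -
  interpret ring_map "fps_const :: 'k \<Rightarrow> 'k fps" by (rule ring_map_fps_const)
  have "fps_compose fps_X Z = Z" using assms by (auto simp: fps_X_fps_compose fps_eq_iff)
  thus ?thesis
    by (induction P)
       (simp_all add: pcompose_pCons fps_of_poly_add fps_of_poly_mult fps_of_poly_smult fps_of_poly_pCons fps_of_poly_const fps_compose_add_distrib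
          fps_compose_mult_distrib assms algebra_simps)
qed

text \<open>
  Hensel's lemma for power series, in the form of the inverse function theorem: \<open>P(a + T) - P(a)\<close> has no
  constant term and a nonzero linear term, hence a compositional inverse.  The divisibility statement
  compares the deviations of \<open>\<xi>\<close> and of \<open>W\<close> from their constant terms.
\<close>

lemma fps_simple_root:
  fixes P :: "'k::field poly" and W :: "'k fps"
  assumes "poly (pderiv P) a \<noteq> 0" and "W $ 0 = poly P a"
  obtains \<xi> where "\<xi> $ 0 = a" and "ev fps_const \<xi> P = W"
    and "W - fps_const (W $ 0) dvd \<xi> - fps_const a"
proof -
  define P' where "P' = pcompose P [:a, 1:]"
  define F where "F = fps_of_poly P' - fps_const (poly P a)"
  define Z where "Z = W - fps_const (W $ 0)"
  define Y where "Y = fps_compose (fps_inv F) Z"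
  have P'0: "coeff P' 0 = poly P a" by (simp add: P'_def)
  have "coeff P' 1 = poly (pderiv P') 0" by (simp add: poly_0_coeff_0 coeff_pderiv)
  also have "\<dots> = poly (pderiv P) a" by (simp add: P'_def pderiv_pcompose poly_pcompose pderiv_pCons)
  finally have F: "F $ 0 = 0" "F $ 1 \<noteq> 0" using assms(1) by (simp_all add: F_def P'0)
  have Z0: "Z $ 0 = 0" by (simp add: Z_def)
  have inv0: "fps_inv F $ 0 = 0" by (simp add: fps_inv_def)
  have Y0: "Y $ 0 = 0" by (simp add: Y_def inv0)
  have "fps_compose F Y = fps_compose (fps_compose F (fps_inv F)) Z" unfolding Y_def by (rule fps_compose_assoc[OF Z0 inv0])
  also have "\<dots> = Z" unfolding fps_inv_right[OF F] using Z0 by (auto simp: fps_X_fps_compose fps_eq_iff)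
  finally have "fps_compose F Y = Z" .
  moreover have "fps_compose F Y = ev fps_const (fps_const a + Y) P - fps_const (poly P a)"
    unfolding F_def P'_def by (simp add: fps_compose_sub_distrib fps_of_poly_pcompose_linear Y0)
  ultimately have "ev fps_const (fps_const a + Y) P = W" by (simp add: Z_def assms(2))
  moreover have "Z dvd Y"
  proof -
    obtain R where R: "fps_inv F = fps_X * R"
    proof
      show "fps_inv F = fps_X * fps_shift 1 (fps_inv F)"
        using inv0 by (simp add: fps_eq_iff)
    qed
    have "fps_compose fps_X Z = Z" using Z0 by (auto simp: fps_X_fps_compose fps_eq_iff)
    hence "Y = Z * (fps_compose R Z)" unfolding Y_def R by (simp add: fps_compose_mult_distrib Z0)
    thus ?thesis by simp
  qed
  ultimately show thesis using that[of "fps_const a + Y"] Y0 by (simp add: Z_def)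
qed

text \<open>
  Composition with a nonzero power series without constant term is injective.
\<close>

lemma fps_transcendental:
  fixes \<xi> :: "'k::field fps"
  assumes "\<xi> \<noteq> fps_const (\<xi> $ 0)" and "P \<noteq> 0"
  shows "ev fps_const \<xi> P \<noteq> 0"
proof
  define Z where "Z = \<xi> - fps_const (\<xi> $ 0)"
  have Z: "Z \<noteq> 0" "Z $ 0 = 0" using assms(1) by (auto simp: Z_def)
  assume "ev fps_const \<xi> P = 0"
  hence "fps_compose (fps_of_poly (pcompose P [:\<xi> $ 0, 1:])) Z = 0"
    by (simp add: fps_of_poly_pcompose_linear Z) (simp add: Z_def)
  hence "fps_of_poly (pcompose P [:\<xi> $ 0, 1:]) = 0" using Z by (simp add: fps_compose_eq_0_iff)
  hence "pcompose P [:\<xi> $ 0, 1:] = 0" by (simp add: fps_of_poly_eq_iff flip: fps_of_poly_0)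
  thus False using assms(2) by (simp add: pcompose_eq_0_iff)
qed


section \<open>The function field of $y^\beta = A(x)$\<close>

locale kummer_function_field =
  fixes A :: "'a::{field,finite} poly" and \<alpha> \<beta> :: nat
    and \<iota> :: "'a \<Rightarrow> 'f::field" and x y :: 'f
  assumes additive: "additive_poly A" and separable: "separable_poly A"
    and degree_A: "degree A = \<alpha>" and coprime: "coprime \<alpha> \<beta>"
    and \<alpha>_ge: "2 \<le> \<alpha>" and \<beta>_ge: "2 \<le> \<beta>"
    and function_field: "is_function_field \<iota> x y (monom 1 \<beta> - [:A:])"
begin

abbreviation G :: "'a poly poly" where "G \<equiv> monom 1 \<beta> - [:A:]"

lemma \<beta>_pos: "0 < \<beta>"
  using \<beta>_ge by simp

sublocale \<iota>: ring_map \<iota>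
  using function_field by (simp add: is_function_field_def field_embedding_ring_map)

sublocale ex: ring_map "ev \<iota> x"
  by (rule \<iota>.ring_map_ev)

sublocale exy: ring_map "eval2 \<iota> x y"
  by (intro ring_map_eval2) unfold_locales

lemma \<iota>_eq_0_iff [simp]: "\<iota> c = 0 \<longleftrightarrow> c = 0"
  by (rule ring_map_field_eq_0_iff) unfold_locales

lemma eval2_eq_0_iff: "eval2 \<iota> x y H = 0 \<longleftrightarrow> G dvd H"
  using function_field by (simp add: is_function_field_def)

lemma eval2_const: "eval2 \<iota> x y [:g:] = ev \<iota> x g"
  by (simp add: eval2_ev)

lemma degree_G: "degree G = \<beta>" and lead_coeff_G: "lead_coeff G = 1"
proof -
  have "degree (monom 1 \<beta> + - [:A:]) = degree (monom (1 :: 'a poly) \<beta>)"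
    by (rule degree_add_eq_left) (simp add: degree_monom_eq \<beta>_pos)
  thus d: "degree G = \<beta>"
    by (simp only: diff_conv_add_uminus) (simp add: degree_monom_eq)
  show "lead_coeff G = 1" using \<beta>_pos by (simp only: d) (simp add: coeff_pCons split: nat.splits)
qed

lemma G_nonzero: "G \<noteq> 0"
  using lead_coeff_G by force

lemma not_G_dvd: "H \<noteq> 0 \<Longrightarrow> degree H < \<beta> \<Longrightarrow> \<not> G dvd H"
  using dvd_imp_degree_le[of G H] degree_G by auto

lemma curve_equation: "y ^ \<beta> = ev \<iota> x A"
proof -
  have "eval2 \<iota> x y G = 0" by (simp only: eval2_eq_0_iff dvd_refl)
  thus ?thesis by (simp only: exy.diff eval2_const) (simp add: eval2_ev ex.ev_monom)
qed

lemma ev_x_eq_0_iff [simp]: "ev \<iota> x g = 0 \<longleftrightarrow> g = 0"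
proof
  assume "ev \<iota> x g = 0"
  hence "G dvd [:g:]" by (simp flip: eval2_eq_0_iff add: eval2_const)
  thus "g = 0" using not_G_dvd[of "[:g:]"] \<beta>_pos by auto
qed simp

lemma normal_form:
  obtains H' where "degree H' < \<beta>" and "eval2 \<iota> x y H' = eval2 \<iota> x y H"
proof -
  obtain q r where qr: "pseudo_divmod H G = (q, r)" by fastforce
  have "H = G * q + r" using pseudo_divmod(1)[OF G_nonzero qr] unfolding lead_coeff_G by simp
  moreover have "eval2 \<iota> x y G = 0" by (simp only: eval2_eq_0_iff dvd_refl)
  ultimately have "eval2 \<iota> x y H = eval2 \<iota> x y r" by (simp only: exy.add exy.mult) simp
  moreover have "degree r < \<beta>" using pseudo_divmod(2)[OF G_nonzero qr] \<beta>_pos degree_G by auto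
  ultimately show thesis using that by simp
qed

lemma prime_G: "G dvd P * Q \<longleftrightarrow> G dvd P \<or> G dvd Q"
  by (simp flip: eval2_eq_0_iff)

text \<open>
  Take an element \<open>D\<close> of \<open>I\<close>, not divisible by \<open>G\<close>, of least degree in \<open>y\<close>.  Pseudo-division of \<open>G\<close> by \<open>D\<close>
  leaves no remainder, by minimality, so \<open>D\<close> divides a multiple \<open>a G\<close> with \<open>a\<close> in \<open>K[x]\<close>.  Since \<open>G\<close>
  is prime and does not divide \<open>D\<close>, it cancels and \<open>D\<close> has degree 0 in \<open>y\<close>.
\<close>

lemma ideal_contains_polynomial_in_x:
  fixes I :: "'a poly poly set"
  assumes add: "\<And>P Q. P \<in> I \<Longrightarrow> Q \<in> I \<Longrightarrow> P + Q \<in> I"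
    and mult: "\<And>P Q. P \<in> I \<Longrightarrow> P * Q \<in> I"
    and G: "G \<in> I" and H: "H \<in> I" "\<not> G dvd H"
  obtains g where "g \<noteq> 0" and "[:g:] \<in> I"
proof -
  obtain D where D: "D \<in> I" "\<not> G dvd D"
    and least: "\<And>P. P \<in> I \<Longrightarrow> \<not> G dvd P \<Longrightarrow> degree D \<le> degree P"
    using ex_has_least_nat[of "\<lambda>P. P \<in> I \<and> \<not> G dvd P" H degree] H by blast
  have uminus: "- P \<in> I" if "P \<in> I" for P using mult[OF that, of "- 1"] by simp
  have D0: "D \<noteq> 0" using D by auto
  have degD: "degree D < \<beta>"
  proof -
    obtain q r where qr: "pseudo_divmod D G = (q, r)" by fastforce
    have eq: "D = G * q + r" using pseudo_divmod(1)[OF G_nonzero qr] unfolding lead_coeff_G by simp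
    have "r = D + - (G * q)" by (subst eq) simp
    hence "r \<in> I" using D G by (simp only: add mult uminus)
    moreover have "\<not> G dvd r" using D(2) dvd_add[of G "G * q" r] unfolding eq[symmetric] by auto
    ultimately have "degree D \<le> degree r" by (rule least)
    moreover have "degree r < \<beta>" using pseudo_divmod(2)[OF G_nonzero qr] \<beta>_pos degree_G by auto
    ultimately show ?thesis by simp
  qed
  obtain a q where a: "a \<noteq> 0" and eq: "smult a G = D * q + pseudo_mod G D"
    using pseudo_mod(1)[OF D0, of G] by blast
  let ?r = "pseudo_mod G D"
  have "G * [:a:] = [:a:] * G" by (rule mult.commute)
  also have "\<dots> = smult a G" by simp
  finally have sm: "G * [:a:] = smult a G" .
  have "?r = G * [:a:] + - (D * q)" unfolding sm eq by simp
  hence "?r \<in> I" using D G by (simp only: add mult uminus)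
  hence "?r = 0 \<or> G dvd ?r" using least[of ?r] pseudo_mod(2)[OF D0, of G] by force
  moreover have "degree ?r < \<beta>" using pseudo_mod(2)[OF D0, of G] degD \<beta>_pos by auto
  ultimately have r0: "?r = 0" using not_G_dvd by blast
  hence "G * [:a:] = D * q" using eq unfolding sm by simp
  hence "G dvd D * q" by (metis dvd_triv_left)
  hence "G dvd q" using D(2) prime_G by blast
  then obtain q' where q': "q = G * q'" by blast
  have "G * [:a:] = G * (D * q')"
    using \<open>G * [:a:] = D * q\<close> unfolding q' by (simp only: mult.left_commute)
  hence *: "[:a:] = D * q'" using G_nonzero by (simp only: mult_cancel_left) simp
  hence "q' \<noteq> 0" using a by auto
  hence "degree D + degree q' = 0" using * D0 by (metis degree_mult_eq degree_pCons_0)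
  then obtain d where d: "D = [:d:]" using degree_eq_zeroE[of D] by auto
  show thesis using that[of d] D D0 d by auto
qed

lemma fraction_with_denominator_in_x:
  obtains g H where "g \<noteq> 0" and "ev \<iota> x g * z = eval2 \<iota> x y H"
proof -
  obtain H1 H2 where H: "eval2 \<iota> x y H2 \<noteq> 0" "z = eval2 \<iota> x y H1 / eval2 \<iota> x y H2"
    using function_field unfolding is_function_field_def by blast
  define I where "I = {P. \<exists>U. eval2 \<iota> x y P = eval2 \<iota> x y (U * H2)}"
  obtain g where g: "g \<noteq> 0" "[:g:] \<in> I"
  proof (rule ideal_contains_polynomial_in_x[of I H2])
    show "P + Q \<in> I" if PQ: "P \<in> I" "Q \<in> I" for P Q
    proof -
      obtain U V where "eval2 \<iota> x y P = eval2 \<iota> x y (U * H2)" "eval2 \<iota> x y Q = eval2 \<iota> x y (V * H2)"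
        using PQ unfolding I_def by blast
      hence "eval2 \<iota> x y (P + Q) = eval2 \<iota> x y ((U + V) * H2)" by (simp add: algebra_simps)
      thus ?thesis unfolding I_def by blast
    qed
    show "P * Q \<in> I" if P: "P \<in> I" for P Q
    proof -
      obtain U where "eval2 \<iota> x y P = eval2 \<iota> x y (U * H2)" using P unfolding I_def by blast
      hence "eval2 \<iota> x y (P * Q) = eval2 \<iota> x y (U * Q * H2)" by (simp add: algebra_simps)
      thus ?thesis unfolding I_def by blast
    qed
    have "eval2 \<iota> x y G = eval2 \<iota> x y (0 * H2)" by (simp add: eval2_eq_0_iff del: exy.diff)
    thus "G \<in> I" unfolding I_def by blast
    have "eval2 \<iota> x y H2 = eval2 \<iota> x y (1 * H2)" by simp
    thus "H2 \<in> I" unfolding I_def by blast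
    show "\<not> G dvd H2" using H(1) by (simp add: eval2_eq_0_iff)
  qed
  then obtain U where "eval2 \<iota> x y [:g:] = eval2 \<iota> x y (U * H2)" unfolding I_def by blast
  hence "ev \<iota> x g * z = eval2 \<iota> x y (U * H1)" using H by (simp add: eval2_const)
  thus thesis using that g by blast
qed

text \<open>
  A solution of the equation of the curve in a field \<open>L\<close> with transcendental \<open>x\<close>-coordinate embeds the function
  field into \<open>L\<close>: a kernel larger than \<open>(G)\<close> would contain a nonzero polynomial in \<open>x\<close> alone.
\<close>

lemma embedding_of_solution:
  fixes \<kappa> :: "'a \<Rightarrow> 'l::field"
  assumes \<kappa>: "ring_map \<kappa>" and sol: "\<upsilon> ^ \<beta> = ev \<kappa> \<xi> A" and trans: "\<And>g. g \<noteq> 0 \<Longrightarrow> ev \<kappa> \<xi> g \<noteq> 0"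
  obtains \<phi> where "ring_map \<phi>" and "\<And>H. \<phi> (eval2 \<iota> x y H) = eval2 \<kappa> \<xi> \<upsilon> H"
proof -
  interpret \<kappa>: ring_map \<kappa> by fact
  interpret e: ring_map "eval2 \<kappa> \<xi> \<upsilon>" by (intro ring_map_eval2 \<kappa>)
  interpret e1: ring_map "ev \<kappa> \<xi>" by (rule \<kappa>.ring_map_ev)
  have e_const: "eval2 \<kappa> \<xi> \<upsilon> [:g:] = ev \<kappa> \<xi> g" for g by (simp add: eval2_ev)
  have eG: "eval2 \<kappa> \<xi> \<upsilon> G = 0"
    by (simp only: e.diff e_const) (simp add: eval2_ev e1.ev_monom sol)
  have kernel: "eval2 \<kappa> \<xi> \<upsilon> H = 0 \<longleftrightarrow> eval2 \<iota> x y H = 0" for H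
  proof
    assume "eval2 \<iota> x y H = 0"
    then obtain Q where "H = G * Q" by (auto simp: eval2_eq_0_iff)
    thus "eval2 \<kappa> \<xi> \<upsilon> H = 0" by (simp only: e.mult eG) simp
  next
    assume H: "eval2 \<kappa> \<xi> \<upsilon> H = 0"
    show "eval2 \<iota> x y H = 0"
    proof (rule ccontr)
      assume "eval2 \<iota> x y H \<noteq> 0"
      hence "\<not> G dvd H" by (simp add: eval2_eq_0_iff)
      then obtain g where "g \<noteq> 0" "[:g:] \<in> {H. eval2 \<kappa> \<xi> \<upsilon> H = 0}"
        using ideal_contains_polynomial_in_x[of "{H. eval2 \<kappa> \<xi> \<upsilon> H = 0}" H] H eG by auto
      thus False using trans by (simp add: e_const)
    qed
  qed
  define num where "num = (\<lambda>z. fst (SOME HH. eval2 \<iota> x y (snd HH) \<noteq> 0 \<and> z = eval2 \<iota> x y (fst HH) / eval2 \<iota> x y (snd HH)))"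
  define den where "den = (\<lambda>z. snd (SOME HH. eval2 \<iota> x y (snd HH) \<noteq> 0 \<and> z = eval2 \<iota> x y (fst HH) / eval2 \<iota> x y (snd HH)))"
  have nd: "eval2 \<iota> x y (den z) \<noteq> 0" "z = eval2 \<iota> x y (num z) / eval2 \<iota> x y (den z)" for z
  proof -
    have "\<exists>HH. eval2 \<iota> x y (snd HH) \<noteq> 0 \<and> z = eval2 \<iota> x y (fst HH) / eval2 \<iota> x y (snd HH)"
      using function_field unfolding is_function_field_def by (metis fst_conv snd_conv)
    from someI_ex[OF this] show "eval2 \<iota> x y (den z) \<noteq> 0" "z = eval2 \<iota> x y (num z) / eval2 \<iota> x y (den z)"
      by (simp_all add: num_def den_def)
  qed
  define \<phi> where "\<phi> = (\<lambda>z. eval2 \<kappa> \<xi> \<upsilon> (num z) / eval2 \<kappa> \<xi> \<upsilon> (den z))"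
  have \<phi>: "\<phi> z = eval2 \<kappa> \<xi> \<upsilon> P / eval2 \<kappa> \<xi> \<upsilon> Q"
    if "eval2 \<iota> x y Q \<noteq> 0" and "z = eval2 \<iota> x y P / eval2 \<iota> x y Q" for z P Q
  proof -
    have "eval2 \<iota> x y (num z) / eval2 \<iota> x y (den z) = eval2 \<iota> x y P / eval2 \<iota> x y Q"
      using nd(2)[of z] that(2) by simp
    hence "eval2 \<iota> x y (num z * Q - P * den z) = 0"
      using nd(1)[of z] that(1) by (simp add: frac_eq_eq)
    hence "eval2 \<kappa> \<xi> \<upsilon> (num z * Q - P * den z) = 0" by (simp only: kernel)
    thus ?thesis unfolding \<phi>_def using nd(1)[of z] that(1) by (simp add: frac_eq_eq kernel)
  qed
  have \<phi>_eval: "\<phi> (eval2 \<iota> x y H) = eval2 \<kappa> \<xi> \<upsilon> H" for H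
    using \<phi>[of 1 "eval2 \<iota> x y H" H] by simp
  have "ring_map \<phi>"
  proof
    show "\<phi> 1 = 1" using \<phi>_eval[of 1] by simp
    fix z w
    have nz: "eval2 \<kappa> \<xi> \<upsilon> (den z) \<noteq> 0" "eval2 \<kappa> \<xi> \<upsilon> (den w) \<noteq> 0" using nd(1) by (simp_all add: kernel)
    have "z + w = eval2 \<iota> x y (num z * den w + num w * den z) / eval2 \<iota> x y (den z * den w)"
      by (subst nd(2)[of z], subst nd(2)[of w]) (use nd(1)[of z] nd(1)[of w] in \<open>simp add: add_frac_eq\<close>)
    from \<phi>[OF _ this] show "\<phi> (z + w) = \<phi> z + \<phi> w"
      using nd(1)[of z] nd(1)[of w] nz by (simp add: add_frac_eq) (simp add: \<phi>_def add_frac_eq)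
    have "z * w = eval2 \<iota> x y (num z * num w) / eval2 \<iota> x y (den z * den w)"
      by (subst nd(2)[of z], subst nd(2)[of w]) simp
    from \<phi>[OF _ this] show "\<phi> (z * w) = \<phi> z * \<phi> w"
      using nd(1)[of z] nd(1)[of w] by simp (simp add: \<phi>_def)
  qed
  thus thesis using that \<phi>_eval by blast
qed

end


section \<open>Places over the affine points\<close>

lemma (in ring_map) dvd_ev_diff: "z - w dvd ev h z p - ev h w p"
proof (induction p)
  case (pCons c p)
  have "ev h z (pCons c p) - ev h w (pCons c p) = (z - w) * ev h z p + w * (ev h z p - ev h w p)"
    by (simp add: algebra_simps)
  thus ?case using pCons.IH by (metis dvd_add dvd_mult dvd_triv_left)
qed simp

text \<open>
  The polynomial \<open>T^n - c\<close> is separable because its derivative \<open>n T^(n-1)\<close> vanishes only at 0.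
\<close>

lemma card_nth_roots_alg_closed:
  fixes c :: "'k::alg_closed_field"
  assumes "of_nat n \<noteq> (0::'k)" and "c \<noteq> 0"
  shows "card {b. b ^ n = c} = n"
proof -
  define P where "P = monom 1 n - [:c:]"
  have n: "n > 0" using assms(1) by (cases n) auto
  have "degree (monom 1 n + - [:c:]) = degree (monom (1::'k) n)"
    by (rule degree_add_eq_left) (simp add: degree_monom_eq n)
  hence degP: "degree P = n" unfolding P_def
    by (simp only: diff_conv_add_uminus) (simp add: degree_monom_eq)
  have lcP: "lead_coeff P = 1" using n unfolding degP by (simp add: P_def coeff_pCons split: nat.splits)
  have P0: "P \<noteq> 0" using degP n by auto
  have root: "poly P b = 0 \<longleftrightarrow> b ^ n = c" for b by (simp add: P_def poly_monom)
  obtain M where M: "size M = n" "P = (\<Prod>b\<in>#M. [:- b, 1:])"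
    using alg_closed_imp_factorization[OF P0] degP lcP by auto
  have fac: "P = [:- b, 1:] * (\<Prod>b\<in>#M - {#b#}. [:- b, 1:])" if "b \<in># M" for b
    unfolding M(2) using that by (subst insert_DiffM[symmetric, OF that]) (simp only: image_mset_add_mset prod_mset.add_mset)
  have in_root: "b ^ n = c" if "b \<in># M" for b
    using fac[OF that] root[of b] by simp
  have count: "count M b = 1" if b: "b \<in># M" for b
  proof (rule ccontr)
    assume "count M b \<noteq> 1"
    moreover have "count M b > 0" using b by (simp only: count_greater_zero_iff)
    ultimately have "count M b - 1 > 0" by linarith
    hence "count (M - {#b#}) b > 0" by (simp only: count_diff count_single refl if_True)
    hence b2: "b \<in># M - {#b#}" by (simp only: count_greater_zero_iff)
    define R where "R = (\<Prod>b\<in>#M - {#b#} - {#b#}. [:- b, 1:])"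
    have "P = [:- b, 1:] * ([:- b, 1:] * R)"
      using fac[OF b] unfolding R_def
      by (subst (asm) insert_DiffM[symmetric, OF b2]) (simp only: image_mset_add_mset prod_mset.add_mset)
    hence "poly (pderiv P) b = 0" by (simp only: pderiv_mult poly_add poly_mult) simp
    hence "of_nat n * b ^ (n - 1) = 0" by (simp add: P_def pderiv_diff pderiv_monom poly_monom pderiv_pCons)
    hence "b = 0" using assms(1) by simp
    thus False using in_root[OF b] n assms(2) by (simp add: power_0_left)
  qed
  have "n = (\<Sum>b\<in>set_mset M. count M b)" using M(1) by (simp add: size_multiset_overloaded_eq)
  also have "\<dots> = card (set_mset M)" using count by simp
  also have "\<dots> \<le> card {b. b ^ n = c}"
  proof (rule card_mono)
    show "finite {b. b ^ n = c}" using poly_roots_finite[OF P0] by (simp add: root)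
  qed (use in_root in auto)
  finally have "n \<le> card {b. b ^ n = c}" .
  moreover have "card {b. b ^ n = c} \<le> n" using card_poly_roots_bound[OF P0] by (simp add: root degP)
  ultimately show ?thesis by simp
qed

context kummer_function_field begin

text \<open>
  The derivative of \<open>a_0 x + a_1 x^p + a_2 x^(p^2) + \<dots>\<close> is \<open>a_0\<close>.  This makes the affine curve nonsingular, and
  since \<open>\<alpha>\<close> is a power of \<open>p\<close> with positive exponent, the exponent \<open>\<beta>\<close> is prime to \<open>p\<close>.
\<close>

lemma derivative_A:
  obtains c where "c \<noteq> 0" and "pderiv A = [:c:]"
    and "\<exists>h>0. \<alpha> = CHAR('a) ^ h"
proof -
  let ?p = "CHAR('a)"
  obtain m a where A: "A = (\<Sum>i\<le>m. monom (a i) (?p ^ i))"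
    using additive unfolding additive_poly_def by blast
  have p: "prime ?p" by (rule finite_field_char_prime)
  have "pderiv A = (\<Sum>i\<le>m. pderiv (monom (a i) (?p ^ i)))"
    unfolding A using higher_pderiv_sum[of 1] by simp
  also have "\<dots> = (\<Sum>i\<in>{0}. pderiv (monom (a i) (?p ^ i)))"
    by (rule sum.mono_neutral_right) (auto simp: pderiv_monom)
  also have "\<dots> = [:a 0:]" by (simp add: pderiv_monom monom_0)
  finally have d: "pderiv A = [:a 0:]" .
  have a0: "a 0 \<noteq> 0"
  proof
    assume "a 0 = 0"
    hence "is_unit A" using separable d by (simp add: separable_poly_def)
    moreover have "A \<noteq> 0" using degree_A \<alpha>_ge by auto
    ultimately have "degree A = 0" by (simp add: is_unit_iff_degree)
    thus False using degree_A \<alpha>_ge by simp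
  qed
  have "\<exists>h>0. \<alpha> = ?p ^ h"
  proof -
    have "coeff A \<alpha> \<noteq> 0" using degree_A \<alpha>_ge by auto
    hence "(\<Sum>i\<le>m. if ?p ^ i = \<alpha> then a i else 0) \<noteq> 0" unfolding A by (simp add: coeff_sum)
    then obtain h where h: "(if ?p ^ h = \<alpha> then a h else 0) \<noteq> 0" by (rule sum.not_neutral_contains_not_neutral)
    hence "?p ^ h = \<alpha>" by (simp split: if_splits)
    moreover from this have "h \<noteq> 0" using \<alpha>_ge by (intro notI) simp
    ultimately show ?thesis by (intro exI[of _ h]) simp
  qed
  with a0 d show thesis by (rule that)
qed

lemma of_nat_\<beta>: "of_nat \<beta> \<noteq> (0::'a)"
proof -
  let ?p = "CHAR('a)"
  obtain h where h: "h > 0" "\<alpha> = ?p ^ h" using derivative_A by metis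
  have p: "prime ?p" by (rule finite_field_char_prime)
  have "?p dvd \<alpha>" using h by simp
  hence "\<not> ?p dvd \<beta>" using coprime p by (meson coprime_common_divisor not_prime_unit)
  thus ?thesis by (simp add: of_nat_eq_0_iff_char_dvd)
qed

text \<open>
  Because \<open>A' \<noteq> 0\<close> everywhere, \<open>y - b\<close> is a local parameter at every point \<open>(a, b)\<close> over the
  algebraic closure, ramified points included, and \<open>x\<close> is a power series \<open>\<xi>\<close> in it.  The divisibility
  measures the ramification of \<open>x\<close> at the point.
\<close>

lemma affine_branch:
  fixes a b :: "'a alg_closure"
  defines "\<kappa> \<equiv> \<lambda>c::'a. fps_const (to_ac c)"
  assumes point: "b ^ \<beta> = ev to_ac a A"
  obtains \<xi> \<phi> where "\<xi> $ 0 = a" and "(fps_const b + fps_X) ^ \<beta> - fps_const (b ^ \<beta>) dvd \<xi> - fps_const a"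
    and "ring_map \<phi>" and "\<And>H. \<phi> (eval2 \<iota> x y H) = fps_to_fls (ev (ev \<kappa> \<xi>) (fps_const b + fps_X) H)"
proof -
  interpret ac: ring_map "to_ac :: 'a \<Rightarrow> 'a alg_closure" by (rule ring_map_to_ac)
  interpret \<kappa>: ring_map \<kappa> unfolding \<kappa>_def by (intro ring_map_compose[OF ring_map_to_ac] ring_map_fps_const)
  interpret fl: ring_map "fps_to_fls :: 'a alg_closure fps \<Rightarrow> _" by (rule ring_map_fps_to_fls)
  define \<kappa>' where "\<kappa>' = (\<lambda>c::'a. fls_const (to_ac c))"
  interpret \<kappa>': ring_map \<kappa>' unfolding \<kappa>'_def by (intro ring_map_compose[OF ring_map_to_ac] ring_map_fls_const)
  define W where "W = (fps_const b + fps_X) ^ \<beta>"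
  define P where "P = map_poly to_ac A"
  have \<kappa>_ev: "ev \<kappa> z p = ev fps_const z (map_poly to_ac p)" for z p
    unfolding \<kappa>_def by (simp add: map_poly_map_poly o_def)
  have W0: "W $ 0 = b ^ \<beta>" by (simp add: W_def fps_power_zeroth)
  obtain c where c: "c \<noteq> 0" "pderiv A = [:c:]" using derivative_A by metis
  have "pderiv P = map_poly to_ac (pderiv A)"
    unfolding P_def by (rule poly_eqI) (simp add: coeff_pderiv coeff_map_poly)
  hence "poly (pderiv P) a \<noteq> 0" using c by (simp add: map_poly_pCons)
  then obtain \<xi> where \<xi>: "\<xi> $ 0 = a" "ev fps_const \<xi> P = W" "W - fps_const (W $ 0) dvd \<xi> - fps_const a"
    using fps_simple_root[of P a W] point W0 by (auto simp: P_def)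
  have "\<xi> \<noteq> fps_const (\<xi> $ 0)"
  proof
    assume "\<xi> = fps_const (\<xi> $ 0)"
    hence "W = ev fps_const (fps_const a) P" using \<xi> by simp
    also have "\<dots> = fps_const (poly P a)"
      using ring_map.ev_ev[OF ring_map_fps_const, where g = "\<lambda>c. c" and k = fps_const and z = a and p = P] by (simp add: ring_map_def)
    finally have "W $ \<beta> = 0" using \<beta>_pos by simp
    moreover have "W = fps_of_poly ([:b, 1:] ^ \<beta>)"
      by (simp add: W_def fps_of_poly_power fps_of_poly_pCons)
    ultimately show False by (simp add: coeff_linear_power)
  qed
  note nonconst = this
  have lift: "fps_to_fls (ev \<kappa> \<xi> p) = ev \<kappa>' (fps_to_fls \<xi>) p" for p
    by (rule fl.ev_ev) (simp_all add: \<kappa>_def \<kappa>'_def \<kappa>.ring_map_axioms[unfolded \<kappa>_def])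
  have lift2: "fps_to_fls (ev (ev \<kappa> \<xi>) z H) = eval2 \<kappa>' (fps_to_fls \<xi>) (fps_to_fls z) H" for z H
    unfolding eval2_ev by (rule fl.ev_ev) (simp_all add: lift \<kappa>.ring_map_ev)
  have sol: "fps_to_fls (fps_const b + fps_X) ^ \<beta> = ev \<kappa>' (fps_to_fls \<xi>) A"
    unfolding lift[symmetric] using \<xi>(2) by (simp only: fl.power[symmetric] \<kappa>_ev P_def W_def)
  have trans: "ev \<kappa>' (fps_to_fls \<xi>) g \<noteq> 0" if "g \<noteq> 0" for g
  proof -
    have "map_poly to_ac g \<noteq> 0" using that by (simp add: map_poly_eq_0_iff)
    thus ?thesis using fps_transcendental[OF nonconst] by (simp flip: lift add: \<kappa>_ev)
  qed
  obtain \<phi> where \<phi>: "ring_map \<phi>" "\<And>H. \<phi> (eval2 \<iota> x y H) = eval2 \<kappa>' (fps_to_fls \<xi>) (fps_to_fls (fps_const b + fps_X)) H"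
    using embedding_of_solution[OF \<kappa>'.ring_map_axioms sol trans] by blast
  show thesis by (rule that[of \<xi> \<phi>]) (use \<xi> \<phi> W0 in \<open>simp_all add: lift2 W_def\<close>)
qed

lemma affine_place:
  fixes a b :: "'a alg_closure"
  defines "\<kappa> \<equiv> \<lambda>c::'a. fps_const (to_ac c)"
  assumes point: "b ^ \<beta> = ev to_ac a A"
  obtains v d \<xi> \<phi> where "place \<iota> v" and "0 \<le> v x" and "d > 0" and "\<And>f. fls_subdegree (\<phi> f) = d * v f"
    and "\<xi> $ 0 = a" and "(fps_const b + fps_X) ^ \<beta> - fps_const (b ^ \<beta>) dvd \<xi> - fps_const a"
    and "ring_map \<phi>" and "\<And>H. \<phi> (eval2 \<iota> x y H) = fps_to_fls (ev (ev \<kappa> \<xi>) (fps_const b + fps_X) H)"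
proof -
  obtain \<xi> \<phi> where \<xi>: "\<xi> $ 0 = a" and dvd: "(fps_const b + fps_X) ^ \<beta> - fps_const (b ^ \<beta>) dvd \<xi> - fps_const a"
    and \<phi>: "ring_map \<phi>" and \<phi>_eval: "\<And>H. \<phi> (eval2 \<iota> x y H) = fps_to_fls (ev (ev \<kappa> \<xi>) (fps_const b + fps_X) H)"
    unfolding \<kappa>_def
    apply (rule affine_branch[OF point])
    subgoal premises prems by (rule prems(1)[OF prems(2-)])
    done
  interpret \<kappa>: ring_map \<kappa> unfolding \<kappa>_def by (intro ring_map_compose[OF ring_map_to_ac] ring_map_fps_const)
  interpret \<kappa>x: ring_map "ev \<kappa> \<xi>" by (rule \<kappa>.ring_map_ev)
  interpret at0: ring_map "\<lambda>f :: 'a alg_closure fps. f $ 0" by (rule ring_map_fps_nth_0)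
  have \<phi>_x: "\<phi> (ev \<iota> x g) = fps_to_fls (ev \<kappa> \<xi> g)" for g
    using \<phi>_eval[of "[:g:]"] by (simp add: eval2_const)
  have const: "fls_subdegree (\<phi> (\<iota> c)) = 0" for c
    using \<phi>_x[of "[:c:]"] by simp (simp add: \<kappa>_def fls_subdegree_fls_to_fps)
  obtain g :: "'a poly" where g: "g \<noteq> 0" "ev to_ac a g = 0" using alg_closure_algebraic by blast
  have "(ev \<kappa> \<xi> g) $ 0 = ev to_ac (\<xi> $ 0) g"
    by (rule at0.ev_ev) (auto simp: \<kappa>_def \<kappa>.ring_map_axioms[unfolded \<kappa>_def])
  hence g0: "(ev \<kappa> \<xi> g) $ 0 = 0" using g \<xi> by simp
  have "\<phi> (ev \<iota> x g) \<noteq> 0" using g(1) ring_map_field_eq_0_iff[OF \<phi>] by simp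
  hence "subdegree (ev \<kappa> \<xi> g) > 0" using g0 by (auto simp: \<phi>_x subdegree_pos_iff)
  hence t0: "fls_subdegree (\<phi> (ev \<iota> x g)) \<noteq> 0" by (simp add: \<phi>_x fls_subdegree_fls_to_fps)
  obtain v d where v: "place \<iota> v" "d > 0" "\<And>f. fls_subdegree (\<phi> f) = d * v f"
    apply (rule place_of_Laurent_embedding[where \<iota> = \<iota>, OF \<phi> const t0])
    subgoal premises prems by (rule prems(1)[OF prems(2-)])
    done
  have "\<phi> x = fps_to_fls \<xi>" using \<phi>_x[of "[:0, 1:]"] by simp
  hence "0 \<le> d * v x" using v(3)[of x] by (simp add: fls_subdegree_fls_to_fps flip: v(3))
  hence vx: "0 \<le> v x" using v(2) by (simp add: zero_le_mult_iff)
  show thesis by (rule that) fact+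
qed

text \<open>
  The affine coordinate ring is integrally closed.  Take a fraction \<open>z = H/g\<close> in which \<open>g\<close> has the least possible degree: at a root \<open>a\<close> of \<open>g\<close> regularity
  of \<open>z\<close> at all points above \<open>a\<close> makes every coefficient of \<open>H\<close> vanish at \<open>a\<close>, so that the minimal polynomial
  of \<open>a\<close> could be cancelled.  For the vanishing, \<open>h(T) = H(a, T)\<close> has degree less than \<open>\<beta>\<close>: if \<open>A(a) \<noteq> 0\<close>,
  it vanishes at the \<open>\<beta>\<close> distinct roots of \<open>T^\<beta> = A(a)\<close>; if \<open>A(a) = 0\<close>, the point above \<open>a\<close> is totally
  ramified and \<open>T^\<beta>\<close> divides \<open>h(T)\<close>.
\<close>

lemma regular_imp_polynomial:
  assumes regular: "\<And>v. place \<iota> v \<Longrightarrow> 0 \<le> v x \<Longrightarrow> 0 \<le> v z"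
  shows "\<exists>H. z = eval2 \<iota> x y H"
proof -
  define den where "den = (\<lambda>g. g \<noteq> 0 \<and> (\<exists>H. ev \<iota> x g * z = eval2 \<iota> x y H))"
  have "\<exists>g. den g" unfolding den_def using fraction_with_denominator_in_x[of z] by metis
  then obtain g where g: "den g" and least: "\<And>g'. den g' \<Longrightarrow> degree g \<le> degree g'"
    using ex_has_least_nat[of den _ degree] by metis
  obtain H0 where H0: "ev \<iota> x g * z = eval2 \<iota> x y H0" and g0: "g \<noteq> 0" using g by (auto simp: den_def)
  obtain H where degH: "degree H < \<beta>" and H: "ev \<iota> x g * z = eval2 \<iota> x y H"
    using normal_form[of H0] H0 by metis
  show ?thesis
  proof (cases "degree g = 0")
    case True
    then obtain c where c: "g = [:c:]" using degree_eq_zeroE by blast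
    hence "c \<noteq> 0" using g0 by auto
    have "eval2 \<iota> x y ([:[:1 / c:]:] * H) = \<iota> (1 / c) * (\<iota> c * z)"
      using H by (simp only: exy.mult eval2_const) (simp add: c)
    also have "\<dots> = z" using \<open>c \<noteq> 0\<close> \<iota>.mult[of "1 / c" c] by (simp del: \<iota>.mult flip: mult.assoc)
    finally show ?thesis by metis
  next
    case False
    interpret ac: ring_map "to_ac :: 'a \<Rightarrow> 'a alg_closure" by (rule ring_map_to_ac)
    define \<kappa> where "\<kappa> = (\<lambda>c::'a. fps_const (to_ac c))"
    interpret \<kappa>: ring_map \<kappa> unfolding \<kappa>_def by (intro ring_map_compose[OF ring_map_to_ac] ring_map_fps_const)
    interpret fl: ring_map "fps_to_fls :: 'a alg_closure fps \<Rightarrow> _" by (rule ring_map_fps_to_fls)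
    have "degree (map_poly to_ac g) = degree g"
      by (rule map_poly_degree_eq) (use g0 in simp)
    then obtain a where a: "ev to_ac a g = 0" using alg_closed_imp_poly_has_root[of "map_poly to_ac g"] False by auto
    interpret aca: ring_map "ev to_ac a" by (rule ac.ring_map_ev)
    define h where "h = map_poly (ev to_ac a) H"
    have degh: "degree h < \<beta>" unfolding h_def using map_poly_degree_leq[of "ev to_ac a" H] degH by simp
    have key: "(fps_const b + fps_X) ^ \<beta> - fps_const (b ^ \<beta>) dvd ev fps_const (fps_const b + fps_X) h"
      if b: "b ^ \<beta> = ev to_ac a A" for b
    proof -
      obtain v d \<xi> \<phi> where v: "place \<iota> v" "0 \<le> v x" "d > 0" "\<And>f. fls_subdegree (\<phi> f) = d * v f"
        and \<xi>: "\<xi> $ 0 = a" "(fps_const b + fps_X) ^ \<beta> - fps_const (b ^ \<beta>) dvd \<xi> - fps_const a"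
        and \<phi>: "ring_map \<phi>" "\<And>H. \<phi> (eval2 \<iota> x y H) = fps_to_fls (ev (ev \<kappa> \<xi>) (fps_const b + fps_X) H)"
        apply (rule affine_place[OF b, folded \<kappa>_def])
        subgoal premises prems by (rule prems(1)[OF prems(2-)])
        done
      interpret \<phi>: ring_map \<phi> by fact
      interpret \<kappa>x: ring_map "ev \<kappa> \<xi>" by (rule \<kappa>.ring_map_ev)
      let ?Y = "fps_const b + fps_X"
      have const_ev: "ev \<kappa> (fps_const a) p = fps_const (ev to_ac a p)" for p
        by (rule ring_map.ev_ev[OF ring_map_fps_const, symmetric]) (simp_all add: \<kappa>_def ring_map_to_ac)
      have cong: "\<xi> - fps_const a dvd ev \<kappa> \<xi> p - fps_const (ev to_ac a p)" for p
        unfolding const_ev[symmetric] by (rule \<kappa>.dvd_ev_diff)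
      have "0 \<le> fls_subdegree (\<phi> z)" using regular[OF v(1,2)] v(3,4) by simp
      hence Z: "\<phi> z = fps_to_fls (fls_regpart (\<phi> z))" by (rule fls_regpart_to_fls_trivial[symmetric])
      define Z where "Z = fls_regpart (\<phi> z)"
      have Z: "\<phi> z = fps_to_fls Z" unfolding Z_def by (rule Z)
      have "fps_to_fls (ev (ev \<kappa> \<xi>) ?Y H) = \<phi> (eval2 \<iota> x y [:g:] * z)"
        unfolding \<phi>(2)[symmetric] H[symmetric] eval2_const ..
      also have "\<dots> = \<phi> (eval2 \<iota> x y [:g:]) * \<phi> z" by (rule \<phi>.mult)
      also have "\<dots> = fps_to_fls (ev \<kappa> \<xi> g * Z)" unfolding \<phi>(2) Z by simp
      finally have "ev (ev \<kappa> \<xi>) ?Y H = ev \<kappa> \<xi> g * Z" by (simp only: fps_to_fls_eq_iff)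
      moreover have "\<xi> - fps_const a dvd ev \<kappa> \<xi> g" using cong[of g] a by simp
      ultimately have "\<xi> - fps_const a dvd ev (ev \<kappa> \<xi>) ?Y H" by simp
      moreover have "\<xi> - fps_const a dvd ev (ev \<kappa> \<xi>) ?Y H - ev fps_const ?Y h"
      proof -
        have "ev (ev \<kappa> \<xi>) ?Y H - ev fps_const ?Y h
            = (\<Sum>j<\<beta>. (ev \<kappa> \<xi> (coeff H j) - fps_const (ev to_ac a (coeff H j))) * ?Y ^ j)"
          unfolding \<kappa>x.ev_altdef[OF degH] ring_map.ev_altdef[OF ring_map_fps_const degh]
          by (simp add: h_def coeff_map_poly sum_subtractf left_diff_distrib)
        also have "\<xi> - fps_const a dvd \<dots>" by (intro dvd_sum dvd_mult2 cong)
        finally show ?thesis .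
      qed
      ultimately have "\<xi> - fps_const a dvd ev fps_const ?Y h" by (metis dvd_diff_right_iff)
      with \<xi>(2) show ?thesis by (rule dvd_trans)
    qed
    have "h = 0"
    proof (cases "ev to_ac a A = 0")
      case False
      have "poly h b = 0" if b: "b ^ \<beta> = ev to_ac a A" for b
      proof -
        interpret at0: ring_map "\<lambda>f :: 'a alg_closure fps. f $ 0" by (rule ring_map_fps_nth_0)
        obtain R where "ev fps_const (fps_const b + fps_X) h = ((fps_const b + fps_X) ^ \<beta> - fps_const (b ^ \<beta>)) * R"
          using key[OF b] by blast
        hence "ev fps_const (fps_const b + fps_X) h $ 0 = (((fps_const b + fps_X) ^ \<beta> - fps_const (b ^ \<beta>)) * R) $ 0"
          by (rule arg_cong)
        also have "\<dots> = 0" by (simp add: fps_power_zeroth)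
        finally have "ev fps_const (fps_const b + fps_X) h $ 0 = 0" .
        moreover have "ev fps_const (fps_const b + fps_X) h $ 0 = ev (\<lambda>c. c) ((fps_const b + fps_X) $ 0) h"
          by (rule at0.ev_ev) (auto simp: ring_map_fps_const)
        ultimately show ?thesis by simp
      qed
      hence sub: "{b. b ^ \<beta> = ev to_ac a A} \<subseteq> {b. poly h b = 0}" by blast
      have "of_nat \<beta> \<noteq> (0 :: 'a alg_closure)"
        using of_nat_\<beta> by (metis to_ac_of_nat to_ac_eq_0_iff)
      hence card: "card {b. b ^ \<beta> = ev to_ac a A} = \<beta>" using False by (rule card_nth_roots_alg_closed)
      show "h = 0"
      proof (rule ccontr)
        assume "h \<noteq> 0"
        hence "\<beta> \<le> degree h"
          using card_mono[OF poly_roots_finite sub] card_poly_roots_bound[of h] card by fastforce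
        thus False using degh by simp
      qed
    next
      case True
      have "ev fps_const (fps_const 0 + fps_X) h = fps_of_poly h"
        using fps_of_poly_pcompose_linear[where Z = fps_X and a = 0 and P = h] by (simp add: pcompose_idR)
      moreover have "(0 :: 'a alg_closure) ^ \<beta> = ev to_ac a A" using True \<beta>_pos by (simp add: power_0_left)
      ultimately have "fps_X ^ \<beta> dvd fps_of_poly h" using key[of 0] \<beta>_pos by (simp add: power_0_left)
      then obtain R where R: "fps_of_poly h = fps_X ^ \<beta> * R" by blast
      have "coeff h j = 0" for j
      proof (cases "j < \<beta>")
        case True
        have "fps_of_poly h $ j = 0" unfolding R using True by (simp add: fps_X_power_mult_nth)
        thus ?thesis by simp
      next
        case False
        thus ?thesis using degh by (simp add: coeff_eq_0)
      qed
      thus "h = 0" by (simp add: poly_eq_iff)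
    qed
    hence vanish: "ev to_ac a (coeff H j) = 0" for j
      by (metis aca.zero coeff_0 coeff_map_poly h_def)
    obtain \<pi> where \<pi>: "\<pi> \<noteq> 0" "ev to_ac a \<pi> = 0"
      and \<pi>_least: "\<And>p. p \<noteq> 0 \<Longrightarrow> ev to_ac a p = 0 \<Longrightarrow> degree \<pi> \<le> degree p"
      using ex_has_least_nat[of "\<lambda>p::'a poly. p \<noteq> 0 \<and> ev to_ac a p = 0" g degree] g0 a by blast
    have deg\<pi>: "degree \<pi> > 0"
    proof (rule Nat.gr0I)
      assume "degree \<pi> = 0"
      then obtain c where "\<pi> = [:c:]" using degree_eq_zeroE by blast
      thus False using \<pi> by simp
    qed
    have \<pi>_dvd: "\<pi> dvd p" if p: "ev to_ac a p = 0" for p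
    proof -
      have "ev to_ac a (\<pi> * (p div \<pi>) + p mod \<pi>) = 0" using p by (simp only: mult_div_mod_eq)
      hence "ev to_ac a (p mod \<pi>) = 0" using \<pi>(2) by (simp only: aca.add aca.mult mult_zero_left add_0)
      moreover have "p mod \<pi> = 0 \<or> degree (p mod \<pi>) < degree \<pi>" using \<pi>(1) by (rule degree_mod_less)
      ultimately have "p mod \<pi> = 0" using \<pi>_least[of "p mod \<pi>"] by force
      thus ?thesis by (simp add: dvd_eq_mod_eq_0)
    qed
    obtain g' where g': "g = \<pi> * g'" using \<pi>_dvd[OF a] by blast
    have "[:\<pi>:] dvd H" unfolding const_poly_dvd_iff using vanish \<pi>_dvd by blast
    then obtain H' where H': "H = [:\<pi>:] * H'" by blast
    have "ev \<iota> x \<pi> * (ev \<iota> x g' * z) = ev \<iota> x \<pi> * eval2 \<iota> x y H'"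
      using H unfolding g' H' by (simp only: exy.mult eval2_const ex.mult mult.assoc)
    hence "ev \<iota> x g' * z = eval2 \<iota> x y H'" using \<pi>(1) by simp
    hence "den g'" using g0 g' by (auto simp: den_def)
    hence "degree g \<le> degree g'" by (rule least)
    moreover have "degree g = degree \<pi> + degree g'" using g0 unfolding g' by (intro degree_mult_eq) auto
    ultimately show ?thesis using deg\<pi> by simp
  qed
qed

end


section \<open>The place at infinity\<close>

definition support :: "'a::field poly poly \<Rightarrow> (nat \<times> nat) set" where
  "support H = {(i, j). coeff (coeff H j) i \<noteq> 0}"

lemma finite_support: "finite (support H)"
proof (rule finite_subset)
  show "support H \<subseteq> (\<Union>j\<in>{..degree H}. (\<lambda>i. (i, j)) ` {..degree (coeff H j)})"
  proof
    fix p assume "p \<in> support H"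
    then obtain i j where p: "p = (i, j)" "coeff (coeff H j) i \<noteq> 0" by (auto simp: support_def)
    hence "coeff H j \<noteq> 0" by auto
    hence "j \<le> degree H" by (rule le_degree)
    moreover have "i \<le> degree (coeff H j)" using p(2) by (rule le_degree)
    ultimately show "p \<in> (\<Union>j\<in>{..degree H}. (\<lambda>i. (i, j)) ` {..degree (coeff H j)})"
      using p(1) by auto
  qed
qed auto

lemma support_nonempty: "H \<noteq> 0 \<Longrightarrow> support H \<noteq> {}"
  by (auto simp: support_def poly_eq_iff)

lemma eval2_altdef:
  assumes "ring_map \<kappa>"
  shows "eval2 \<kappa> \<xi> \<upsilon> H = (\<Sum>(i, j)\<in>support H. \<kappa> (coeff (coeff H j) i) * (\<xi> ^ i * \<upsilon> ^ j))"
proof -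
  interpret \<kappa>: ring_map \<kappa> by fact
  interpret \<kappa>x: ring_map "ev \<kappa> \<xi>" by (rule \<kappa>.ring_map_ev)
  define n where "n = Suc (degree H)"
  define m where "m = Suc (\<Sum>j\<le>degree H. degree (coeff H j))"
  have m: "degree (coeff H j) < m" for j
  proof (cases "j \<le> degree H")
    case True
    thus ?thesis using member_le_sum[of j "{..degree H}" "\<lambda>j. degree (coeff H j)"] by (simp add: m_def)
  qed (simp add: m_def coeff_eq_0)
  have "eval2 \<kappa> \<xi> \<upsilon> H = (\<Sum>j<n. \<Sum>i<m. \<kappa> (coeff (coeff H j) i) * (\<xi> ^ i * \<upsilon> ^ j))"
  proof -
    have "degree H < n" by (simp add: n_def)
    thus ?thesis
      unfolding eval2_ev by (simp only: \<kappa>x.ev_altdef \<kappa>.ev_altdef[OF m] sum_distrib_right mult.assoc)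
  qed
  also have "\<dots> = (\<Sum>(i, j)\<in>{..<m} \<times> {..<n}. \<kappa> (coeff (coeff H j) i) * (\<xi> ^ i * \<upsilon> ^ j))"
    by (subst sum.swap) (simp add: sum.cartesian_product)
  also have "\<dots> = (\<Sum>(i, j)\<in>support H. \<kappa> (coeff (coeff H j) i) * (\<xi> ^ i * \<upsilon> ^ j))"
  proof (rule sum.mono_neutral_right)
    show "support H \<subseteq> {..<m} \<times> {..<n}"
    proof
      fix p assume "p \<in> support H"
      then obtain i j where p: "p = (i, j)" "coeff (coeff H j) i \<noteq> 0" by (auto simp: support_def)
      have "i < m" using le_degree[OF p(2)] m[of j] by simp
      moreover have "coeff H j \<noteq> 0" using p(2) by auto
      hence "j < n" using le_degree[of H j] by (simp add: n_def)
      ultimately show "p \<in> {..<m} \<times> {..<n}" using p(1) by simp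
    qed
  qed (auto simp: support_def)
  finally show ?thesis .
qed

lemma (in valuation) v_ev:
  assumes "ring_map \<kappa>" and const: "\<And>c. c \<noteq> 0 \<Longrightarrow> \<kappa> c \<noteq> 0 \<and> v (\<kappa> c) = 0"
    and \<xi>: "\<xi> \<noteq> 0" "v \<xi> < 0" and g: "g \<noteq> 0"
  shows "ev \<kappa> \<xi> g \<noteq> 0" and "v (ev \<kappa> \<xi> g) = int (degree g) * v \<xi>"
proof -
  interpret \<kappa>: ring_map \<kappa> by fact
  define I where "I = {i. coeff g i \<noteq> 0}"
  have I: "finite I" "I \<noteq> {}"
    unfolding I_def using g MOST_coeff_eq_0[of g] by (auto simp: poly_eq_iff eventually_cofinite)
  have "ev \<kappa> \<xi> g = (\<Sum>i<Suc (degree g). \<kappa> (coeff g i) * \<xi> ^ i)" by (rule \<kappa>.ev_altdef) simp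
  also have "\<dots> = (\<Sum>i\<in>I. \<kappa> (coeff g i) * \<xi> ^ i)"
    by (rule sum.mono_neutral_right) (auto simp: I_def less_Suc_eq_le le_degree)
  finally have eq: "ev \<kappa> \<xi> g = (\<Sum>i\<in>I. \<kappa> (coeff g i) * \<xi> ^ i)" .
  have val: "\<kappa> (coeff g i) * \<xi> ^ i \<noteq> 0 \<and> v (\<kappa> (coeff g i) * \<xi> ^ i) = int i * v \<xi>" if "i \<in> I" for i
    using that const[of "coeff g i"] \<xi> by (simp add: I_def v_mult v_power)
  have inj: "inj_on (\<lambda>i. v (\<kappa> (coeff g i) * \<xi> ^ i)) I"
    by (rule inj_onI) (use val \<xi> in simp)
  note * = v_sum_distinct[OF I _ inj, folded eq]
  show "ev \<kappa> \<xi> g \<noteq> 0" using * val by blast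
  have "v (ev \<kappa> \<xi> g) = Min ((\<lambda>i. v (\<kappa> (coeff g i) * \<xi> ^ i)) ` I)" using * val by blast
  also have "(\<lambda>i. v (\<kappa> (coeff g i) * \<xi> ^ i)) ` I = (\<lambda>i. int i * v \<xi>) ` I" using val by (intro image_cong) auto
  also have "Min \<dots> = int (degree g) * v \<xi>"
  proof (rule Min_eqI)
    show "int (degree g) * v \<xi> \<in> (\<lambda>i. int i * v \<xi>) ` I" using g by (auto simp: I_def)
    show "int (degree g) * v \<xi> \<le> k" if "k \<in> (\<lambda>i. int i * v \<xi>) ` I" for k
      using that \<xi>(2) by (auto simp: I_def le_degree intro!: mult_right_mono_neg)
  qed (use I in auto)
  finally show "v (ev \<kappa> \<xi> g) = int (degree g) * v \<xi>" .
qed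

context kummer_function_field begin

text \<open>The pole orders of \<open>x\<close> and \<open>y\<close> at infinity are \<open>\<beta>\<close> and \<open>\<alpha>\<close>.\<close>

definition weight :: "nat \<times> nat \<Rightarrow> nat" where
  "weight = (\<lambda>(i, j). \<beta> * i + \<alpha> * j)"

definition pole_order :: "'a poly poly \<Rightarrow> nat" where
  "pole_order H = Max (weight ` support H)"

lemma weight_inj:
  assumes "j < \<beta>" and "j' < \<beta>" and "weight (i, j) = weight (i', j')"
  shows "(i, j) = (i', j')"
proof -
  have eq: "\<beta> * i + \<alpha> * j = \<beta> * i' + \<alpha> * j'" using assms(3) by (simp add: weight_def)
  hence "(\<beta> * i + \<alpha> * j) mod \<beta> = (\<beta> * i' + \<alpha> * j') mod \<beta>" by simp
  hence "[\<alpha> * j = \<alpha> * j'] (mod \<beta>)" by (simp add: cong_def)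
  hence "[j = j'] (mod \<beta>)" using coprime cong_mult_lcancel_nat by blast
  hence "j = j'" using assms by (simp add: cong_def)
  thus ?thesis using eq \<beta>_pos by simp
qed

lemma support_less: "degree H < \<beta> \<Longrightarrow> (i, j) \<in> support H \<Longrightarrow> j < \<beta>"
  using le_degree[of H j] by (force simp: support_def)

text \<open>The monomials \<open>x^i y^j\<close> with \<open>j < \<beta>\<close> have pairwise distinct orders at infinity, so there is no cancellation.\<close>

lemma valuation_at_infinity:
  assumes "valuation v" and \<kappa>: "ring_map \<kappa>" and const: "\<And>c. c \<noteq> 0 \<Longrightarrow> \<kappa> c \<noteq> 0 \<and> v (\<kappa> c) = 0"
    and \<xi>: "\<xi> \<noteq> 0" "v \<xi> = - (k * int \<beta>)" and \<upsilon>: "\<upsilon> \<noteq> 0" "v \<upsilon> = - (k * int \<alpha>)" and k: "k > 0"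
    and H: "H \<noteq> 0" "degree H < \<beta>"
  shows "eval2 \<kappa> \<xi> \<upsilon> H \<noteq> 0" and "v (eval2 \<kappa> \<xi> \<upsilon> H) = - (k * int (pole_order H))"
proof -
  interpret valuation v by fact
  let ?t = "\<lambda>(i, j). \<kappa> (coeff (coeff H j) i) * (\<xi> ^ i * \<upsilon> ^ j)"
  have eq: "eval2 \<kappa> \<xi> \<upsilon> H = sum ?t (support H)" by (rule eval2_altdef[OF \<kappa>])
  have val: "?t p \<noteq> 0 \<and> v (?t p) = - (k * int (weight p))" if "p \<in> support H" for p
  proof -
    obtain i j where p: "p = (i, j)" by fastforce
    have "\<kappa> (coeff (coeff H j) i) \<noteq> 0 \<and> v (\<kappa> (coeff (coeff H j) i)) = 0"
      using that by (intro const) (simp add: p support_def)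
    thus ?thesis using \<xi> \<upsilon> by (simp add: p weight_def v_mult v_power algebra_simps)
  qed
  have inj: "inj_on (\<lambda>p. v (?t p)) (support H)"
  proof (rule inj_onI)
    fix p p' assume p: "p \<in> support H" "p' \<in> support H" and "v (?t p) = v (?t p')"
    hence "weight p = weight p'" using val k by simp
    thus "p = p'" using p weight_inj support_less[OF H(2)] by (metis surj_pair)
  qed
  note * = v_sum_distinct[OF finite_support support_nonempty[OF H(1)] _ inj, folded eq]
  show "eval2 \<kappa> \<xi> \<upsilon> H \<noteq> 0" using * val by blast
  have "v (eval2 \<kappa> \<xi> \<upsilon> H) = Min ((\<lambda>p. v (?t p)) ` support H)" using * val by blast
  also have "(\<lambda>p. v (?t p)) ` support H = (\<lambda>p. - (k * int (weight p))) ` support H"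
    using val by (intro image_cong) auto
  also have "Min \<dots> = - (k * int (pole_order H))"
  proof (rule Min_eqI)
    have "pole_order H \<in> weight ` support H"
      unfolding pole_order_def using finite_support support_nonempty[OF H(1)] by (intro Max_in) auto
    thus "- (k * int (pole_order H)) \<in> (\<lambda>p. - (k * int (weight p))) ` support H" by auto
    show "- (k * int (pole_order H)) \<le> l" if l: "l \<in> (\<lambda>p. - (k * int (weight p))) ` support H" for l
    proof -
      obtain p where p: "p \<in> support H" "l = - (k * int (weight p))" using l by blast
      have "weight p \<le> pole_order H"
        unfolding pole_order_def using p(1) finite_support by (intro Max_ge) auto
      thus ?thesis using k by (simp add: p(2))
    qed
  qed (use finite_support in auto)
  finally show "v (eval2 \<kappa> \<xi> \<upsilon> H) = - (k * int (pole_order H))" .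
qed

lemma x_nonzero: "x \<noteq> 0" and y_nonzero: "y \<noteq> 0"
proof -
  have "ev \<iota> x [:0, 1:] \<noteq> 0" by (simp only: ev_x_eq_0_iff) simp
  thus "x \<noteq> 0" by simp
  have "ev \<iota> x A \<noteq> 0" using degree_A \<alpha>_ge by auto
  thus "y \<noteq> 0" using \<beta>_pos by (auto simp flip: curve_equation)
qed

lemma place_const: "place \<iota> v \<Longrightarrow> c \<noteq> 0 \<Longrightarrow> \<iota> c \<noteq> 0 \<and> v (\<iota> c) = 0"
  by (simp add: place_def)

text \<open>
  Comparing \<open>y^\<beta>\<close> with \<open>A(x)\<close> gives \<open>v(x) = - k \<beta>\<close> and \<open>v(y) = - k \<alpha>\<close> for some \<open>k > 0\<close>, and then \<open>k\<close>
  divides every value of \<open>v\<close>.  As \<open>v\<close> takes the value 1, it follows that \<open>k = 1\<close>.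
\<close>

lemma infinite_place_values:
  assumes v: "place \<iota> v" and vx: "v x < 0"
  shows "v x = - int \<beta>" and "H \<noteq> 0 \<Longrightarrow> degree H < \<beta> \<Longrightarrow> v (eval2 \<iota> x y H) = - int (pole_order H)"
proof -
  interpret valuation v using v by (rule place_valuation)
  have "A \<noteq> 0" using degree_A \<alpha>_ge by auto
  hence "v (ev \<iota> x A) = int \<alpha> * v x"
    using v_ev(2)[OF \<iota>.ring_map_axioms place_const[OF v] x_nonzero vx] degree_A by simp
  moreover have "v (ev \<iota> x A) = int \<beta> * v y" by (simp flip: curve_equation add: v_power y_nonzero)
  ultimately have eq: "int \<beta> * v y = int \<alpha> * v x" by simp
  hence "int \<beta> dvd int \<alpha> * v x" by (metis dvd_triv_left)
  hence "int \<beta> dvd v x" using coprime by (simp add: coprime_dvd_mult_right_iff coprime_commute)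
  then obtain s where s: "v x = int \<beta> * s" by blast
  define k where "k = - s"
  have k: "k > 0" using vx s \<beta>_pos by (simp add: k_def mult_less_0_iff)
  have vx': "v x = - (k * int \<beta>)" by (simp add: s k_def)
  have "int \<beta> * v y = int \<beta> * (- (k * int \<alpha>))" by (simp add: eq s k_def)
  hence vy: "v y = - (k * int \<alpha>)" using \<beta>_pos by (simp only: mult_cancel_left) simp
  have val: "v (eval2 \<iota> x y H) = - (k * int (pole_order H))" if "H \<noteq> 0" "degree H < \<beta>" for H
    by (rule valuation_at_infinity[OF place_valuation[OF v] \<iota>.ring_map_axioms place_const[OF v]
          x_nonzero vx' y_nonzero vy k that])
  have dvd: "k dvd v (eval2 \<iota> x y H)" if "eval2 \<iota> x y H \<noteq> 0" for H
  proof -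
    obtain H' where H': "degree H' < \<beta>" "eval2 \<iota> x y H' = eval2 \<iota> x y H" by (rule normal_form)
    hence "H' \<noteq> 0" using that by auto
    from val[OF this H'(1)] show ?thesis unfolding H'(2) by simp
  qed
  obtain z where z: "v z = 1" using v by (auto simp: place_def)
  obtain g F where gH: "g \<noteq> 0" "ev \<iota> x g * z = eval2 \<iota> x y F" by (rule fraction_with_denominator_in_x)
  have z0: "z \<noteq> 0" using z v by (auto simp: place_def)
  have nz: "eval2 \<iota> x y F \<noteq> 0" using gH z0 by (simp flip: gH(2))
  have "v (eval2 \<iota> x y F) = v (eval2 \<iota> x y [:g:]) + 1"
    unfolding gH(2)[symmetric] eval2_const using gH(1) z0 z by (simp add: v_mult)
  moreover have "k dvd v (eval2 \<iota> x y [:g:])" using gH(1) by (intro dvd) (simp add: eval2_const)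
  ultimately have "k dvd 1" using dvd[OF nz] by (metis dvd_add_right_iff)
  hence k1: "k = 1" using k by simp
  show "v x = - int \<beta>" using vx' k1 by simp
  show "v (eval2 \<iota> x y H) = - int (pole_order H)" if "H \<noteq> 0" "degree H < \<beta>"
    using val[OF that] k1 by simp
qed

lemma place_eqI:
  assumes v: "place \<iota> v" and w: "place \<iota> w"
    and eq: "\<And>H. eval2 \<iota> x y H \<noteq> 0 \<Longrightarrow> v (eval2 \<iota> x y H) = w (eval2 \<iota> x y H)"
  shows "v = w"
proof
  fix z
  interpret v: valuation v using v by (rule place_valuation)
  interpret w: valuation w using w by (rule place_valuation)
  show "v z = w z"
  proof (cases "z = 0")
    case False
    obtain g H where gH: "g \<noteq> 0" "ev \<iota> x g * z = eval2 \<iota> x y H" by (rule fraction_with_denominator_in_x)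
    have "eval2 \<iota> x y H \<noteq> 0" using gH False by (simp flip: gH(2))
    from eq[OF this] have "v (ev \<iota> x g * z) = w (ev \<iota> x g * z)" by (simp only: gH(2))
    moreover have "v (ev \<iota> x g) = w (ev \<iota> x g)"
      using eq[of "[:g:]"] gH(1) by (simp add: eval2_const)
    ultimately show ?thesis using gH(1) False by (simp add: v.v_mult w.v_mult)
  qed (use v w in \<open>simp add: place_def\<close>)
qed

lemma infinite_place_unique:
  assumes v: "place \<iota> v" "v x < 0" and w: "place \<iota> w" "w x < 0"
  shows "v = w"
proof (rule place_eqI[OF v(1) w(1)])
  fix H assume nz: "eval2 \<iota> x y H \<noteq> 0"
  obtain H' where H': "degree H' < \<beta>" "eval2 \<iota> x y H' = eval2 \<iota> x y H" by (rule normal_form)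
  hence "H' \<noteq> 0" using nz by auto
  thus "v (eval2 \<iota> x y H) = w (eval2 \<iota> x y H)"
    using infinite_place_values(2)[OF v _ H'(1)] infinite_place_values(2)[OF w _ H'(1)] H'(2) by simp
qed

text \<open>
  The parametrisation near infinity: with a local parameter \<open>s\<close> put \<open>x = l^e s^(-\<beta>)\<close> and
  \<open>y = l^f s^(-\<alpha>) w\<close>, where \<open>l\<close> is the leading coefficient of \<open>A\<close> and \<open>f \<beta> = 1 + e \<alpha>\<close>.  The equation
  of the curve then becomes \<open>w^\<beta> = 1 + \<dots>\<close>.
\<close>

lemma infinite_branch:
  obtains \<phi> :: "'f \<Rightarrow> 'a fls" where "ring_map \<phi>" and "\<And>c. \<phi> (\<iota> c) = fls_const c"
    and "fls_subdegree (\<phi> x) = - int \<beta>"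
proof -
  interpret fl: ring_map "fps_to_fls :: 'a fps \<Rightarrow> _" by (rule ring_map_fps_to_fls)
  interpret \<kappa>: ring_map "fls_const :: 'a \<Rightarrow> _" by (rule ring_map_fls_const)
  interpret val: valuation "fls_subdegree :: 'a fls \<Rightarrow> int" by (rule fls_valuation)
  define l where "l = lead_coeff A"
  have l: "l \<noteq> 0" unfolding l_def using degree_A \<alpha>_ge by auto
  (* both exponents are chosen such that the leading coefficients of y^beta and A(x) agree *)
  obtain f e where fe: "\<beta> * f = \<alpha> * e + 1" using bezout_nat[of \<beta> \<alpha>] \<beta>_pos coprime
    by (auto simp: gcd.commute)
  define u where "u = (\<Sum>i\<le>\<alpha>. fps_const (coeff A i * l ^ (e * i) / l ^ (\<beta> * f)) * fps_X ^ (\<beta> * (\<alpha> - i)))"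
  have u0: "u $ 0 = 1"
  proof -
    have "u $ 0 = (\<Sum>i\<le>\<alpha>. if i = \<alpha> then coeff A i * l ^ (e * i) / l ^ (\<beta> * f) else 0)"
      unfolding u_def fps_sum_nth using \<beta>_pos by (intro sum.cong) auto
    also have "\<dots> = l * l ^ (e * \<alpha>) / l ^ (\<beta> * f)" by (simp add: l_def degree_A)
    also have "\<dots> = 1" using l by (simp add: fe mult.commute)
    finally show ?thesis .
  qed
  have "poly (pderiv (monom (1::'a) \<beta>)) 1 \<noteq> 0" using of_nat_\<beta> by (simp add: pderiv_monom poly_monom)
  then obtain w where w: "w $ 0 = 1" "ev fps_const w (monom 1 \<beta>) = u"
    using fps_simple_root[of "monom 1 \<beta>" 1 u] u0 by (auto simp: poly_monom)
  have wu: "w ^ \<beta> = u" using w(2) ring_map.ev_monom[OF ring_map_fps_const, where z = w and c = 1 and n = \<beta>] by simp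
  let ?s = "fls_X :: 'a fls"
  define \<xi> where "\<xi> = fls_const (l ^ e) * inverse (?s ^ \<beta>)"
  define \<upsilon> where "\<upsilon> = fls_const (l ^ f) * inverse (?s ^ \<alpha>) * fps_to_fls w"
  have sol: "\<upsilon> ^ \<beta> = ev fls_const \<xi> A"
  proof -
    have "\<upsilon> ^ \<beta> = fls_const (l ^ (\<beta> * f)) * inverse (?s ^ (\<alpha> * \<beta>)) * fps_to_fls u"
      by (simp add: \<upsilon>_def power_mult_distrib power_inverse mult.commute flip: power_mult wu)
    also have "\<dots> = (\<Sum>i\<le>\<alpha>. fls_const (l ^ (\<beta> * f)) * inverse (?s ^ (\<alpha> * \<beta>)) *
        (fls_const (coeff A i * l ^ (e * i) / l ^ (\<beta> * f)) * ?s ^ (\<beta> * (\<alpha> - i))))"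
      by (simp add: u_def sum_distrib_left fps_to_fls_power)
    also have "\<dots> = (\<Sum>i\<le>\<alpha>. fls_const (coeff A i) * \<xi> ^ i)"
    proof (rule sum.cong[OF refl])
      fix i assume "i \<in> {..\<alpha>}"
      hence "?s ^ (\<alpha> * \<beta>) = ?s ^ (\<beta> * i) * ?s ^ (\<beta> * (\<alpha> - i))"
        by (simp flip: power_add distrib_left add: mult.commute)
      hence 1: "inverse (?s ^ (\<alpha> * \<beta>)) * ?s ^ (\<beta> * (\<alpha> - i)) = inverse (?s ^ (\<beta> * i))"
        by (simp add: field_simps)
      have "fls_const (l ^ (\<beta> * f)) * fls_const (coeff A i * l ^ (e * i) / l ^ (\<beta> * f)) = fls_const (coeff A i * l ^ (e * i))"
      proof -
        have "l ^ (\<beta> * f) * (coeff A i * l ^ (e * i) / l ^ (\<beta> * f)) = coeff A i * l ^ (e * i)" using l by simp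
        thus ?thesis by (simp only: \<kappa>.mult[symmetric])
      qed
      hence "fls_const (l ^ (\<beta> * f)) * inverse (?s ^ (\<alpha> * \<beta>)) *
        (fls_const (coeff A i * l ^ (e * i) / l ^ (\<beta> * f)) * ?s ^ (\<beta> * (\<alpha> - i)))
        = fls_const (coeff A i * l ^ (e * i)) * inverse (?s ^ (\<beta> * i))"
        unfolding 1[symmetric] by (simp only: ac_simps)
      also have "\<dots> = fls_const (coeff A i) * \<xi> ^ i"
        by (simp add: \<xi>_def power_mult_distrib power_inverse flip: power_mult)
      finally show "fls_const (l ^ (\<beta> * f)) * inverse (?s ^ (\<alpha> * \<beta>)) *
        (fls_const (coeff A i * l ^ (e * i) / l ^ (\<beta> * f)) * ?s ^ (\<beta> * (\<alpha> - i))) = fls_const (coeff A i) * \<xi> ^ i" .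
    qed
    also have "\<dots> = ev fls_const \<xi> A"
      using \<kappa>.ev_altdef[of A "Suc \<alpha>" \<xi>] degree_A by (simp add: lessThan_Suc_atMost)
    finally show ?thesis .
  qed
  have "w \<noteq> 0" using w(1) by auto
  have subdeg_w: "fls_subdegree (fps_to_fls w) = 0"
    using w(1) by (simp add: fls_subdegree_fls_to_fps subdegree_eq_0_iff)
  have nz: "\<xi> \<noteq> 0" using l by (simp add: \<xi>_def)
  have sx: "fls_subdegree \<xi> = - int \<beta>" using l by (simp add: \<xi>_def fls_subdegree_pow)
  have trans: "ev fls_const \<xi> g \<noteq> 0" if "g \<noteq> 0" for g
    by (rule val.v_ev[OF \<kappa>.ring_map_axioms _ nz _ that]) (use \<beta>_pos in \<open>simp_all add: sx\<close>)
  obtain \<phi> where \<phi>: "ring_map \<phi>" "\<And>H. \<phi> (eval2 \<iota> x y H) = eval2 fls_const \<xi> \<upsilon> H"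
    using embedding_of_solution[OF \<kappa>.ring_map_axioms sol trans] by metis
  interpret \<kappa>x: ring_map "ev fls_const \<xi>" by (rule \<kappa>.ring_map_ev)
  have \<phi>_x: "\<phi> (ev \<iota> x g) = ev fls_const \<xi> g" for g
    using \<phi>(2)[of "[:g:]"] by (simp add: eval2_const) (simp add: eval2_ev)
  show thesis
  proof (rule that[OF \<phi>(1)])
    show "\<phi> (\<iota> c) = fls_const c" for c using \<phi>_x[of "[:c:]"] by simp
    show "fls_subdegree (\<phi> x) = - int \<beta>" using \<phi>_x[of "[:0, 1:]"] sx by simp
  qed
qed

lemma infinite_place:
  obtains v where "v \<in> rational_places \<iota>" and "place \<iota> v" and "v x < 0"
proof -
  obtain \<phi> :: "'f \<Rightarrow> 'a fls" where \<phi>: "ring_map \<phi>" and const: "\<And>c. \<phi> (\<iota> c) = fls_const c"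
    and sx: "fls_subdegree (\<phi> x) = - int \<beta>" using infinite_branch by blast
  interpret \<phi>: ring_map \<phi> by fact
  have c0: "fls_subdegree (\<phi> (\<iota> c)) = 0" for c by (simp add: const)
  have t0: "fls_subdegree (\<phi> x) \<noteq> 0" using sx \<beta>_pos by simp
  obtain v d where v: "place \<iota> v" "d > 0" "\<And>f. fls_subdegree (\<phi> f) = d * v f"
    apply (rule place_of_Laurent_embedding[where \<iota> = \<iota>, OF \<phi> c0 t0])
    subgoal premises prems by (rule prems(1)[OF prems(2-)])
    done
  have "d * v x < 0" using sx \<beta>_pos by (simp flip: v(3))
  hence "v x < 0" using v(2) by (simp add: mult_less_0_iff)
  moreover have "\<exists>c. z - \<iota> c \<in> maximal_ideal v" if z: "z \<in> valuation_ring v" for z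
  proof (intro exI)
    let ?c = "fls_nth (\<phi> z) 0"
    have "0 \<le> fls_subdegree (\<phi> z)" using z v by (auto simp: valuation_ring_def place_def)
    hence "fls_nth (\<phi> (z - \<iota> ?c)) n = 0" if "n \<le> 0" for n
      using that by (cases "n = 0") (auto simp: const)
    hence "z - \<iota> ?c = 0 \<or> 0 < fls_subdegree (\<phi> (z - \<iota> ?c))"
      using ring_map_field_eq_0_iff[OF \<phi>, of "z - \<iota> ?c"] by (metis nth_fls_subdegree_nonzero not_le)
    thus "z - \<iota> ?c \<in> maximal_ideal v" using v(2) by (auto simp: maximal_ideal_def v(3) zero_less_mult_iff simp del: \<phi>.diff)
  qed
  ultimately show thesis using that[of v] v(1) by (auto simp: rational_places_def)
qed

end


context valuation begin

lemma ideal_add: "f \<in> maximal_ideal v \<Longrightarrow> g \<in> maximal_ideal v \<Longrightarrow> f + g \<in> maximal_ideal v"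
  using v_add[of f g]
  by (cases "f = 0 \<or> g = 0 \<or> f + g = 0") (auto simp: maximal_ideal_def min_le_iff_disj)

lemma ring_add: "f \<in> valuation_ring v \<Longrightarrow> g \<in> valuation_ring v \<Longrightarrow> f + g \<in> valuation_ring v"
  using v_add[of f g]
  by (cases "f = 0 \<or> g = 0 \<or> f + g = 0") (auto simp: valuation_ring_def min_le_iff_disj)

lemma ring_mult: "f \<in> valuation_ring v \<Longrightarrow> g \<in> valuation_ring v \<Longrightarrow> f * g \<in> valuation_ring v"
  using v_mult[of f g] by (cases "f = 0 \<or> g = 0") (auto simp: valuation_ring_def)

lemma ideal_mult: "f \<in> maximal_ideal v \<Longrightarrow> g \<in> valuation_ring v \<Longrightarrow> f * g \<in> maximal_ideal v"
  using v_mult[of f g] by (cases "f = 0 \<or> g = 0") (auto simp: valuation_ring_def maximal_ideal_def)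

lemma ideal_subset_ring: "f \<in> maximal_ideal v \<Longrightarrow> f \<in> valuation_ring v"
  by (auto simp: valuation_ring_def maximal_ideal_def)

end


section \<open>The genus\<close>

text \<open>
  Off the axes, the lattice points of the open triangle and their images under the point reflection
  \<open>(i, j) \<mapsto> (\<alpha> - i, \<beta> - j)\<close> are disjoint and lie in a rectangle of \<open>(\<alpha> - 1) (\<beta> - 1)\<close> points.
\<close>

lemma card_lattice_triangle:
  fixes \<alpha> \<beta> :: nat
  assumes "\<alpha> > 0" and "\<beta> > 0"
  defines "T \<equiv> {(i, j). \<beta> * i + \<alpha> * j < \<alpha> * \<beta>}"
  shows "finite T" and "2 * card T \<le> \<alpha> * \<beta> + \<alpha> + \<beta> - 1"
proof -
  have lt: "i < \<alpha> \<and> j < \<beta>" if "(i, j) \<in> T" for i j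
  proof -
    have "\<beta> * i + \<alpha> * j < \<alpha> * \<beta>" using that by (simp add: T_def)
    hence "\<beta> * i < \<beta> * \<alpha>" "\<alpha> * j < \<alpha> * \<beta>" unfolding mult.commute[of \<beta> \<alpha>] by linarith+
    thus ?thesis by simp
  qed
  have "T \<subseteq> {..<\<alpha>} \<times> {..<\<beta>}" using lt by auto
  thus fin: "finite T" by (rule finite_subset) simp
  define axes where "axes = (\<lambda>i. (i, 0::nat)) ` {..<\<alpha>} \<union> (\<lambda>j. (0::nat, j)) ` {1..<\<beta>}"
  define T1 where "T1 = {(i, j) \<in> T. 0 < i \<and> 0 < j}"
  define refl where "refl = (\<lambda>(i, j). (\<alpha> - i, \<beta> - j))"
  have combine: "2 * t \<le> 2 * l + r" if "c \<le> l" "t \<le> c + s" "2 * s \<le> r" for t l c s r :: nat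
    using that by linarith
  have "card axes \<le> \<alpha> + (\<beta> - 1)"
    unfolding axes_def by (rule order.trans[OF card_Un_le]) (intro add_mono order.trans[OF card_image_le], auto)
  moreover have "T \<subseteq> axes \<union> T1"
  proof
    fix p assume p: "p \<in> T"
    obtain i j where ij: "p = (i, j)" by fastforce
    show "p \<in> axes \<union> T1" using p lt[of i j] unfolding ij axes_def T1_def
      by (cases "i = 0"; cases "j = 0") auto
  qed
  hence "card T \<le> card (axes \<union> T1)"
    using fin by (intro card_mono) (auto simp: axes_def T1_def intro: finite_subset[of _ T])
  hence "card T \<le> card axes + card T1" using card_Un_le[of axes T1] by linarith
  moreover have "2 * card T1 \<le> (\<alpha> - 1) * (\<beta> - 1)"
  proof -
    have finT1: "finite T1" unfolding T1_def by (rule finite_subset[OF _ fin]) auto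
    have T1_lt: "0 < i \<and> i < \<alpha> \<and> 0 < j \<and> j < \<beta> \<and> \<beta> * i + \<alpha> * j < \<alpha> * \<beta>" if "(i, j) \<in> T1" for i j
      using that lt[of i j] by (auto simp: T1_def T_def)
    have inj: "inj_on refl T1"
    proof (rule inj_onI)
      fix p p' assume pp: "p \<in> T1" "p' \<in> T1" "refl p = refl p'"
      obtain i j i' j' where ij: "p = (i, j)" "p' = (i', j')" by fastforce
      show "p = p'" using pp T1_lt[of i j] T1_lt[of i' j'] by (auto simp: ij refl_def)
    qed
    have "T1 \<inter> refl ` T1 = {}"
    proof (rule ccontr)
      assume "T1 \<inter> refl ` T1 \<noteq> {}"
      then obtain i j where ij: "(i, j) \<in> T1" "(\<alpha> - i, \<beta> - j) \<in> T1" by (auto simp: refl_def)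
      have "\<beta> * (\<alpha> - i) + \<beta> * i = \<beta> * \<alpha>" "\<alpha> * (\<beta> - j) + \<alpha> * j = \<alpha> * \<beta>"
        using T1_lt[OF ij(1)] by (simp_all flip: distrib_left)
      thus False using T1_lt[OF ij(1)] T1_lt[OF ij(2)] by (simp add: mult.commute)
    qed
    hence "2 * card T1 = card (T1 \<union> refl ` T1)"
      using finT1 by (simp add: card_Un_disjoint card_image[OF inj])
    also have "\<dots> \<le> card ({1..<\<alpha>} \<times> {1..<\<beta>})"
    proof (rule card_mono)
      show "T1 \<union> refl ` T1 \<subseteq> {1..<\<alpha>} \<times> {1..<\<beta>}"
      proof
        fix p assume "p \<in> T1 \<union> refl ` T1"
        then obtain p' where p': "p' \<in> T1" "p = p' \<or> p = refl p'" by blast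
        obtain i j where "p' = (i, j)" by fastforce
        hence ij: "(i, j) \<in> T1" "p = (i, j) \<or> p = (\<alpha> - i, \<beta> - j)" using p' by (auto simp: refl_def)
        thus "p \<in> {1..<\<alpha>} \<times> {1..<\<beta>}" using T1_lt[OF ij(1)] by auto
      qed
    qed auto
    finally show ?thesis by simp
  qed
  ultimately have "2 * card T \<le> 2 * (\<alpha> + (\<beta> - 1)) + (\<alpha> - 1) * (\<beta> - 1)" by (rule combine)
  also have "\<dots> = \<alpha> * \<beta> + \<alpha> + \<beta> - 1"
    using assms(1,2) by (cases \<alpha>; cases \<beta>) (simp_all add: algebra_simps)
  finally show "2 * card T \<le> \<alpha> * \<beta> + \<alpha> + \<beta> - 1" .
qed

text \<open>
  Two elements of the valuation ring are congruent to constants modulo the maximal ideal, hence dependent.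
\<close>

lemma rational_place_degree:
  assumes emb: "field_embedding \<iota>" and v: "v \<in> rational_places \<iota>"
  shows "place_degree \<iota> v = 1"
proof -
  interpret \<iota>: ring_map \<iota> using emb by (simp add: field_embedding_ring_map)
  have pl: "place \<iota> v" using v by (simp add: rational_places_def)
  interpret valuation v using pl by (rule place_valuation)
  have const_m: "\<iota> c \<in> maximal_ideal v \<longleftrightarrow> c = 0" for c
    using pl ring_map_field_eq_0_iff[OF \<iota>.ring_map_axioms, of c] by (auto simp: place_def maximal_ideal_def)
  let ?indep = "\<lambda>B. \<forall>c. (\<Sum>b\<in>B. \<iota> (c b) * b) \<in> maximal_ideal v \<longrightarrow> (\<forall>b\<in>B. c b = 0)"
  have add_m: "f + g \<in> maximal_ideal v" if "f \<in> maximal_ideal v" "g \<in> maximal_ideal v" for f g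
    using that by (rule ideal_add)
  have scale_m: "\<iota> c * f \<in> maximal_ideal v" if "f \<in> maximal_ideal v" for c f
  proof -
    have "\<iota> c \<in> valuation_ring v" using pl by (cases "c = 0") (auto simp: valuation_ring_def place_def)
    with that have "f * \<iota> c \<in> maximal_ideal v" by (rule ideal_mult)
    thus ?thesis by (simp only: mult.commute)
  qed
  show ?thesis
    unfolding place_degree_def
  proof (rule Greatest_equality)
    have "\<forall>c. (\<Sum>b\<in>{1::'b}. \<iota> (c b) * b) \<in> maximal_ideal v \<longrightarrow> (\<forall>b\<in>{1}. c b = 0)"
      by (simp add: const_m)
    moreover have "{1} \<subseteq> valuation_ring v" by (simp add: valuation_ring_def v_1)
    ultimately show "\<exists>B\<subseteq>valuation_ring v. finite B \<and> card B = 1 \<and> ?indep B"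
      by (intro exI[of _ "{1}"]) simp
  next
    fix d assume "\<exists>B\<subseteq>valuation_ring v. finite B \<and> card B = d \<and> ?indep B"
    then obtain B where B: "B \<subseteq> valuation_ring v" "finite B" "card B = d" "?indep B" by blast
    show "d \<le> 1"
    proof (rule ccontr)
      assume "\<not> d \<le> 1"
      then obtain b1 b2 where b: "b1 \<in> B" "b2 \<in> B" "b1 \<noteq> b2"
        using B(2,3) card_le_Suc0_iff_eq[of B] by auto
      obtain r1 r2 where r: "b1 - \<iota> r1 \<in> maximal_ideal v" "b2 - \<iota> r2 \<in> maximal_ideal v"
        using v B(1) b by (auto simp: rational_places_def) blast
      have zero: "c1 = 0 \<and> c2 = 0" if "\<iota> c1 * b1 + \<iota> c2 * b2 \<in> maximal_ideal v" for c1 c2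
      proof -
        define c where "c = (\<lambda>b. if b = b1 then c1 else if b = b2 then c2 else 0)"
        have "(\<Sum>b\<in>B. \<iota> (c b) * b) = (\<Sum>b\<in>{b1, b2}. \<iota> (c b) * b)"
          by (rule sum.mono_neutral_right) (use B(2) b in \<open>auto simp: c_def\<close>)
        also have "\<dots> = \<iota> c1 * b1 + \<iota> c2 * b2" using b(3) by (simp add: c_def)
        finally have "\<forall>b\<in>B. c b = 0" using B(4) that by simp
        thus ?thesis using b by (auto simp: c_def)
      qed
      have "\<iota> r2 * b1 + \<iota> (- r1) * b2 = \<iota> r2 * (b1 - \<iota> r1) + \<iota> (- r1) * (b2 - \<iota> r2)"
        by (simp add: algebra_simps)
      also have "\<dots> \<in> maximal_ideal v" using r by (intro add_m scale_m)
      finally have "r1 = 0" using zero by fastforce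
      hence "\<iota> 1 * b1 + \<iota> 0 * b2 \<in> maximal_ideal v" using r(1) by simp
      thus False using zero by fastforce
    qed
  qed
qed

context kummer_function_field begin

text \<open>
  Functions with poles at infinity only are polynomials in \<open>x\<close> and \<open>y\<close>, whose normal form shows the pole order.
\<close>

lemma riemann_roch_space_at_infinity:
  assumes v: "place \<iota> v" "v x < 0"
    and z: "z \<in> riemann_roch_space \<iota> (\<lambda>w. if w = v then int N else 0)" "z \<noteq> 0"
  shows "\<exists>H. H \<noteq> 0 \<and> degree H < \<beta> \<and> pole_order H \<le> N \<and> z = eval2 \<iota> x y H"
proof -
  define D where "D = (\<lambda>w. if w = v then int N else 0)"
  have L: "- D w \<le> w z" if "place \<iota> w" for w using z that by (simp add: riemann_roch_space_def D_def)
  have "0 \<le> w z" if "place \<iota> w" "0 \<le> w x" for w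
    using L[OF that(1)] that(2) v(2) by (auto simp: D_def split: if_splits)
  then obtain H0 where "z = eval2 \<iota> x y H0" using regular_imp_polynomial by blast
  then obtain H where H: "degree H < \<beta>" "z = eval2 \<iota> x y H" using normal_form[of H0] by metis
  have "H \<noteq> 0" using z(2) H(2) by auto
  moreover have "pole_order H \<le> N"
    using infinite_place_values(2)[OF v \<open>H \<noteq> 0\<close> H(1)] L[OF v(1)] by (simp add: D_def H(2))
  ultimately show ?thesis using H by blast
qed

lemma ell_at_infinity_le:
  assumes v: "place \<iota> v" "v x < 0"
  shows "ell \<iota> (\<lambda>w. if w = v then int N else 0) \<le> card {p. weight p \<le> N}"
proof -
  have emb: "field_embedding \<iota>" using function_field by (simp add: is_function_field_def)
  interpret V: vector_space "\<lambda>c f. \<iota> c * f" by (rule vector_space_over_constants[OF emb])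
  define T where "T = {p. weight p \<le> N}"
  have finT: "finite T"
  proof (rule finite_subset)
    show "T \<subseteq> {..N} \<times> {..N}"
    proof
      fix p assume "p \<in> T"
      moreover obtain i j where "p = (i, j)" by fastforce
      ultimately have p: "p = (i, j)" "\<beta> * i + \<alpha> * j \<le> N" by (auto simp: T_def weight_def)
      have "i \<le> \<beta> * i" "j \<le> \<alpha> * j" using \<beta>_pos \<alpha>_ge by simp_all
      hence "i \<le> N" "j \<le> N" using p(2) by linarith+
      thus "p \<in> {..N} \<times> {..N}" using p by simp
    qed
  qed simp
  let ?m = "\<lambda>(i, j). x ^ i * y ^ j"
  have "riemann_roch_space \<iota> (\<lambda>w. if w = v then int N else 0) \<subseteq> V.span (?m ` T)"
  proof
    fix z assume z: "z \<in> riemann_roch_space \<iota> (\<lambda>w. if w = v then int N else 0)"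
    show "z \<in> V.span (?m ` T)"
    proof (cases "z = 0")
      case False
      then obtain H where H: "pole_order H \<le> N" "z = eval2 \<iota> x y H"
        using riemann_roch_space_at_infinity[OF v z] by blast
      have sub: "support H \<subseteq> T"
      proof
        fix p assume "p \<in> support H"
        hence "weight p \<le> pole_order H"
          unfolding pole_order_def using finite_support by (intro Max_ge) auto
        thus "p \<in> T" using H(1) by (simp add: T_def)
      qed
      have "(\<Sum>(i, j)\<in>support H. \<iota> (coeff (coeff H j) i) * (x ^ i * y ^ j)) \<in> V.span (?m ` T)"
      proof (rule V.span_sum)
        fix p assume p: "p \<in> support H"
        obtain i j where ij: "p = (i, j)" by fastforce
        have "x ^ i * y ^ j \<in> ?m ` T" using p sub ij by force
        hence "\<iota> (coeff (coeff H j) i) * (x ^ i * y ^ j) \<in> V.span (?m ` T)"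
          by (intro V.span_scale V.span_base)
        thus "(case p of (i, j) \<Rightarrow> \<iota> (coeff (coeff H j) i) * (x ^ i * y ^ j)) \<in> V.span (?m ` T)"
          by (simp add: ij)
      qed
      thus ?thesis unfolding H(2) eval2_altdef[OF \<iota>.ring_map_axioms] .
    qed (simp add: V.span_zero)
  qed
  hence "ell \<iota> (\<lambda>w. if w = v then int N else 0) \<le> card (?m ` T)"
    unfolding ell_def using finT by (intro V.dim_le_card) auto
  also have "\<dots> \<le> card T" using finT by (rule card_image_le)
  finally show ?thesis by (simp add: T_def)
qed

text \<open>
  The divisor \<open>N P\<close> with \<open>P\<close> the place at infinity and \<open>N = \<alpha> \<beta> - 1\<close> attains the bound.  The choice of
  \<open>N\<close> makes the admissible monomials \<open>x^i y^j\<close> exactly the lattice points of an open triangle.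
\<close>

lemma genus_ge:
  assumes "has_genus \<iota> g"
  shows "(\<alpha> - 1) * (\<beta> - 1) \<le> 2 * g"
proof -
  obtain v where v: "v \<in> rational_places \<iota>" "place \<iota> v" "v x < 0" by (rule infinite_place)
  define N where "N = \<alpha> * \<beta> - 1"
  have ab: "\<alpha> * \<beta> \<ge> 2 * 2" using \<alpha>_ge \<beta>_ge by (rule mult_le_mono)
  define D where "D = (\<lambda>w. if w = v then int N else 0)"
  have supp: "{w. D w \<noteq> 0} = {v}" using ab by (auto simp: D_def N_def)
  have "field_embedding \<iota>" using function_field by (simp add: is_function_field_def)
  hence deg: "divisor_degree \<iota> D = int N"
    unfolding divisor_degree_def supp using rational_place_degree[OF _ v(1)] by (simp add: D_def)
  have "divisor \<iota> D" unfolding divisor_def supp using v by simp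
  hence "divisor_degree \<iota> D - int (ell \<iota> D) + 1 \<le> int g" using assms unfolding has_genus_def by blast
  hence le: "int (\<alpha> * \<beta>) - int (ell \<iota> D) \<le> int g" using ab unfolding deg N_def by linarith
  have "{p. weight p \<le> N} = {(i, j). \<beta> * i + \<alpha> * j < \<alpha> * \<beta>}"
    using ab by (auto simp: weight_def N_def)
  hence "2 * ell \<iota> D \<le> \<alpha> * \<beta> + \<alpha> + \<beta> - 1"
    using ell_at_infinity_le[OF v(2,3), of N] card_lattice_triangle(2)[of \<alpha> \<beta>] \<alpha>_ge \<beta>_pos
    by (simp add: D_def)
  hence "2 * (\<alpha> * \<beta>) \<le> 2 * g + (\<alpha> * \<beta> + \<alpha> + \<beta> - 1)" using le by linarith
  moreover have "(\<alpha> - 1) * (\<beta> - 1) + (\<alpha> * \<beta> + \<alpha> + \<beta> - 1) = 2 * (\<alpha> * \<beta>)"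
    using \<alpha>_ge \<beta>_pos by (cases \<alpha>; cases \<beta>) (simp_all add: algebra_simps)
  ultimately show ?thesis by linarith
qed

end


section \<open>Rational places\<close>

context valuation begin

lemma ev_in_ring:
  assumes "ring_map h" and "\<And>c. h c \<in> valuation_ring v" and "z \<in> valuation_ring v"
  shows "ev h z p \<in> valuation_ring v"
proof -
  interpret ring_map h by fact
  show ?thesis
  proof (induction p)
    case (pCons c p)
    thus ?case using assms by (simp add: ring_add ring_mult)
  qed (simp add: valuation_ring_def)
qed

text \<open>
  Evaluation is compatible with reduction modulo the maximal ideal.  The coefficient map \<open>h\<close> is general, so
  that the lemma can be applied first to the coefficients in \<open>x\<close> and then to the polynomial in \<open>y\<close>.
\<close>

lemma ev_residue:
  assumes h: "ring_map h" "\<And>c. h c \<in> valuation_ring v" and z: "z \<in> valuation_ring v"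
    and k: "ring_map k" and \<iota>: "ring_map \<iota>" "\<And>c. \<iota> c \<in> valuation_ring v"
    and hk: "\<And>c. h c - \<iota> (k c) \<in> maximal_ideal v" and zw: "z - \<iota> w \<in> maximal_ideal v"
  shows "ev h z p - \<iota> (ev k w p) \<in> maximal_ideal v"
proof -
  interpret h: ring_map h by fact
  interpret k: ring_map k by fact
  interpret \<iota>: ring_map \<iota> by fact
  show ?thesis
  proof (induction p)
    case (pCons c p)
    have "ev h z (pCons c p) - \<iota> (ev k w (pCons c p)) =
        (h c - \<iota> (k c)) + (ev h z p - \<iota> (ev k w p)) * z + (z - \<iota> w) * \<iota> (ev k w p)"
      by (simp add: algebra_simps)
    also have "\<dots> \<in> maximal_ideal v" by (intro ideal_add ideal_mult hk zw z \<iota> pCons.IH)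
    finally show ?case .
  qed (simp add: maximal_ideal_def)
qed

end

lemma ring_map_id: "ring_map (\<lambda>c. c)"
  by standard auto

context kummer_function_field begin

abbreviation value_at :: "'a \<Rightarrow> 'a \<Rightarrow> 'a poly poly \<Rightarrow> 'a" where
  "value_at \<equiv> eval2 (\<lambda>c. c)"

definition centered_at :: "('f \<Rightarrow> int) \<Rightarrow> 'a \<Rightarrow> 'a \<Rightarrow> bool" where
  "centered_at v a b \<longleftrightarrow> x - \<iota> a \<in> maximal_ideal v \<and> y - \<iota> b \<in> maximal_ideal v"

lemma const_in_ring: "place \<iota> v \<Longrightarrow> \<iota> c \<in> valuation_ring v"
  by (cases "c = 0") (auto simp: valuation_ring_def place_def)

lemma const_in_ideal_iff: "place \<iota> v \<Longrightarrow> \<iota> c \<in> maximal_ideal v \<longleftrightarrow> c = 0"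
  by (auto simp: maximal_ideal_def place_def)

lemma residue_at_center:
  assumes v: "place \<iota> v" and c: "centered_at v a b"
  shows "eval2 \<iota> x y H - \<iota> (value_at a b H) \<in> maximal_ideal v"
    and "eval2 \<iota> x y H \<in> valuation_ring v"
proof -
  interpret valuation v using v by (rule place_valuation)
  have xy: "x - \<iota> a \<in> maximal_ideal v" "y - \<iota> b \<in> maximal_ideal v" using c by (simp_all add: centered_at_def)
  have "(x - \<iota> a) + \<iota> a \<in> valuation_ring v" "(y - \<iota> b) + \<iota> b \<in> valuation_ring v"
    by (intro ring_add const_in_ring[OF v] ideal_subset_ring xy)+
  hence O: "x \<in> valuation_ring v" "y \<in> valuation_ring v" by simp_all
  have exO: "ev \<iota> x p \<in> valuation_ring v" for p
    by (intro ev_in_ring \<iota>.ring_map_axioms const_in_ring[OF v] O)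
  have "ev \<iota> x p - \<iota> (ev (\<lambda>c. c) a p) \<in> maximal_ideal v" for p
    by (rule ev_residue) (use \<iota>.ring_map_axioms ring_map_id const_in_ring[OF v] O xy in \<open>auto simp: maximal_ideal_def\<close>)
  note exm = this
  show "eval2 \<iota> x y H - \<iota> (value_at a b H) \<in> maximal_ideal v"
    unfolding eval2_ev
    by (rule ev_residue) (rule ex.ring_map_axioms exO O \<iota>.ring_map_axioms const_in_ring[OF v] exm xy
        ring_map.ring_map_ev[OF ring_map_id])+
  show "eval2 \<iota> x y H \<in> valuation_ring v"
    unfolding eval2_ev by (intro ev_in_ring ex.ring_map_axioms exO O)
qed

sublocale at: ring_map "value_at a b" for a b
  by (intro ring_map_eval2 ring_map_id)

lemma value_at_G: "value_at a b G = b ^ \<beta> - poly A a"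
proof -
  interpret ia: ring_map "\<lambda>p. poly p a" by standard auto
  have "value_at a b (monom 1 \<beta>) = b ^ \<beta>" "value_at a b [:A:] = poly A a"
    by (simp_all add: eval2_ev ia.ev_monom)
  thus ?thesis by (simp only: at.diff)
qed

lemma center_on_curve:
  assumes v: "place \<iota> v" and c: "centered_at v a b"
  shows "b ^ \<beta> = poly A a"
proof -
  have "eval2 \<iota> x y G = 0" by (simp only: eval2_eq_0_iff dvd_refl)
  hence "- \<iota> (value_at a b G) \<in> maximal_ideal v" using residue_at_center(1)[OF v c, of G] by simp
  hence "\<iota> (- value_at a b G) \<in> maximal_ideal v" by (simp only: \<iota>.neg)
  hence "- value_at a b G = 0" by (simp only: const_in_ideal_iff[OF v])
  hence "value_at a b G = 0" by (simp only: neg_equal_0_iff_equal)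
  thus ?thesis unfolding value_at_G by simp
qed

lemma rational_place_center:
  assumes v: "v \<in> rational_places \<iota>" and vx: "0 \<le> v x"
  shows "\<exists>a b. centered_at v a b"
proof -
  have pl: "place \<iota> v" using v by (simp add: rational_places_def)
  interpret valuation v using pl by (rule place_valuation)
  have xO: "x \<in> valuation_ring v" using vx by (simp add: valuation_ring_def)
  have "ev \<iota> x A \<in> valuation_ring v"
    by (intro ev_in_ring \<iota>.ring_map_axioms const_in_ring[OF pl] xO)
  hence "0 \<le> v (y ^ \<beta>)" using y_nonzero by (simp add: valuation_ring_def flip: curve_equation)
  hence "0 \<le> v y" using \<beta>_pos y_nonzero by (simp add: v_power zero_le_mult_iff)
  hence "y \<in> valuation_ring v" by (simp add: valuation_ring_def)
  thus ?thesis using v xO unfolding rational_places_def centered_at_def by blast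
qed

text \<open>
  Every affine rational point is nonsingular, since \<open>A'\<close> is a nonzero constant: \<open>y - b\<close> generates the
  maximal ideal of its local ring, which leaves room for one valuation only.
\<close>

lemma center_unique_place:
  assumes v: "place \<iota> v" "centered_at v a b" and w: "place \<iota> w" "centered_at w a b"
  shows "v = w"
proof -
  interpret v: valuation v using v(1) by (rule place_valuation)
  interpret w: valuation w using w(1) by (rule place_valuation)
  define t where "t = y - \<iota> b"
  obtain c where c: "c \<noteq> 0" "pderiv A = [:c:]" using derivative_A by metis
  have on_curve: "b ^ \<beta> = poly A a" by (rule center_on_curve[OF v])
  have unit: "u (eval2 \<iota> x y H) = 0 \<and> eval2 \<iota> x y H \<noteq> 0"
    if u: "place \<iota> u" "centered_at u a b" and H: "value_at a b H \<noteq> 0" for u H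
  proof -
    interpret u: valuation u using u(1) by (rule place_valuation)
    have notm: "eval2 \<iota> x y H \<notin> maximal_ideal u"
    proof
      assume "eval2 \<iota> x y H \<in> maximal_ideal u"
      moreover have "(eval2 \<iota> x y H - \<iota> (value_at a b H)) * (- 1) \<in> maximal_ideal u"
        by (intro u.ideal_mult residue_at_center(1)[OF u]) (simp add: valuation_ring_def u.v_minus u.v_1)
      ultimately have "eval2 \<iota> x y H + (eval2 \<iota> x y H - \<iota> (value_at a b H)) * (- 1) \<in> maximal_ideal u"
        by (rule u.ideal_add)
      hence "\<iota> (value_at a b H) \<in> maximal_ideal u" by simp
      thus False using H const_in_ideal_iff[OF u(1)] by simp
    qed
    with residue_at_center(2)[OF u, of H] show ?thesis
      by (auto simp: valuation_ring_def maximal_ideal_def)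
  qed
  (* the tangent relation (x - a) V = (y - b) U with V a unit at the point *)
  have "poly (A - [:poly A a:]) a = 0" by simp
  hence "[:- a, 1:] dvd A - [:poly A a:]" by (simp only: poly_eq_0_iff_dvd)
  then obtain V where V: "A - [:poly A a:] = [:- a, 1:] * V" by (rule dvdE)
  have "poly (pderiv (A - [:poly A a:])) a = poly V a" unfolding V by (simp only: pderiv_mult poly_add poly_mult) (simp add: pderiv_pCons)
  hence Va: "poly V a = c" using c by (simp add: pderiv_diff pderiv_pCons)
  have "poly (monom 1 \<beta> - [:[:b ^ \<beta>:]:]) [:b:] = 0" by (simp add: poly_monom poly_const_pow)
  hence "[:- [:b:], 1:] dvd monom 1 \<beta> - [:[:b ^ \<beta>:]:]" by (simp only: poly_eq_0_iff_dvd)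
  then obtain U where U: "monom 1 \<beta> - [:[:b ^ \<beta>:]:] = [:- [:b:], 1:] * U" by (rule dvdE)
  have lin: "eval2 \<iota> x y [:- [:b:], 1:] = t" by (simp add: t_def eval2_ev)
  have "eval2 \<iota> x y (monom 1 \<beta> - [:[:b ^ \<beta>:]:]) = ev \<iota> x A - \<iota> (poly A a)"
    by (simp only: exy.diff) (simp add: eval2_ev ex.ev_monom curve_equation on_curve)
  also have "\<dots> = ev \<iota> x (A - [:poly A a:])" by simp
  also have "\<dots> = (x - \<iota> a) * ev \<iota> x V" unfolding V by (simp only: ex.mult) simp
  finally have tangent: "t * eval2 \<iota> x y U = (x - \<iota> a) * ev \<iota> x V"
    unfolding U by (simp only: exy.mult lin)
  have reduce: "\<exists>W H'. value_at a b W \<noteq> 0 \<and> eval2 \<iota> x y W * eval2 \<iota> x y H = t * eval2 \<iota> x y H'"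
    if H: "value_at a b H = 0" for H
  proof -
    define r where "r = poly H [:b:]"
    have "poly (H - [:r:]) [:b:] = 0" by (simp add: r_def)
    hence "[:- [:b:], 1:] dvd H - [:r:]" by (simp only: poly_eq_0_iff_dvd)
  then obtain R where R: "H - [:r:] = [:- [:b:], 1:] * R" by (rule dvdE)
    have HR: "H = [:- [:b:], 1:] * R + [:r:]" using R by (simp add: algebra_simps)
    have "value_at a b [:- [:b:], 1:] = 0"
      by (simp add: eval2_ev map_poly_pCons)
    hence "value_at a b H = value_at a b [:r:]" by (subst HR) (simp only: at.add at.mult mult_zero_left add_0)
    hence "poly r a = 0" using H by (simp add: eval2_ev map_poly_pCons)
    hence "[:- a, 1:] dvd r" by (simp only: poly_eq_0_iff_dvd)
  then obtain P where P: "r = [:- a, 1:] * P" by (rule dvdE)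
    have "eval2 \<iota> x y H = t * eval2 \<iota> x y R + ev \<iota> x r"
      by (subst HR) (simp only: exy.add exy.mult lin eval2_const)
    also have "ev \<iota> x r = (x - \<iota> a) * ev \<iota> x P" unfolding P by (simp only: ex.mult) simp
    finally have eqH: "eval2 \<iota> x y H = t * eval2 \<iota> x y R + (x - \<iota> a) * ev \<iota> x P" .
    have "ev \<iota> x V * eval2 \<iota> x y H = t * (ev \<iota> x V * eval2 \<iota> x y R) + ((x - \<iota> a) * ev \<iota> x V) * ev \<iota> x P"
      unfolding eqH by (simp add: algebra_simps)
    also have "\<dots> = t * eval2 \<iota> x y ([:V:] * R + U * [:P:])"
      unfolding tangent[symmetric] by (simp only: exy.add exy.mult eval2_const) (simp add: algebra_simps)
    finally have "eval2 \<iota> x y [:V:] * eval2 \<iota> x y H = t * eval2 \<iota> x y ([:V:] * R + U * [:P:])"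
      by (simp only: eval2_const)
    moreover have "value_at a b [:V:] \<noteq> 0" using Va c(1) by (simp add: eval2_ev map_poly_pCons)
    ultimately show ?thesis by blast
  qed
  have t0: "t \<noteq> 0"
  proof -
    have "\<not> G dvd [:- [:b:], 1:]" using \<beta>_ge by (intro not_G_dvd) auto
    thus ?thesis unfolding lin[symmetric] by (simp only: eval2_eq_0_iff) simp
  qed
  have tv: "0 < v t" and tw: "0 < w t" using v(2) w(2) t0 by (auto simp: centered_at_def maximal_ideal_def t_def)
  have power_of_t: "\<exists>k::nat. v (eval2 \<iota> x y H) = int k * v t \<and> w (eval2 \<iota> x y H) = int k * w t"
    if "eval2 \<iota> x y H \<noteq> 0" for H
    using that
  proof (induction "nat (v (eval2 \<iota> x y H))" arbitrary: H rule: less_induct)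
    case less
    show ?case
    proof (cases "value_at a b H = 0")
      case False
      thus ?thesis using unit[OF v] unit[OF w] by (intro exI[of _ 0]) simp
    next
      case True
      then obtain W H' where W: "value_at a b W \<noteq> 0" and eq: "eval2 \<iota> x y W * eval2 \<iota> x y H = t * eval2 \<iota> x y H'"
        using reduce by blast
      have nz: "eval2 \<iota> x y W \<noteq> 0" using unit[OF v W] by simp
      have nz': "eval2 \<iota> x y H' \<noteq> 0" using eq nz less.prems by auto
      have "v (eval2 \<iota> x y W * eval2 \<iota> x y H) = v (t * eval2 \<iota> x y H')" using eq by simp
      hence ev: "v (eval2 \<iota> x y H) = v t + v (eval2 \<iota> x y H')"
        using nz nz' less.prems t0 unit[OF v W] by (simp add: v.v_mult)
      have "w (eval2 \<iota> x y W * eval2 \<iota> x y H) = w (t * eval2 \<iota> x y H')" using eq by simp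
      hence ew: "w (eval2 \<iota> x y H) = w t + w (eval2 \<iota> x y H')"
        using nz nz' less.prems t0 unit[OF w W] by (simp add: w.v_mult)
      have "0 \<le> v (eval2 \<iota> x y H')" using residue_at_center(2)[OF v, of H'] nz' by (simp add: valuation_ring_def)
      hence "nat (v (eval2 \<iota> x y H')) < nat (v (eval2 \<iota> x y H))" using ev tv by simp
      then obtain k :: nat where "v (eval2 \<iota> x y H') = int k * v t" "w (eval2 \<iota> x y H') = int k * w t"
        using less.hyps[OF _ nz'] by blast
      thus ?thesis using ev ew by (intro exI[of _ "Suc k"]) (simp add: algebra_simps)
    qed
  qed
  have t1: "u t = 1" if u: "place \<iota> u" "0 < u t"
    and pw: "\<And>H. eval2 \<iota> x y H \<noteq> 0 \<Longrightarrow> \<exists>k::nat. u (eval2 \<iota> x y H) = int k * u t" for u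
  proof -
    interpret u: valuation u using u(1) by (rule place_valuation)
    obtain z where z: "u z = 1" using u(1) by (auto simp: place_def)
    have z0: "z \<noteq> 0" using z u(1) by (auto simp: place_def)
    obtain g H where gH: "g \<noteq> 0" "ev \<iota> x g * z = eval2 \<iota> x y H" by (rule fraction_with_denominator_in_x)
    have nz: "eval2 \<iota> x y [:g:] \<noteq> 0" using gH(1) by (simp add: eval2_const)
    have nz': "eval2 \<iota> x y H \<noteq> 0" using gH z0 by (simp flip: gH(2))
    have "u (eval2 \<iota> x y H) = u (eval2 \<iota> x y [:g:]) + 1"
      unfolding gH(2)[symmetric] using nz z0 z by (simp add: u.v_mult eval2_const)
    moreover have "u t dvd u (eval2 \<iota> x y H)" "u t dvd u (eval2 \<iota> x y [:g:])"
      using pw[OF nz] pw[OF nz'] by auto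
    ultimately have "u t dvd 1" by (metis dvd_add_right_iff)
    thus ?thesis using u(2) by simp
  qed
  have "v t = 1" using power_of_t by (intro t1[OF v(1) tv]) blast
  moreover have "w t = 1" using power_of_t by (intro t1[OF w(1) tw]) blast
  ultimately show ?thesis using power_of_t by (intro place_eqI[OF v(1) w(1)]) fastforce
qed

definition affine_points :: "('a \<times> 'a) set" where
  "affine_points = {(a, b). b ^ \<beta> = poly A a}"

text \<open>
  A rational place has either a center on the affine curve, which determines it, or a pole of \<open>x\<close>.
\<close>

lemma card_rational_places_le: "card (rational_places \<iota>) \<le> card affine_points + 1"
proof -
  define inf where "inf = {v \<in> rational_places \<iota>. v x < 0}"
  define aff where "aff = {v \<in> rational_places \<iota>. 0 \<le> v x}"
  define center where "center = (\<lambda>v. SOME p. centered_at v (fst p) (snd p))"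
  have center: "centered_at v (fst (center v)) (snd (center v))" if "v \<in> aff" for v
    unfolding center_def using rational_place_center[of v] that by (intro someI_ex[of "\<lambda>p. centered_at v (fst p) (snd p)"]) (auto simp: aff_def)
  have pl: "place \<iota> v" if "v \<in> rational_places \<iota>" for v using that by (simp add: rational_places_def)
  have "center ` aff \<subseteq> affine_points"
    using center center_on_curve pl by (fastforce simp: affine_points_def aff_def case_prod_beta)
  moreover have "inj_on center aff"
    using center center_unique_place pl by (intro inj_onI) (metis (no_types, lifting) aff_def mem_Collect_eq)
  ultimately have aff: "card aff \<le> card affine_points" by (intro card_inj_on_le) auto
  obtain v where "v \<in> rational_places \<iota>" "v x < 0" by (rule infinite_place)
  hence "inf \<subseteq> {v}" using infinite_place_unique pl by (auto simp: inf_def)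
  hence "card inf \<le> 1" using card_mono[of "{v}" inf] by simp
  moreover have "rational_places \<iota> = aff \<union> inf" by (auto simp: aff_def inf_def)
  ultimately show ?thesis using card_Un_le[of aff inf] aff by simp
qed

end


section \<open>Zeros of functions on the affine curve\<close>

context kummer_function_field begin

lemma value_at_cong:
  assumes "eval2 \<iota> x y H = eval2 \<iota> x y H'" and "(a, b) \<in> affine_points"
  shows "value_at a b H = value_at a b H'"
proof -
  have "eval2 \<iota> x y (H - H') = 0" using assms(1) by simp
  then obtain Q where Q: "H - H' = G * Q" by (auto simp: eval2_eq_0_iff simp del: exy.diff)
  have "value_at a b G = 0" using assms(2) unfolding value_at_G affine_points_def by simp
  hence "value_at a b (H - H') = 0" unfolding Q by (simp only: at.mult mult_zero_left)
  thus ?thesis by simp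
qed

lemma interpolation:
  "\<exists>S. \<forall>a b. value_at a b S = g a b"
proof -
  (* \<delta> a b vanishes at every point of the plane except (a, b) *)
  define \<delta> where "\<delta> = (\<lambda>a b. (\<Prod>a'\<in>UNIV - {a}. [:[:- a', 1:]:]) * (\<Prod>b'\<in>UNIV - {b}. [:- [:b':], 1:]) :: 'a poly poly)"
  have \<delta>: "value_at c d (\<delta> a b) = (\<Prod>a'\<in>UNIV - {a}. c - a') * (\<Prod>b'\<in>UNIV - {b}. d - b')" for a b c d
  proof -
    have "value_at c d [:[:- a', 1:]:] = c - a'" "value_at c d [:- [:b':], 1:] = d - b'" for a' b'
      by (simp_all add: eval2_ev map_poly_pCons)
    thus ?thesis by (simp only: \<delta>_def at.mult at.prod)
  qed
  have \<delta>0: "value_at c d (\<delta> a b) = 0 \<longleftrightarrow> (c, d) \<noteq> (a, b)" for a b c d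
    unfolding \<delta> by auto
  define S where "S = (\<Sum>p\<in>UNIV. [:[:g (fst p) (snd p) / value_at (fst p) (snd p) (\<delta> (fst p) (snd p)):]:] * \<delta> (fst p) (snd p))"
  have "value_at a b S = g a b" for a b
  proof -
    have const: "value_at a b [:[:c:]:] = c" for c by (simp add: eval2_ev map_poly_pCons)
    have "value_at a b S = (\<Sum>p\<in>UNIV. g (fst p) (snd p) / value_at (fst p) (snd p) (\<delta> (fst p) (snd p)) * value_at a b (\<delta> (fst p) (snd p)))"
      unfolding S_def by (simp only: at.sum at.mult const)
    also have "\<dots> = (\<Sum>p\<in>UNIV. if p = (a, b) then g a b else 0)"
    proof (rule sum.cong[OF refl])
      fix p :: "'a \<times> 'a"
      show "g (fst p) (snd p) / value_at (fst p) (snd p) (\<delta> (fst p) (snd p)) * value_at a b (\<delta> (fst p) (snd p)) = (if p = (a, b) then g a b else 0)"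
        using \<delta>0[of a b "fst p" "snd p"] by (cases "p = (a, b)") (auto simp: prod_eq_iff)
    qed
    also have "\<dots> = g a b" by simp
    finally show ?thesis .
  qed
  thus ?thesis by blast
qed

text \<open>
  For the place \<open>v\<close> at infinity these are the functions in the affine coordinate ring with pole order at most \<open>N\<close>.
\<close>

definition filtration :: "('f \<Rightarrow> int) \<Rightarrow> nat \<Rightarrow> 'f set" where
  "filtration v N = {z \<in> range (eval2 \<iota> x y). z = 0 \<or> - v z \<le> int N}"

text \<open>
  The residue field at infinity is the base field, so any two functions with the same pole order are
  proportional up to smaller pole order.  Finite cardinalities replace dimensions throughout.
\<close>

lemma filtration_finite_card:
  assumes v: "v \<in> rational_places \<iota>" "v x < 0"
  shows "finite (filtration v 0)" and "finite (filtration v N) \<Longrightarrow> finite (filtration v (Suc N))"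
    and "finite (filtration v N) \<Longrightarrow> card (filtration v (Suc N)) \<le> CARD('a) * card (filtration v N)"
proof -
  have pl: "place \<iota> v" using v by (simp add: rational_places_def)
  interpret valuation v using pl by (rule place_valuation)
  have reg: "v z \<le> 0" if z: "z \<in> range (eval2 \<iota> x y)" "z \<noteq> 0" for z
  proof -
    obtain H0 where "z = eval2 \<iota> x y H0" using z(1) by blast
    then obtain H where H: "degree H < \<beta>" "eval2 \<iota> x y H = z" using normal_form[of H0] by metis
    hence "H \<noteq> 0" using z(2) by auto
    from infinite_place_values(2)[OF pl v(2) this H(1)] show ?thesis by (simp add: H(2))
  qed
  have approx: "\<exists>c. z - \<iota> c * u = 0 \<or> v u < v (z - \<iota> c * u)" if u: "u \<noteq> 0" and z: "z = 0 \<or> v u \<le> v z" for u z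
  proof -
    have "z / u \<in> valuation_ring v" using u z by (cases "z = 0") (auto simp: valuation_ring_def v_divide)
    then obtain c where c: "z / u - \<iota> c \<in> maximal_ideal v" using v(1) by (auto simp: rational_places_def)
    have eq: "z - \<iota> c * u = (z / u - \<iota> c) * u" using u by (simp add: algebra_simps)
    have "z - \<iota> c * u = 0 \<or> v u < v (z - \<iota> c * u)"
      unfolding eq using c u by (cases "z / u - \<iota> c = 0") (auto simp: maximal_ideal_def v_mult)
    thus ?thesis by blast
  qed
  have comb: "z - \<iota> c * u \<in> range (eval2 \<iota> x y)" if zu: "z \<in> range (eval2 \<iota> x y)" "u \<in> range (eval2 \<iota> x y)" for z c u
  proof -
    obtain P Q where "z = eval2 \<iota> x y P" "u = eval2 \<iota> x y Q" using zu by blast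
    hence "z - \<iota> c * u = eval2 \<iota> x y (P - [:[:c:]:] * Q)"
      by (simp only: exy.diff exy.mult eval2_const) simp
    thus ?thesis by blast
  qed
  have one: "1 \<in> range (eval2 \<iota> x y)" by (metis exy.one rangeI)
  have "filtration v 0 \<subseteq> range \<iota>"
  proof
    fix z assume z: "z \<in> filtration v 0"
    hence "z = 0 \<or> v 1 \<le> v z" by (auto simp: filtration_def v_1)
    then obtain c where "z - \<iota> c * 1 = 0 \<or> v 1 < v (z - \<iota> c * 1)" using approx[of 1 z] by auto
    moreover have "z - \<iota> c * 1 \<in> range (eval2 \<iota> x y)" using z one by (intro comb) (auto simp: filtration_def)
    ultimately have "z - \<iota> c * 1 = 0" using reg[of "z - \<iota> c * 1"] v_1 by force
    thus "z \<in> range \<iota>" by simp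
  qed
  thus "finite (filtration v 0)" by (rule finite_subset) simp
  assume fin: "finite (filtration v N)"
  have mono: "filtration v N \<subseteq> filtration v (Suc N)" by (auto simp: filtration_def)
  have "finite (filtration v (Suc N)) \<and> card (filtration v (Suc N)) \<le> CARD('a) * card (filtration v N)"
  proof (cases "filtration v (Suc N) \<subseteq> filtration v N")
    case True
    hence "filtration v (Suc N) = filtration v N" using mono by blast
    moreover have "1 * card (filtration v N) \<le> CARD('a) * card (filtration v N)"
      by (intro mult_right_mono) (auto simp: Suc_le_eq)
    ultimately show ?thesis using fin by simp
  next
    case False
    then obtain u where u: "u \<in> filtration v (Suc N)" "u \<notin> filtration v N" by blast
    hence u0: "u \<noteq> 0" and vu: "v u = - int (Suc N)" by (auto simp: filtration_def)
    have "filtration v (Suc N) \<subseteq> (\<lambda>(c, w). \<iota> c * u + w) ` (UNIV \<times> filtration v N)"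
    proof
      fix z assume z: "z \<in> filtration v (Suc N)"
      hence "z = 0 \<or> v u \<le> v z" by (auto simp: filtration_def vu)
      then obtain c where c: "z - \<iota> c * u = 0 \<or> v u < v (z - \<iota> c * u)" using approx[OF u0] by blast
      have "z - \<iota> c * u \<in> range (eval2 \<iota> x y)" using z u by (intro comb) (auto simp: filtration_def)
      hence "z - \<iota> c * u \<in> filtration v N" using c by (auto simp: filtration_def vu)
      moreover have "z = (\<lambda>(c, w). \<iota> c * u + w) (c, z - \<iota> c * u)" by simp
      ultimately show "z \<in> (\<lambda>(c, w). \<iota> c * u + w) ` (UNIV \<times> filtration v N)" by blast
    qed
    moreover have fin': "finite ((\<lambda>(c, w). \<iota> c * u + w) ` (UNIV \<times> filtration v N))" using fin by simp
    moreover have "card ((\<lambda>(c, w). \<iota> c * u + w) ` (UNIV \<times> filtration v N)) \<le> CARD('a) * card (filtration v N)"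
      using card_image_le[of "UNIV \<times> filtration v N" "\<lambda>(c, w). \<iota> c * u + w"] fin by (simp add: card_cartesian_product)
    ultimately show ?thesis by (meson card_mono finite_subset order_trans)
  qed
  thus "finite (filtration v (Suc N))" "card (filtration v (Suc N)) \<le> CARD('a) * card (filtration v N)" by auto
qed

lemma finite_filtration:
  assumes v: "v \<in> rational_places \<iota>" "v x < 0"
  shows "finite (filtration v N)"
  by (induction N) (use filtration_finite_card[OF v] in auto)

lemma card_filtration_le:
  assumes v: "v \<in> rational_places \<iota>" "v x < 0"
  shows "card (filtration v (N + k)) \<le> CARD('a) ^ k * card (filtration v N)"
proof (induction k)
  case (Suc k)
  have "card (filtration v (N + Suc k)) \<le> CARD('a) * card (filtration v (N + k))"
    using filtration_finite_card(3)[OF v finite_filtration[OF v]] by simp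
  also have "\<dots> \<le> CARD('a) * (CARD('a) ^ k * card (filtration v N))" using Suc.IH by (rule mult_left_mono) simp
  finally show ?case by (simp add: mult_ac)
qed simp

text \<open>
  A function has at most as many zeros as poles, by counting.  Let \<open>Z\<close> be the set of affine zeros of \<open>f\<close>,
  \<open>\<rho>\<close> its pole order and \<open>F(N)\<close> the set of polynomial functions of pole order at most \<open>N\<close>.  For \<open>N\<close> large, every
  function on \<open>Z\<close> is interpolated by some \<open>S \<in> F(N + \<rho>)\<close>, and the sums \<open>S + f w\<close> with \<open>w \<in> F(N)\<close>
  are distinct elements of \<open>F(N + \<rho>)\<close>.  Hence \<open>Q^|Z| |F(N)| \<le> |F(N + \<rho>)| \<le> Q^\<rho> |F(N)|\<close>, where \<open>Q\<close> is the
  size of the base field.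
\<close>

lemma card_zeros_le_valuation:
  assumes v: "v \<in> rational_places \<iota>" "v x < 0" and H: "eval2 \<iota> x y H \<noteq> 0"
  shows "int (card {(a, b) \<in> affine_points. value_at a b H = 0}) \<le> - v (eval2 \<iota> x y H)"
proof -
  have pl: "place \<iota> v" using v by (simp add: rational_places_def)
  interpret valuation v using pl by (rule place_valuation)
  define f where "f = eval2 \<iota> x y H"
  define Z where "Z = {(a, b) \<in> affine_points. value_at a b H = 0}"
  define \<rho> where "\<rho> = nat (- v f)"
  have f0: "f \<noteq> 0" using H by (simp add: f_def)
  have "- v f \<ge> 0"
  proof -
    obtain H' where H': "degree H' < \<beta>" "eval2 \<iota> x y H' = f" using normal_form[of H] unfolding f_def by blast
    hence "H' \<noteq> 0" using f0 by auto
    from infinite_place_values(2)[OF pl v(2) this H'(1)] show ?thesis by (simp add: H'(2))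
  qed
  hence vf: "- v f = int \<rho>" by (simp add: \<rho>_def)
  define \<Phi> where "\<Phi> = (Z \<rightarrow>\<^sub>E (UNIV :: 'a set))"
  have fin\<Phi>: "finite \<Phi>" unfolding \<Phi>_def by (intro finite_PiE) auto
  have card\<Phi>: "card \<Phi> = CARD('a) ^ card Z" unfolding \<Phi>_def by (simp add: card_PiE)
  define S where "S = (\<lambda>g. SOME P. \<forall>a b. value_at a b P = g (a, b))"
  have S: "value_at a b (S g) = g (a, b)" for g a b
  proof -
    from someI_ex[OF interpolation[of "\<lambda>a b. g (a, b)"]] show ?thesis by (simp add: S_def)
  qed
  (* the sum is a crude upper bound for all pole orders of the interpolating functions *)
  define N where "N = (\<Sum>g\<in>\<Phi>. nat (- v (eval2 \<iota> x y (S g))))"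
  have SN: "eval2 \<iota> x y (S g) = 0 \<or> - v (eval2 \<iota> x y (S g)) \<le> int (N + \<rho>)" if "g \<in> \<Phi>" for g
  proof -
    have "nat (- v (eval2 \<iota> x y (S g))) \<le> N"
      unfolding N_def using fin\<Phi> that by (intro member_le_sum) auto
    thus ?thesis by linarith
  qed
  let ?h = "\<lambda>(g, w). eval2 \<iota> x y (S g) + f * w"
  have "card (\<Phi> \<times> filtration v N) \<le> card (filtration v (N + \<rho>))"
  proof (rule card_inj_on_le[of ?h])
    show "inj_on ?h (\<Phi> \<times> filtration v N)"
    proof (rule inj_onI)
      fix p p' assume p: "p \<in> \<Phi> \<times> filtration v N" "p' \<in> \<Phi> \<times> filtration v N" "?h p = ?h p'"
      obtain g w g' w' where gw: "p = (g, w)" "p' = (g', w')" by fastforce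
      obtain W W' where W: "w = eval2 \<iota> x y W" "w' = eval2 \<iota> x y W'"
        using p by (auto simp: gw filtration_def)
      have eq: "eval2 \<iota> x y (S g + H * W) = eval2 \<iota> x y (S g' + H * W')"
        using p(3) by (simp add: gw W f_def)
      have "g = g'"
      proof
        fix P :: "'a \<times> 'a"
        obtain a b where P: "P = (a, b)" by fastforce
        show "g P = g' P"
        proof (cases "P \<in> Z")
          case True
          hence ab: "(a, b) \<in> affine_points" "value_at a b H = 0" by (auto simp: Z_def P)
          from value_at_cong[OF eq ab(1)] show ?thesis by (simp add: ab(2) S P)
        next
          case False
          have "g \<in> \<Phi>" "g' \<in> \<Phi>" using p(1,2) unfolding gw by blast+
          note * = this[unfolded \<Phi>_def]
          have "g P = undefined" "g' P = undefined" by (rule PiE_arb[OF *(1) False], rule PiE_arb[OF *(2) False])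
          thus ?thesis by (rule trans[OF _ sym])
        qed
      qed
      moreover from this have "w = w'" using p(3) f0 by (simp add: gw)
      ultimately show "p = p'" by (simp add: gw)
    qed
    show "?h ` (\<Phi> \<times> filtration v N) \<subseteq> filtration v (N + \<rho>)"
    proof
      fix z assume "z \<in> ?h ` (\<Phi> \<times> filtration v N)"
      then obtain g w where gw: "g \<in> \<Phi>" "w \<in> filtration v N" "z = eval2 \<iota> x y (S g) + f * w" by auto
      obtain W where W: "w = eval2 \<iota> x y W" using gw(2) by (auto simp: filtration_def)
      have "z = eval2 \<iota> x y (S g + H * W)" by (simp add: gw W f_def)
      moreover have "f * w = 0 \<or> - v (f * w) \<le> int (N + \<rho>)"
        using gw(2) vf f0 by (cases "w = 0") (auto simp: filtration_def v_mult)
      hence "z = 0 \<or> - v z \<le> int (N + \<rho>)"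
        using SN[OF gw(1)] v_add[of "eval2 \<iota> x y (S g)" "f * w"] unfolding gw(3)
        by (cases "eval2 \<iota> x y (S g) = 0 \<or> f * w = 0 \<or> eval2 \<iota> x y (S g) + f * w = 0") (auto simp: min_le_iff_disj)
      ultimately show "z \<in> filtration v (N + \<rho>)" by (auto simp: filtration_def simp del: exy.add)
    qed
  qed (rule finite_filtration[OF v])
  also have "\<dots> \<le> CARD('a) ^ \<rho> * card (filtration v N)" by (rule card_filtration_le[OF v])
  finally have "CARD('a) ^ card Z * card (filtration v N) \<le> CARD('a) ^ \<rho> * card (filtration v N)"
    by (simp add: card_cartesian_product card\<Phi>)
  moreover have "0 \<in> filtration v N" unfolding filtration_def using exy.zero by (auto intro: range_eqI[of _ _ 0])
  hence "card (filtration v N) > 0" using finite_filtration[OF v] by (auto simp: card_gt_0_iff)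
  ultimately have "CARD('a) ^ card Z \<le> CARD('a) ^ \<rho>" by simp
  moreover have "CARD('a) > 1" using card_mono[of UNIV "{0, 1::'a}"] by simp
  ultimately have "card Z \<le> \<rho>" by simp
  thus ?thesis using vf by (simp add: Z_def f_def)
qed

lemma card_zeros_le:
  assumes "H \<noteq> 0" and "degree H < \<beta>"
  shows "card {(a, b) \<in> affine_points. value_at a b H = 0} \<le> pole_order H"
proof -
  obtain v where v: "v \<in> rational_places \<iota>" "place \<iota> v" "v x < 0" by (rule infinite_place)
  have "eval2 \<iota> x y H \<noteq> 0" using not_G_dvd[OF assms] by (simp add: eval2_eq_0_iff)
  from card_zeros_le_valuation[OF v(1,3) this] show ?thesis
    using infinite_place_values(2)[OF v(2,3) assms] by simp
qed


section \<open>Consequences of maximality\<close>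

lemma A_additive: "poly A (a + b) = poly A a + poly A b"
proof -
  obtain m c where A: "A = (\<Sum>i\<le>m. monom (c i) (CHAR('a) ^ i))"
    using additive unfolding additive_poly_def by blast
  have p: "prime CHAR('a)" by (rule finite_field_char_prime)
  show ?thesis
    unfolding A by (simp add: poly_sum poly_monom freshmans_dream'[OF p refl] distrib_left sum.distrib)
qed

text \<open>
  Maximality and the lower bound for the genus give at least \<open>q^2 + (\<alpha> - 1) (\<beta> - 1) q\<close> affine points.  The character
  sum bound gives at most \<open>q^2 + (k - 1) (d - 1) q\<close>, where \<open>k \<le> \<alpha>\<close> and \<open>d \<le> \<beta>\<close> count the roots of \<open>A\<close>
  and the \<open>\<beta>\<close>-th roots of unity in the base field.  So equality holds everywhere: all of them are rational.
\<close>

lemma maximal_counts: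
  assumes max: "maximal_curve q \<iota>" and q: "CARD('a) = q\<^sup>2"
  shows "card affine_points = q\<^sup>2 + (\<beta> - 1) * (\<alpha> - 1) * q"
    and "card {a. poly A a = 0} = \<alpha>" and "card {z::'a. z ^ \<beta> = 1} = \<beta>"
proof -
  define k where "k = card {a. poly A a = 0}"
  define d where "d = card {z::'a. z ^ \<beta> = 1}"
  define N where "N = card affine_points"
  obtain g where g: "has_genus \<iota> g" "card (rational_places \<iota>) = q\<^sup>2 + 1 + 2 * g * q"
    using max by (auto simp: maximal_curve_def)
  have "q\<^sup>2 + 2 * g * q \<le> N" using card_rational_places_le g(2) by (simp add: N_def)
  moreover have "(\<alpha> - 1) * (\<beta> - 1) * q \<le> 2 * g * q" using genus_ge[OF g(1)] by (rule mult_right_mono) simp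
  ultimately have lower: "q\<^sup>2 + (\<alpha> - 1) * (\<beta> - 1) * q \<le> N" by linarith
  have A0: "A \<noteq> 0" using degree_A \<alpha>_ge by auto
  have k: "1 \<le> k" "k \<le> \<alpha>"
  proof -
    have "poly A 0 = 0" using A_additive[of 0 0] by (simp only: add_0_right add_cancel_right_right)
    thus "1 \<le> k" by (auto simp: k_def Suc_le_eq card_gt_0_iff)
    show "k \<le> \<alpha>" using card_poly_roots_bound[OF A0] degree_A by (simp add: k_def)
  qed
  have d: "1 \<le> d" "d \<le> \<beta>"
  proof -
    show "1 \<le> d" by (auto simp: d_def Suc_le_eq card_gt_0_iff intro!: exI[of _ 1])
    define P where "P = monom (1::'a) \<beta> - 1"
    have "coeff P \<beta> = 1" using \<beta>_pos by (simp add: P_def)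
    hence "P \<noteq> 0" by auto
    hence "card {z. poly P z = 0} \<le> degree P" by (rule card_poly_roots_bound)
    also have "degree P \<le> \<beta>" unfolding P_def by (intro degree_diff_le degree_monom_le) simp
    finally show "d \<le> \<beta>" by (simp add: P_def d_def poly_monom)
  qed
  have "real N \<le> real (q\<^sup>2) + (real k - 1) * (real d - 1) * q"
    using card_affine_points_le[of "poly A" \<beta> q] A_additive \<beta>_pos q
    by (simp add: N_def affine_points_def k_def d_def)
  also have "\<dots> = real (q\<^sup>2 + (k - 1) * (d - 1) * q)" using k d by (simp add: of_nat_diff)
  finally have upper: "N \<le> q\<^sup>2 + (k - 1) * (d - 1) * q" by (simp only: of_nat_le_iff)
  have "q > 0" using q by (cases q) auto
  moreover have "(\<alpha> - 1) * (\<beta> - 1) * q \<le> (k - 1) * (d - 1) * q"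
    using order.trans[OF lower upper] by (simp only: add_le_cancel_left)
  ultimately have le: "(\<alpha> - 1) * (\<beta> - 1) \<le> (k - 1) * (d - 1)" by (simp only: mult_le_cancel2)
  have k\<alpha>: "k = \<alpha>"
  proof (rule ccontr)
    assume "k \<noteq> \<alpha>"
    hence "k - 1 < \<alpha> - 1" "0 < \<beta> - 1" "d - 1 \<le> \<beta> - 1" using k d \<beta>_ge by auto
    hence "(k - 1) * (d - 1) < (\<alpha> - 1) * (\<beta> - 1)"
      using mult_left_mono[of "d - 1" "\<beta> - 1" "k - 1"] mult_strict_right_mono[of "k - 1" "\<alpha> - 1" "\<beta> - 1"] by linarith
    thus False using le by linarith
  qed
  have d\<beta>: "d = \<beta>"
  proof (rule ccontr)
    assume "d \<noteq> \<beta>"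
    hence "(k - 1) * (d - 1) < (\<alpha> - 1) * (\<beta> - 1)" using k\<alpha> d \<alpha>_ge by auto
    thus False using le by simp
  qed
  show "card affine_points = q\<^sup>2 + (\<beta> - 1) * (\<alpha> - 1) * q"
    using lower upper unfolding k\<alpha> d\<beta> N_def by (simp add: mult.commute)
  show "card {a. poly A a = 0} = \<alpha>" using k\<alpha> by (simp add: k_def)
  show "card {z::'a. z ^ \<beta> = 1} = \<beta>" using d\<beta> by (simp add: d_def)
qed

end


section \<open>The code\<close>

lemma sum_fun_apply: "(\<Sum>i\<in>I. f i) k = (\<Sum>i\<in>I. f i k :: 'b::comm_monoid_add)"
  by (induction I rule: infinite_finite_induct) auto

text \<open>
  For codes closed under differences it suffices to recover the symbol 0 from zeros.
\<close>

lemma recovery_setI: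
  assumes sub: "\<And>c c'. c \<in> C \<Longrightarrow> c' \<in> C \<Longrightarrow> (\<lambda>l. c l - c' l) \<in> C"
    and rec: "\<And>c. c \<in> C \<Longrightarrow> \<forall>l\<in>I. c l = 0 \<Longrightarrow> c i = (0::'a::field)"
    and I: "I \<noteq> {}" "I \<subseteq> {..<n} - {i}"
  shows "recovery_set n C i I"
  unfolding recovery_set_def
proof (intro conjI allI impI I)
  fix \<gamma> \<gamma>' :: 'a assume ne: "\<gamma> \<noteq> \<gamma>'"
  show "projections C I i \<gamma> \<inter> projections C I i \<gamma>' = {}"
  proof (rule ccontr)
    assume "projections C I i \<gamma> \<inter> projections C I i \<gamma>' \<noteq> {}"
    then obtain c c' where c: "c \<in> C" "c i = \<gamma>" "c' \<in> C" "c' i = \<gamma>'" "restrict c I = restrict c' I"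
      unfolding projections_def by auto
    have "\<forall>l\<in>I. c l - c' l = 0" using c(5) by (metis right_minus_eq restrict_apply')
    hence "c i - c' i = 0" using rec[OF sub[OF c(1,3)]] by blast
    thus False using ne c by simp
  qed
qed

lemma min_dist_ge:
  assumes sub: "\<And>c c'. c \<in> C \<Longrightarrow> c' \<in> C \<Longrightarrow> (\<lambda>l. c l - c' l) \<in> C"
    and zeros: "\<And>c. c \<in> C \<Longrightarrow> c \<noteq> (\<lambda>_. 0) \<Longrightarrow> card {l. l < n \<and> c l = (0::'a::field)} \<le> B"
    and two: "c1 \<in> C" "c2 \<in> C" "c1 \<noteq> c2"
  shows "int n - int B \<le> int (min_dist n C)"
proof -
  let ?S = "{hamming_dist n c c' |c c'. c \<in> C \<and> c' \<in> C \<and> c \<noteq> c'}"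
  have dist: "hamming_dist n c c' \<le> n \<and> n \<le> hamming_dist n c c' + B"
    if c: "c \<in> C" "c' \<in> C" "c \<noteq> c'" for c c'
  proof -
    have "(\<lambda>l. c l - c' l) \<noteq> (\<lambda>_. 0)" using c(3) by (auto simp: fun_eq_iff)
    hence le: "card {l. l < n \<and> c l - c' l = 0} \<le> B" by (intro zeros sub c)
    have "{..<n} = {l. l < n \<and> c l \<noteq> c' l} \<union> {l. l < n \<and> c l - c' l = 0}" by auto
    hence "card {..<n} = card {l. l < n \<and> c l \<noteq> c' l} + card {l. l < n \<and> c l - c' l = 0}"
      by (simp only:) (intro card_Un_disjoint; auto)
    thus ?thesis using le by (simp add: hamming_dist_def)
  qed
  have "?S \<subseteq> {..n}" using dist by auto
  hence "finite ?S" by (rule finite_subset) simp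
  moreover have "?S \<noteq> {}" using two by blast
  ultimately have "min_dist n C \<in> ?S" unfolding min_dist_def by (rule Min_in)
  then obtain c c' where c: "c \<in> C" "c' \<in> C" "c \<noteq> c'" "min_dist n C = hamming_dist n c c'" by blast
  show ?thesis using dist[OF c(1-3)] c(4) by linarith
qed

context kummer_function_field begin

text \<open>
  The functions \<open>x^j y^(u i)\<close> with \<open>i \<le> t1\<close> and \<open>j \<le> t2\<close> are evaluated at the rational points with \<open>y \<noteq> 0\<close>.
  A nonzero combination has pole order at most \<open>\<alpha> u t1 + \<beta> t2\<close>, which is less than \<open>n\<close>; this gives the distance
  and the dimension.  At a point \<open>(a, b)\<close> the first recovery set consists of \<open>t2 + 1\<close> points \<open>(a + r, b)\<close>
  with \<open>A(r) = 0\<close>, on which a word is a polynomial in \<open>x\<close> of degree at most \<open>t2\<close>.  The second one contains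
  \<open>(a, \<eta> b)\<close>, where every word takes the same value as at \<open>(a, b)\<close>, and is filled up with other points
  \<open>(a, \<zeta> b)\<close> with \<open>\<zeta>^\<beta> = 1\<close> to the prescribed size.
\<close>

lemma exists_LRC:
  fixes \<eta> :: 'a and u t1 t2 q n :: nat
  assumes max: "maximal_curve q \<iota>" and q: "CARD('a) = q\<^sup>2"
    and \<eta>: "\<eta> \<noteq> 1" "\<eta> ^ u = 1" and u: "u dvd \<beta>" "0 < u" and t1: "u * t1 + 2 \<le> \<beta>" and t2: "t2 + 2 \<le> \<alpha>"
    and n: "n = q\<^sup>2 + (\<beta> - 1) * (\<alpha> - 1) * q - \<alpha>"
  shows "\<exists>(C :: (nat \<Rightarrow> 'a) set) d. is_LRC n ((t1 + 1) * (t2 + 1)) d [t2 + 1, t1 + 1] C \<and>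
           int n - int (\<alpha> * (u * t1) + \<beta> * t2) \<le> int d"
proof -
  note counts = maximal_counts[OF max q]
  define S where "S = {(a, b) \<in> affine_points. b \<noteq> 0}"
  define B where "B = \<alpha> * (u * t1) + \<beta> * t2"
  have finaff: "finite affine_points" by simp
  have cardS: "card S = n"
  proof -
    have "affine_points - S = (\<lambda>a. (a, 0)) ` {a. poly A a = 0}"
      using \<beta>_pos by (auto simp: S_def affine_points_def power_0_left)
    hence "card (affine_points - S) = \<alpha>" using counts(2) by (simp add: card_image inj_on_def)
    moreover have "S \<subseteq> affine_points" by (auto simp: S_def)
    hence "card (affine_points - S) = card affine_points - card S" "card S \<le> card affine_points"
      by (auto intro!: card_Diff_subset card_mono)
    ultimately have "card S = card affine_points - \<alpha>" by linarith
    thus ?thesis by (simp only: counts(1) n)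
  qed
  have Bn: "B < n"
  proof -
    have "B \<le> \<alpha> * (\<beta> - 2) + \<beta> * (\<alpha> - 2)"
      unfolding B_def using t1 t2 by (intro add_mono mult_left_mono) auto
    moreover have "\<alpha> * (\<beta> - 2) + \<beta> * (\<alpha> - 2) < 2 * ((\<beta> - 1) * (\<alpha> - 1))"
    proof -
      obtain a b where "\<alpha> = a + 2" "\<beta> = b + 2" using \<alpha>_ge \<beta>_ge by (metis add.commute le_Suc_ex)
      thus ?thesis by (simp add: algebra_simps)
    qed
    moreover have "2 \<le> q"
    proof -
      have "CARD('a) > 1" using card_mono[of UNIV "{0, 1::'a}"] by simp
      hence "\<not> q \<le> 1" using q power_le_one[of q 2] by auto
      thus ?thesis by simp
    qed
    hence "2 * ((\<beta> - 1) * (\<alpha> - 1)) \<le> (\<beta> - 1) * (\<alpha> - 1) * q" by (simp add: mult.commute)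
    moreover have "\<alpha> \<le> q\<^sup>2" using card_mono[of UNIV "{a. poly A a = 0}"] counts(2) q by simp
    ultimately show ?thesis unfolding n by linarith
  qed
  obtain e where e: "bij_betw e {..<n} S"
    using ex_bij_betw_nat_finite[of S] cardS by (auto simp: S_def lessThan_atLeast0)
  have eS: "e k \<in> S" if "k < n" for k using e that by (auto simp: bij_betw_def)
  define idx where "idx = inv_into {..<n} e"
  have idx: "idx P < n" "e (idx P) = P" if "P \<in> S" for P
    using that e by (auto simp: idx_def bij_betw_def intro: f_inv_into_f inv_into_into[of P e "{..<n}", simplified])
  have inj_idx: "inj_on idx S" by (rule inj_on_inverseI[of _ e]) (rule idx(2))
  define J where "J = {..t1} \<times> {..t2}"
  have finJ: "finite J" by (simp add: J_def)
  define w where "w = (\<lambda>p k. if k < n then fst (e k) ^ snd p * snd (e k) ^ (u * fst p) else (0::'a))"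
  define word where "word = (\<lambda>c k. \<Sum>p\<in>J. c p * w p k)"
  define fpoly where "fpoly = (\<lambda>c. \<Sum>p\<in>J. monom (monom (c p) (snd p)) (u * fst p) :: 'a poly poly)"
  have value_fpoly: "value_at a b (fpoly c) = (\<Sum>p\<in>J. c p * (a ^ snd p * b ^ (u * fst p)))" for a b c
  proof -
    interpret ia: ring_map "\<lambda>p. poly p a" by standard auto
    have "value_at a b (monom (monom d j) i) = d * (a ^ j * b ^ i)" for d i j
      by (simp add: eval2_ev ia.ev_monom poly_monom)
    thus ?thesis by (simp add: fpoly_def)
  qed
  have word_eq: "word c k = (case e k of (a, b) \<Rightarrow> value_at a b (fpoly c))" if "k < n" for c k
    using that by (simp add: word_def w_def value_fpoly case_prod_beta)
  have coeff: "coeff (coeff (fpoly c) j) i = (if (j div u, i) \<in> J \<and> u dvd j then c (j div u, i) else 0)" for c i j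
  proof -
    have "coeff (coeff (fpoly c) j) i = (\<Sum>p\<in>J. if p = (j div u, i) then (if u dvd j then c p else 0) else 0)"
      unfolding fpoly_def coeff_sum using u(2) by (intro sum.cong) (auto simp: prod_eq_iff)
    also have "\<dots> = (if (j div u, i) \<in> J \<and> u dvd j then c (j div u, i) else 0)"
      using finJ by (simp add: sum.delta)
    finally show ?thesis .
  qed
  have zeros: "card {k. k < n \<and> word c k = 0} \<le> B" if c: "p \<in> J" "c p \<noteq> 0" for c p
  proof -
    obtain i j where p: "p = (i, j)" by fastforce
    have "coeff (coeff (fpoly c) (u * i)) j \<noteq> 0" using c u(2) by (simp add: coeff p)
    hence nz: "fpoly c \<noteq> 0" by auto
    have supp: "j' \<le> u * t1 \<and> i' \<le> t2" if "(i', j') \<in> support (fpoly c)" for i' j'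
    proof -
      have "(j' div u, i') \<in> J" "u dvd j'" using that by (auto simp: support_def coeff split: if_splits)
      thus ?thesis using u(2) by (auto simp: J_def elim!: dvdE)
    qed
    have deg: "degree (fpoly c) < \<beta>"
    proof -
      have "degree (fpoly c) \<le> u * t1"
      proof (rule degree_le, intro allI impI)
        fix j' assume "u * t1 < j'"
        hence "(i', j') \<notin> support (fpoly c)" for i' using supp by fastforce
        thus "coeff (fpoly c) j' = 0" by (simp add: support_def poly_eq_iff)
      qed
      thus ?thesis using t1 by simp
    qed
    have "pole_order (fpoly c) \<le> B"
      unfolding pole_order_def
    proof (rule Max.boundedI)
      fix l assume "l \<in> weight ` support (fpoly c)"
      then obtain i' j' where l: "(i', j') \<in> support (fpoly c)" "l = \<beta> * i' + \<alpha> * j'" by (auto simp: weight_def)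
      have "\<beta> * i' \<le> \<beta> * t2" "\<alpha> * j' \<le> \<alpha> * (u * t1)" using supp[OF l(1)] by (auto intro!: mult_left_mono)
      thus "l \<le> B" unfolding l(2) B_def by linarith
    qed (use finite_support support_nonempty[OF nz] in auto)
    hence "card {(a, b) \<in> affine_points. value_at a b (fpoly c) = 0} \<le> B"
      using card_zeros_le[OF nz deg] by simp
    moreover have "card {k. k < n \<and> word c k = 0} \<le> card {(a, b) \<in> affine_points. value_at a b (fpoly c) = 0}"
    proof (rule card_inj_on_le[of e])
      show "inj_on e {k. k < n \<and> word c k = 0}"
        using e by (auto simp: bij_betw_def intro: inj_on_subset)
      show "e ` {k. k < n \<and> word c k = 0} \<subseteq> {(a, b) \<in> affine_points. value_at a b (fpoly c) = 0}"
      proof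
        fix P assume "P \<in> e ` {k. k < n \<and> word c k = 0}"
        then obtain k where k: "k < n" "word c k = 0" "P = e k" by blast
        thus "P \<in> {(a, b) \<in> affine_points. value_at a b (fpoly c) = 0}"
          using eS[OF k(1)] word_eq[OF k(1), of c] by (auto simp: S_def)
      qed
    qed simp
    ultimately show ?thesis by simp
  qed
  have word_0: "c p = 0" if "word c = (\<lambda>_. 0)" "p \<in> J" for c p
  proof (rule ccontr)
    assume "c p \<noteq> 0"
    from zeros[of p c, OF that(2) this] have "card {k. k < n} \<le> B" by (simp add: that(1))
    thus False using Bn by simp
  qed
  interpret V: vector_space "word_scale :: 'a \<Rightarrow> _" by (rule vector_space_word_scale)
  have sum_w: "(\<Sum>p\<in>J. (\<lambda>k. c p * w p k)) = word c" for c
    by (rule ext) (simp add: word_def sum_fun_apply)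
  have inj_w: "inj_on w J"
  proof (rule inj_onI, rule ccontr)
    fix p p' assume p: "p \<in> J" "p' \<in> J" "w p = w p'" "p \<noteq> p'"
    define c where "c = (\<lambda>r. if r = p then 1 else if r = p' then - 1 else (0::'a))"
    have "word c = (\<lambda>_. 0)"
    proof
      fix k
      have "word c k = (\<Sum>r\<in>{p, p'}. c r * w r k)"
        unfolding word_def using p finJ by (intro sum.mono_neutral_right) (auto simp: c_def)
      thus "word c k = 0" using p by (simp add: c_def)
    qed
    hence "c p = 0" using p(1) by (rule word_0)
    thus False by (simp add: c_def)
  qed
  define C where "C = V.span (w ` J)"
  have in_C: "\<exists>c. z = word c" if z: "z \<in> C" for z
  proof -
    obtain d where "z = (\<Sum>b\<in>w ` J. (\<lambda>k. d b * b k))"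
      using z finJ unfolding C_def by (auto simp: V.span_finite)
    also have "\<dots> = (\<Sum>p\<in>J. (\<lambda>k. d (w p) * w p k))" using inj_w by (simp add: sum.reindex)
    finally show ?thesis using sum_w[of "\<lambda>p. d (w p)"] by auto
  qed
  have indep: "V.independent (w ` J)"
  proof
    assume "V.dependent (w ` J)"
    then obtain d b where d: "b \<in> w ` J" "d b \<noteq> 0" "(\<Sum>b\<in>w ` J. (\<lambda>k. d b * b k)) = 0"
      using finJ by (auto simp: V.dependent_finite)
    have "(\<Sum>b\<in>w ` J. (\<lambda>k. d b * b k)) = word (\<lambda>p. d (w p))"
      using inj_w sum_w[of "\<lambda>p. d (w p)"] by (simp add: sum.reindex)
    hence "word (\<lambda>p. d (w p)) = (\<lambda>_. 0)" using d(3) by (simp add: zero_fun_def)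
    thus False using word_0[of "\<lambda>p. d (w p)"] d(1,2) by auto
  qed
  have dim: "code_dim C = (t1 + 1) * (t2 + 1)"
    unfolding code_dim_def C_def V.dim_span_eq_card_independent[OF indep] card_image[OF inj_w]
    by (simp add: J_def)
  have subC: "(\<lambda>l. c l - c' l) \<in> C" if "c \<in> C" "c' \<in> C" for c c'
    using V.span_diff[of c "w ` J" c'] that by (simp add: C_def fun_diff_def)
  have linear: "linear_code n C"
    unfolding linear_code_def
  proof
    show "C \<subseteq> words n"
    proof
      fix z assume "z \<in> C"
      then obtain c where "z = word c" using in_C by blast
      thus "z \<in> words n" by (simp add: words_def word_def w_def)
    qed
    show "V.subspace C" unfolding C_def by (rule V.subspace_span)
  qed
  have zerosC: "card {l. l < n \<and> z l = 0} \<le> B" if z: "z \<in> C" "z \<noteq> (\<lambda>_. 0)" for z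
  proof -
    obtain c where c: "z = word c" using in_C[OF z(1)] by blast
    have "\<exists>p\<in>J. c p \<noteq> 0"
    proof (rule ccontr)
      assume "\<not> (\<exists>p\<in>J. c p \<noteq> 0)"
      hence "word c = (\<lambda>_. 0)" by (simp add: word_def)
      thus False using z(2) c by simp
    qed
    thus ?thesis using zeros c by auto
  qed
  have dist: "int n - int B \<le> int (min_dist n C)"
  proof (rule min_dist_ge[OF subC zerosC])
    have "(0, 0) \<in> J" by (simp add: J_def)
    hence "w (0, 0) \<in> w ` J" by blast
    thus "w (0, 0) \<in> C" unfolding C_def by (rule V.span_base)
    have "0 \<in> C" unfolding C_def by (rule V.span_zero)
    thus "(\<lambda>_. 0) \<in> C" by (simp add: zero_fun_def)
    have "w (0, 0) 0 = 1" using Bn by (simp add: w_def)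
    thus "w (0, 0) \<noteq> (\<lambda>_. 0)" by (metis zero_neq_one)
  qed
  have recovery: "\<exists>I. disjoint_family_on I {..<length [t2 + 1, t1 + 1]} \<and>
      (\<forall>j<length [t2 + 1, t1 + 1]. recovery_set n C k (I j) \<and> card (I j) = [t2 + 1, t1 + 1] ! j)"
    if k: "k < n" for k
  proof -
    obtain a b where ab: "e k = (a, b)" by fastforce
    have abS: "(a, b) \<in> S" using eS[OF k] by (simp add: ab)
    have b0: "b \<noteq> 0" and curve: "b ^ \<beta> = poly A a" using abS by (auto simp: S_def affine_points_def)
    have k_idx: "idx (a, b) = k" using e k by (simp add: idx_def bij_betw_def flip: ab)
    have idx_set: "idx ` M \<subseteq> {..<n} - {k} \<and> card (idx ` M) = card M" if M: "M \<subseteq> S" "(a, b) \<notin> M" for M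
    proof -
      have "idx P \<noteq> k" if "P \<in> M" for P
        using that M inj_onD[OF inj_idx, of P "(a, b)"] abS k_idx by auto
      moreover have "inj_on idx M" using inj_idx M(1) by (rule inj_on_subset)
      ultimately show ?thesis using M(1) idx(1) by (auto simp: card_image)
    qed
    (* translations of x by roots of A *)
    have A0: "poly A 0 = 0" using A_additive[of 0 0] by (simp only: add_0_right add_cancel_right_right)
    have "card ({r. poly A r = 0} - {0}) = \<alpha> - 1" using counts(2) A0 by (simp add: card_Diff_singleton)
    hence "t2 + 1 \<le> card ({r. poly A r = 0} - {0})" using t2 by simp
    then obtain R where R: "R \<subseteq> {r. poly A r = 0} - {0}" "card R = t2 + 1" "finite R"
      by (rule obtain_subset_with_card_n)
    define X0 where "X0 = (\<lambda>r. (a + r, b)) ` R"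
    have X0S: "X0 \<subseteq> S" using R(1) b0 curve by (auto simp: X0_def S_def affine_points_def A_additive)
    have X0k: "(a, b) \<notin> X0" using R(1) by (auto simp: X0_def)
    have cardX0: "card X0 = t2 + 1" using R(2) by (simp add: X0_def card_image inj_on_def)
    (* multiplications of y by roots of unity, among them \<eta>, which does not change y^u *)
    have \<eta>\<beta>: "\<eta> ^ \<beta> = 1" using u(1) \<eta>(2) by (auto simp: power_mult elim!: dvdE)
    define U where "U = {z::'a. z ^ \<beta> = 1} - {1, \<eta>}"
    have "card U = \<beta> - 2"
      unfolding U_def using counts(3) \<eta> \<eta>\<beta> by (subst card_Diff_subset) auto
    moreover have "t1 \<le> u * t1" using u(2) by simp
    ultimately have "t1 \<le> card U" using t1 by linarith
    then obtain E where E: "E \<subseteq> U" "card E = t1" "finite E" by (rule obtain_subset_with_card_n)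
    define X1 where "X1 = (\<lambda>z. (a, z * b)) ` insert \<eta> E"
    have X1S: "X1 \<subseteq> S"
    proof
      fix P assume "P \<in> X1"
      then obtain z where z: "z \<in> insert \<eta> E" "P = (a, z * b)" by (auto simp: X1_def)
      have "z ^ \<beta> = 1" using z(1) E(1) \<eta>\<beta> by (auto simp: U_def)
      moreover from this have "z \<noteq> 0" using \<beta>_pos by (auto simp: power_0_left)
      ultimately show "P \<in> S" using b0 curve by (simp add: z(2) S_def affine_points_def power_mult_distrib)
    qed
    have X1k: "(a, b) \<notin> X1" using E(1) \<eta> b0 by (auto simp: X1_def U_def)
    have cardX1: "card X1 = t1 + 1"
    proof -
      have "inj_on (\<lambda>z. (a, z * b)) (insert \<eta> E)" using b0 by (intro inj_onI) simp
      moreover have "\<eta> \<notin> E" using E(1) by (auto simp: U_def)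
      ultimately show ?thesis using E(2,3) by (simp add: X1_def card_image del: image_insert)
    qed
    have disj: "X0 \<inter> X1 = {}" using R(1) by (auto simp: X0_def X1_def)
    define I where "I = (\<lambda>j::nat. if j = 0 then idx ` X0 else idx ` X1)"
    have "idx ` X0 \<inter> idx ` X1 = {}"
      using inj_on_image_Int[OF inj_idx X0S X1S] disj by simp
    hence disjoint: "disjoint_family_on I {..<length [t2 + 1, t1 + 1]}"
      by (auto simp: disjoint_family_on_def I_def)
    have rec0: "recovery_set n C k (idx ` X0)"
    proof (rule recovery_setI[OF subC])
      fix z assume z: "z \<in> C" "\<forall>l\<in>idx ` X0. z l = 0"
      obtain c where c: "z = word c" using in_C[OF z(1)] by blast
      define g where "g = (\<Sum>p\<in>J. monom (c p * b ^ (u * fst p)) (snd p))"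
      have g: "poly g x' = value_at x' b (fpoly c)" for x'
        by (simp add: g_def value_fpoly poly_sum poly_monom mult_ac)
      have degg: "degree g \<le> t2"
        unfolding g_def by (intro degree_sum_le finJ order.trans[OF degree_monom_le]) (auto simp: J_def)
      have roots: "(\<lambda>r. a + r) ` R \<subseteq> {x'. poly g x' = 0}"
      proof safe
        fix r assume r: "r \<in> R"
        hence P: "(a + r, b) \<in> X0" by (simp add: X0_def)
        hence "word c (idx (a + r, b)) = 0" using z(2) c by simp
        thus "poly g (a + r) = 0" using idx[of "(a + r, b)"] P X0S by (simp add: word_eq g subset_iff)
      qed
      have "g = 0"
      proof (rule ccontr)
        assume "g \<noteq> 0"
        have "t2 + 1 = card ((\<lambda>r. a + r) ` R)" using R(2) by (simp add: card_image)
        also have "\<dots> \<le> card {x'. poly g x' = 0}" by (rule card_mono[OF _ roots]) simp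
        also have "\<dots> \<le> t2" using card_poly_roots_bound[OF \<open>g \<noteq> 0\<close>] degg by simp
        finally show False by simp
      qed
      thus "z k = 0" using g[of a] by (simp add: c word_eq[OF k] ab)
    qed (use idx_set[OF X0S X0k] cardX0 in auto)
    have rec1: "recovery_set n C k (idx ` X1)"
    proof (rule recovery_setI[OF subC])
      fix z assume z: "z \<in> C" "\<forall>l\<in>idx ` X1. z l = 0"
      obtain c where c: "z = word c" using in_C[OF z(1)] by blast
      have P: "(a, \<eta> * b) \<in> X1" by (simp add: X1_def)
      hence "word c (idx (a, \<eta> * b)) = 0" using z(2) c by simp
      hence "value_at a (\<eta> * b) (fpoly c) = 0" using idx[of "(a, \<eta> * b)"] P X1S by (simp add: word_eq subset_iff)
      moreover have "(\<eta> * b) ^ (u * i) = b ^ (u * i)" for i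
        using \<eta>(2) by (simp add: power_mult_distrib power_mult)
      ultimately have "value_at a b (fpoly c) = 0" by (simp add: value_fpoly)
      thus "z k = 0" by (simp add: c word_eq[OF k] ab)
    qed (use idx_set[OF X1S X1k] cardX1 in auto)
    have "recovery_set n C k (I j) \<and> card (I j) = [t2 + 1, t1 + 1] ! j" if "j < length [t2 + 1, t1 + 1]" for j
      using that rec0 rec1 idx_set[OF X0S X0k] idx_set[OF X1S X1k] cardX0 cardX1
      by (cases j) (auto simp: I_def)
    thus ?thesis using disjoint by blast
  qed
  have "is_LRC n ((t1 + 1) * (t2 + 1)) (min_dist n C) [t2 + 1, t1 + 1] C"
    unfolding is_LRC_def using linear dim recovery by blast
  thus ?thesis using dist unfolding B_def by blast
qed

end

lemma mult_order:
  fixes a :: "'a::{field,finite}"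
  assumes "a \<noteq> 0"
  shows "0 < mult_order a" and "a ^ mult_order a = 1"
proof -
  have "\<not> inj_on (\<lambda>k::nat. a ^ k) UNIV" using finite_imageD[of "\<lambda>k::nat. a ^ k" UNIV] by auto
  then obtain i j where ij: "i < j" "a ^ i = a ^ j" by (metis (full_types) inj_onI linorder_neqE_nat)
  have "a ^ j = a ^ i * a ^ (j - i)" using ij(1) by (simp flip: power_add)
  hence "0 < j - i \<and> a ^ (j - i) = 1" using ij assms by simp
  hence "0 < mult_order a \<and> a ^ mult_order a = 1" unfolding mult_order_def by (rule LeastI)
  thus "0 < mult_order a" and "a ^ mult_order a = 1" by auto
qed

theorem theorem3p2p1:
  fixes q \<alpha> \<beta> u v m t1 t2 n :: nat
    and A :: "'a::{field,finite} poly"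
    and eta lam :: 'a
    and \<iota> :: "'a \<Rightarrow> 'f::field"
    and x y :: 'f
  assumes "primepow q"
    and "CARD('a) = q\<^sup>2"
    and "additive_poly A"
    and "separable_poly A"
    and "degree A = \<alpha>"
    and "coprime \<alpha> \<beta>"
    and "absolutely_irreducible (monom 1 \<beta> - [:A:])"
    and "is_function_field \<iota> x y (monom 1 \<beta> - [:A:])"
    and "maximal_curve q \<iota>"
    and "eta \<noteq> 0" and "lam \<noteq> 0"
    and "u = mult_order eta" and "v = mult_order lam"
    and "u dvd \<beta>" and "v dvd \<beta>"
    and "1 < u" and "u \<le> v"
    and "gcd u v = m" and "1 < m"
    and "real t1 \<le> (real v - 2) / real u"
    and "int t2 \<le> int \<alpha> - 2"
    and "n = q\<^sup>2 + (\<beta> - 1) * (\<alpha> - 1) * q - \<alpha>"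
  shows "\<exists>(C :: (nat \<Rightarrow> 'a) set) d.
           is_LRC n ((t1 + 1) * (t2 + 1)) d [t2 + 1, t1 + 1] C \<and>
           int n - int \<alpha> * int u * int t1 - int \<beta> * int t2 \<le> int d"
proof -
  have t2: "t2 + 2 \<le> \<alpha>" using \<open>int t2 \<le> int \<alpha> - 2\<close> by linarith
  have \<beta>0: "\<beta> > 0"
  proof (rule Nat.gr0I)
    assume "\<beta> = 0"
    hence "\<alpha> = 1" using \<open>coprime \<alpha> \<beta>\<close> by simp
    thus False using t2 by simp
  qed
  hence "u \<le> \<beta>" "v \<le> \<beta>" using \<open>u dvd \<beta>\<close> \<open>v dvd \<beta>\<close> by (auto intro: dvd_imp_le)
  interpret kummer_function_field A \<alpha> \<beta> \<iota> x y
    using assms t2 \<open>u \<le> \<beta>\<close> by unfold_locales auto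
  have "real t1 * real u \<le> real v - 2"
    using \<open>real t1 \<le> (real v - 2) / real u\<close> \<open>1 < u\<close> by (simp add: pos_le_divide_eq)
  hence "real (u * t1 + 2) \<le> real v" by (simp add: mult.commute)
  hence t1: "u * t1 + 2 \<le> \<beta>" using \<open>v \<le> \<beta>\<close> by (simp only: of_nat_le_iff)
  have eta: "eta ^ u = 1" unfolding \<open>u = mult_order eta\<close> using \<open>eta \<noteq> 0\<close> by (rule mult_order)
  have "eta \<noteq> 1"
  proof
    assume "eta = 1"
    hence "mult_order eta \<le> 1" unfolding mult_order_def by (intro Least_le) simp
    thus False using \<open>u = mult_order eta\<close> \<open>1 < u\<close> by simp
  qed
  from exists_LRC[OF \<open>maximal_curve q \<iota>\<close> \<open>CARD('a) = q\<^sup>2\<close> this eta \<open>u dvd \<beta>\<close> _ t1 t2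
      \<open>n = q\<^sup>2 + (\<beta> - 1) * (\<alpha> - 1) * q - \<alpha>\<close>] \<open>1 < u\<close>
  obtain C d where "is_LRC n ((t1 + 1) * (t2 + 1)) d [t2 + 1, t1 + 1] (C :: (nat \<Rightarrow> 'a) set)"
    and "int n - int (\<alpha> * (u * t1) + \<beta> * t2) \<le> int d" by auto
  thus ?thesis by (intro exI[of _ C] exI[of _ d]) (simp add: algebra_simps)
qed

end
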